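(* Let $N\ge1$, $p_F:=1+2/N$ and $1<p\le p_F$. There exist constants $\gamma_2=\gamma_2(N,p,\alpha)>0$, $\alpha\in(0,1)$, depending only on $N,p,\alpha$, such that the following holds. Let $\alpha\in(0,1)$ and $T>0$. If $\mu$ is a nonnegative Radon measure on $\mathbf{R}^N$ satisfying $$\sup_{z\in\mathbf{R}^N}\mu\big(B(z;T^{\frac\alpha2})\big)\le\gamma_2\,T^{\alpha\left(\frac N2-\frac1{p-1}\right)},$$ then the problem $$(\mathrm{P})_\alpha:\qquad {}^{C}\partial_t^\alpha u-\Delta u=u^p\quad (t>0,\ x\in\mathbf{R}^N),\qquad u(0)=\mu\ \text{ in }\mathbf{R}^N,$$ possesses a solution in $[0,T)\times\mathbf{R}^N$. Furthermore, these constants satisfy the following. (i) If $1<p<p_F$, then $\limsup_{\alpha\to1-0}\gamma_2(N,p,\alpha)\in(0,\infty)$. (ii) If $p=p_F$, then one can take $\gamma_2'(\alpha)$ such that $\gamma_2(N,p_F,\alpha)\le\gamma_2'(\alpha)(1-\alpha)^{\frac N2}$ and $\limsup_{\alpha\to1-0}\gamma_2'(\alpha)\in(0,\infty)$.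
   Context: $B(z;r):=\{y\in\mathbf{R}^N;\ |z-y|<r\}$. For $t>0$, $x\in\mathbf{R}^N$, $G(t,x):=(4\pi t)^{-N/2}\exp(-|x|^2/(4t))$, and for a Radon measure $\mu$ on $\mathbf{R}^N$, $e^{t\Delta}\mu(x):=\int_{\mathbf{R}^N}G(t,x-y)\,d\mu(y)$. A locally integrable function $\phi$ is identified with the Radon measure $\phi\,dx$. For $\alpha\in(0,1)$, $h_\alpha>0$ denotes the probability density function on $(0,\infty)$ characterized by $$\int_0^\infty h_\alpha(\theta)e^{z\theta}\,d\theta=E_{\alpha,1}(z),\qquad z\in\mathbf{C},\qquad\text{where } E_{\alpha,\beta}(z):=\sum_{k=0}^\infty\frac{z^k}{\Gamma(\alpha k+\beta)}$$ is the Mittag--Leffler function. It also satisfies $\int_0^\infty\alpha\theta h_\alpha(\theta)e^{z\theta}\,d\theta=E_{\alpha,\alpha}(z)$ for $z\in\mathbf{C}$ and $\int_0^\infty\theta^\delta h_\alpha(\theta)\,d\theta=\Gamma(1+\delta)/\Gamma(1+\alpha\delta)<\infty$ for $\delta>-1$. Set, for $t>0$, $$P_\alpha(t)\mu:=\int_0^\infty h_\alpha(\theta)\,e^{t^\alpha\theta\Delta}\mu\,d\theta,\qquad S_\alpha(t)\mu:=\int_0^\infty\theta h_\alpha(\theta)\,e^{t^\alpha\theta\Delta}\mu\,d\theta.$$ Here ${}^{C}\partial_t^\alpha$ is the Caputo derivative of order $\alpha$, $({}^{C}\partial_t^\alpha f)(t)=\frac{1}{\Gamma(1-\alpha)}\frac{d}{dt}\int_0^t\frac{f(s)-f(0)}{(t-s)^\alpha}\,ds$,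 but solutions are understood in the following integral sense. Definition of solution: for $T\in(0,\infty]$, a nonnegative measurable function $u$ on $(0,T)\times\mathbf{R}^N$ is a solution of $(\mathrm{P})_\alpha$ in $[0,T)\times\mathbf{R}^N$ if $$\infty>u(t,x)=[P_\alpha(t)\mu](x)+\alpha\int_0^t(t-s)^{\alpha-1}[S_\alpha(t-s)u(s)^p](x)\,ds$$ for almost all $t\in(0,T)$ and $x\in\mathbf{R}^N$. *)

theory Defs
  imports "HOL-Analysis.Analysis"
begin

definition fujita_exponent :: "nat \<Rightarrow> real" where
  "fujita_exponent N = 1 + 2 / real N"

text \<open>On \<open>\<real>\<^sup>N\<close> inner regularity follows from the other two conditions; it is listed because it
  belongs to the usual definition of a Radon measure. Nonnegativity is built into \<^typ>\<open>'a measure\<close>.\<close>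

definition radon_measure :: "'a::topological_space measure \<Rightarrow> bool" where
  "radon_measure \<mu> \<longleftrightarrow>
     sets \<mu> = sets borel \<and>
     (\<forall>K. compact K \<longrightarrow> emeasure \<mu> K < \<infinity>) \<and>
     (\<forall>B\<in>sets borel. emeasure \<mu> B = (SUP K\<in>{K. compact K \<and> K \<subseteq> B}. emeasure \<mu> K))"

definition heat_kernel :: "real \<Rightarrow> real ^ 'n \<Rightarrow> real" where
  "heat_kernel t x =
     (4 * pi * t) powr (- real CARD('n) / 2) * exp (- (norm x)\<^sup>2 / (4 * t))"

definition heat_op :: "real \<Rightarrow> (real ^ 'n) measure \<Rightarrow> real ^ 'n \<Rightarrow> ennreal" where
  "heat_op t \<mu> x = (\<integral>\<^sup>+ y. ennreal (heat_kernel t (x - y)) \<partial>\<mu>)"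

definition mittag_leffler :: "real \<Rightarrow> real \<Rightarrow> complex \<Rightarrow> complex" where
  "mittag_leffler \<alpha> \<beta> z = (\<Sum>k. z ^ k / of_real (Gamma (\<alpha> * real k + \<beta>)))"

definition is_subordination_density :: "real \<Rightarrow> (real \<Rightarrow> real) \<Rightarrow> bool" where
  "is_subordination_density \<alpha> h \<longleftrightarrow>
     h \<in> borel_measurable borel \<and>
     (\<forall>\<theta>>0. 0 < h \<theta>) \<and>
     (\<integral>\<^sup>+ \<theta>\<in>{0<..}. ennreal (h \<theta>) \<partial>lborel) = 1 \<and>
     (\<forall>z::complex.
        set_integrable lborel {0<..} (\<lambda>\<theta>. of_real (h \<theta>) * exp (z * of_real \<theta>)) \<and>
        (LINT \<theta>:{0<..}|lborel. of_real (h \<theta>) * exp (z * of_real \<theta>)) = mittag_leffler \<alpha> 1 z)"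

text \<open>The characterization determines \<open>h\<^sub>\<alpha>\<close> up to null sets of \<open>(0,\<infinity>)\<close>, so the integrals below
  do not depend on the choice. Values on \<open>(-\<infinity>,0]\<close> are irrelevant.\<close>

definition subordination_density :: "real \<Rightarrow> real \<Rightarrow> real" where
  "subordination_density \<alpha> = (SOME h. is_subordination_density \<alpha> h)"

definition P_op :: "real \<Rightarrow> real \<Rightarrow> (real ^ 'n) measure \<Rightarrow> real ^ 'n \<Rightarrow> ennreal" where
  "P_op \<alpha> t \<mu> x =
     (\<integral>\<^sup>+ \<theta>\<in>{0<..}. ennreal (subordination_density \<alpha> \<theta>) * heat_op (t powr \<alpha> * \<theta>) \<mu> x \<partial>lborel)"

definition S_op :: "real \<Rightarrow> real \<Rightarrow> (real ^ 'n) measure \<Rightarrow> real ^ 'n \<Rightarrow> ennreal" where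
  "S_op \<alpha> t \<mu> x =
     (\<integral>\<^sup>+ \<theta>\<in>{0<..}. ennreal (\<theta> * subordination_density \<alpha> \<theta>) * heat_op (t powr \<alpha> * \<theta>) \<mu> x \<partial>lborel)"

definition ennreal_pow :: "ennreal \<Rightarrow> real \<Rightarrow> ennreal" where
  "ennreal_pow v p = (if v = \<infinity> then \<infinity> else ennreal (enn2real v powr p))"

text \<open>A nonnegative function \<open>\<phi>\<close> is identified with the measure \<open>\<phi> dx\<close>, that is
  \<^term>\<open>density lborel \<phi>\<close>. The equation is required for almost every \<open>(t,x)\<close> with respect to
  Lebesgue measure on \<open>(0,T) \<times> \<real>\<^sup>N\<close>; finiteness of the right-hand side there forces
  \<open>u(s)\<^sup>p\<close> to be locally integrable for almost every \<open>s\<close>.\<close>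

definition is_solution ::
  "real \<Rightarrow> real \<Rightarrow> ereal \<Rightarrow> (real ^ 'n) measure \<Rightarrow> (real \<Rightarrow> real ^ 'n \<Rightarrow> ennreal) \<Rightarrow> bool" where
  "is_solution \<alpha> p T \<mu> u \<longleftrightarrow>
     (\<lambda>(t, x). u t x) \<in> borel_measurable (restrict_space borel ({t. 0 < t \<and> ereal t < T} \<times> UNIV)) \<and>
     (AE (t, x) in lborel. 0 < t \<and> ereal t < T \<longrightarrow>
        u t x < \<infinity> \<and>
        u t x = P_op \<alpha> t \<mu> x +
          ennreal \<alpha> * (\<integral>\<^sup>+ s\<in>{0<..<t}. ennreal ((t - s) powr (\<alpha> - 1)) *
             S_op \<alpha> (t - s) (density lborel (\<lambda>y. ennreal_pow (u s y) p)) x \<partial>lborel))"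

end

theory Submission
  imports Defs "HOL-Probability.Levy"
begin

text \<open>The density \<open>h\<^sub>\<alpha>\<close> exists because the random variable \<open>\<Theta> = K(\<phi>) L\<^bsup>1-\<alpha>\<^esup>\<close>, with \<open>\<phi>\<close> uniform
  on \<open>(0,\<pi>)\<close>, \<open>L\<close> exponential and \<open>K\<close> Kanter's function, has moments \<open>n!/\<Gamma>(1+\<alpha>n)\<close>; it is unique
  by Levy's theorem on characteristic functions. As \<open>sin \<phi> \<le> K(\<phi>) \<le> e\<close>, the moments
  \<open>E(\<Theta>\<^bsup>-a\<^esup> e\<^bsup>c\<Theta>\<^esup>)\<close> with \<open>a < 1\<close> are bounded uniformly as \<open>\<alpha>\<close> tends to 1.

  Put \<open>a = N(p-1)/(2p)\<close>, so that \<open>pa \<le> 1\<close> and hence \<open>a < 1\<close>. By Minkowski's inequality,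
  \<open>P\<^sub>\<alpha>(t)\<close> and \<open>S\<^sub>\<alpha>(t)\<close> map uniformly local measures to functions that are uniformly locally in
  \<open>L\<^sup>p\<close>, with norm of order \<open>t\<^bsup>-\<alpha>a\<^esup>\<close>. Since \<open>p\<alpha>a < 1\<close> even in the critical case \<open>pa = 1\<close>, the
  Duhamel integral converges, and small data keep the increasing Picard iterates bounded by
  \<open>A t\<^bsup>-\<alpha>a\<^esup>\<close> in this norm. Their supremum is finite almost everywhere and solves the equation by
  monotone convergence.\<close>

section \<open>The subordination density\<close>

text \<open>By Kanter's representation, S = (A(\<phi>)/L)^((1-\<alpha>)/\<alpha>) with A(\<phi>) =
  \<open>kanter \<alpha> \<phi>\<close> to the power -1/(1-\<alpha>) is a one-sided \<alpha>-stable
  variable, so \<Theta> is S^(-\<alpha>). Moments would identify its law but do not show how much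
  mass lies near 0; the negative moments, called for by the singularity \<tau>^(-a) of the heat
  kernel, are read off from the explicit form. The exponent a = (N/2)(1 - 1/p) is the smoothing rate
  of the heat semigroup from L^1 to L^p. The Duhamel term leads to the Beta integral of
  u^(-p\<alpha>a) (1-u)^(\<alpha>-\<alpha>a-1). Its exponent at u = 0 stays away from -1 as \<alpha>
  tends to 1 iff pa < 1, that is p < p_F; for p = p_F the integral grows like 1/(1-\<alpha>). The
  smallness condition raises this integral to the power -1/(p-1), which is -N/2 for p = p_F: hence
  the two cases of the theorem and the rate (1-\<alpha>)^(N/2).\<close>

text \<open>The value at \<open>\<i> * of_real pi\<close> is pi times the generalized binomial
  coefficient n!/(Gamma(1+x) Gamma(1+n-x)). Expanding one factor 1 + e^z gives the primitives for
  (n, x) and (n, x-1), whose values add up by Pascal's rule; n = 0 is the reflection formula.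
  Reciprocal Gamma functions keep the formula valid at the poles of Gamma.\<close>

lemma binomial_exp_primitive:
  fixes x :: real
  shows "\<exists>\<Phi>::complex \<Rightarrow> complex.
    (\<forall>z. (\<Phi> has_field_derivative ((1 + exp z) ^ n * exp (- (of_real x * z)))) (at z)) \<and>
    (\<forall>r. Im (\<Phi> (of_real r)) = 0) \<and>
    Im (\<Phi> (\<i> * of_real pi)) = pi * fact n * rGamma (1 + x) * rGamma (1 + real n - x)"
proof (induction n arbitrary: x)
  case 0
  show ?case
  proof (cases "x = 0")
    case True
    then show ?thesis by (intro exI[of _ "\<lambda>z. z"]) auto
  next
    case False
    have "rGamma (complex_of_real x) * rGamma (1 - of_real x) = sin (of_real pi * of_real x) / of_real pi"
      by (rule rGamma_reflection_complex)
    then have "complex_of_real (rGamma x * rGamma (1 - x)) = of_real (sin (pi * x) / pi)"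
      unfolding of_real_mult of_real_divide rGamma_complex_of_real[symmetric] sin_of_real[symmetric]
      by simp
    then have r: "rGamma x * rGamma (1 - x) = sin (pi * x) / pi" using of_real_eq_iff by blast
    have r1: "x * rGamma (1 + x) = rGamma x" using rGamma_plus1[of x] by (simp add: add.commute)
    have r2: "x * (pi * rGamma (1 + x) * rGamma (1 - x)) = sin (pi * x)"
      using r by (simp add: field_simps flip: r1)
    define \<Phi> where "\<Phi> = (\<lambda>z. - exp (- (complex_of_real x * z)) / of_real x)"
    have "(\<Phi> has_field_derivative exp (- (of_real x * z))) (at z)" for z
      unfolding \<Phi>_def using False by (auto intro!: derivative_eq_intros simp: field_simps)
    moreover have "Im (\<Phi> (of_real r)) = 0" for r
    proof -
      have "\<Phi> (of_real r) = of_real (- exp (- (x * r)) / x)"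
        unfolding \<Phi>_def by (simp flip: exp_of_real)
      then show ?thesis by (metis Im_complex_of_real)
    qed
    moreover have "Im (\<Phi> (\<i> * of_real pi)) = pi * rGamma (1 + x) * rGamma (1 - x)"
    proof -
      have "Im (\<Phi> (\<i> * of_real pi)) = sin (pi * x) / x"
        unfolding \<Phi>_def by (simp add: Im_exp Im_divide_of_real mult.commute)
      also have "\<dots> = pi * rGamma (1 + x) * rGamma (1 - x)" unfolding r2[symmetric] using False by simp
      finally show ?thesis .
    qed
    ultimately show ?thesis by (intro exI[of _ \<Phi>]) auto
  qed
next
  case (Suc n)
  obtain \<Phi> where \<Phi>: "\<And>z. (\<Phi> has_field_derivative ((1 + exp z) ^ n * exp (- (of_real x * z)))) (at z)"
    "\<And>r. Im (\<Phi> (of_real r)) = 0"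
    "Im (\<Phi> (\<i> * of_real pi)) = pi * fact n * rGamma (1 + x) * rGamma (1 + real n - x)"
    using Suc.IH[of x] by blast
  obtain \<Psi> where \<Psi>: "\<And>z. (\<Psi> has_field_derivative ((1 + exp z) ^ n * exp (- (of_real (x - 1) * z)))) (at z)"
    "\<And>r. Im (\<Psi> (of_real r)) = 0"
    "Im (\<Psi> (\<i> * of_real pi)) = pi * fact n * rGamma (1 + (x - 1)) * rGamma (1 + real n - (x - 1))"
    using Suc.IH[of "x - 1"] by blast
  have 1: "((\<lambda>z. \<Phi> z + \<Psi> z) has_field_derivative ((1 + exp z) ^ Suc n * exp (- (of_real x * z)))) (at z)" for z
  proof -
    have "exp (- (of_real (x - 1) * z)) = exp z * exp (- (of_real x * z))"
      by (simp add: algebra_simps flip: exp_add)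
    then show ?thesis using DERIV_add[OF \<Phi>(1)[of z] \<Psi>(1)[of z]] by (simp add: algebra_simps)
  qed
  have r1: "rGamma x = x * rGamma (1 + x)" using rGamma_plus1[of x] by (simp add: add.commute)
  have r2: "rGamma (1 + real n - x) = (1 + real n - x) * rGamma (2 + real n - x)"
    using rGamma_plus1[of "1 + real n - x"] by (simp add: algebra_simps)
  have "Im (\<Phi> (\<i> * of_real pi) + \<Psi> (\<i> * of_real pi)) =
      pi * fact (Suc n) * rGamma (1 + x) * rGamma (1 + real (Suc n) - x)"
  proof -
    have e: "1 + real n - (x - 1) = 2 + real n - x" "1 + real (Suc n) - x = 2 + real n - x" "1 + (x - 1) = x" by auto
    show ?thesis unfolding plus_complex.simps \<Phi>(3) \<Psi>(3) e r2 r1 by (simp add: algebra_simps)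
  qed
  with 1 \<Phi>(2) \<Psi>(2) show ?case by (intro exI[of _ "\<lambda>z. \<Phi> z + \<Psi> z"]) auto
qed

definition kanter :: "real \<Rightarrow> real \<Rightarrow> real" where
  "kanter \<alpha> \<phi> = sin \<phi> / (sin (\<alpha> * \<phi>) powr \<alpha> * sin ((1 - \<alpha>) * \<phi>) powr (1 - \<alpha>))"

lemma sin_scaled_pos:
  assumes "0 < \<alpha>" "\<alpha> < 1" "0 < \<phi>" "\<phi> < pi"
  shows "0 < sin (\<alpha> * \<phi>)" "0 < sin ((1 - \<alpha>) * \<phi>)"
proof -
  have "\<alpha> * \<phi> < 1 * pi" "(1 - \<alpha>) * \<phi> < 1 * pi" using assms by (intro mult_strict_mono; simp)+
  then show "0 < sin (\<alpha> * \<phi>)" "0 < sin ((1 - \<alpha>) * \<phi>)" using assms by (auto intro!: sin_gt_zero)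
qed

lemma kanter_pos:
  assumes "0 < \<alpha>" "\<alpha> < 1" "0 < \<phi>" "\<phi> < pi"
  shows "0 < kanter \<alpha> \<phi>"
  unfolding kanter_def using sin_scaled_pos[OF assms] assms
  by (auto intro!: divide_pos_pos mult_pos_pos sin_gt_zero)

lemma tendsto_sin_scaled: "((\<lambda>x. sin (c * x) / x) \<longlongrightarrow> c) (at (0::real))"
proof -
  have "((\<lambda>x. sin (c * x)) has_real_derivative c) (at 0)"
    by (auto intro!: derivative_eq_intros)
  then show ?thesis by (simp add: DERIV_def)
qed

text \<open>The primitive is evaluated along \<open>\<zeta>(t) = ln \<rho>(t) + \<i>t\<close>, the curve on which the integrand
  \<open>(1 + e\<^sup>\<zeta>)\<^sup>n e\<^bsup>-\<alpha>n\<zeta>\<^esup>\<close> is real and equals the \<open>n\<close>-th power of Kanter's function. It runs from a real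
  point to \<open>\<i>\<pi>\<close>, so only the end point contributes to the imaginary part.\<close>

lemma kanter_power_integral:
  assumes "0 < \<alpha>" "\<alpha> < 1"
  shows "(\<integral>\<^sup>+\<phi>\<in>{0<..<pi}. ennreal (kanter \<alpha> \<phi> ^ n) \<partial>lborel) =
    ennreal (pi * fact n * rGamma (1 + \<alpha> * real n) * rGamma (1 + (1 - \<alpha>) * real n))"
proof -
  define b where "b = 1 - \<alpha>"
  have b: "0 < b" "b < 1" using assms by (auto simp: b_def)
  obtain \<Phi> where \<Phi>: "\<And>z. (\<Phi> has_field_derivative ((1 + exp z) ^ n * exp (- (of_real (\<alpha> * n) * z)))) (at z)"
    "\<And>r. Im (\<Phi> (of_real r)) = 0"
    "Im (\<Phi> (\<i> * of_real pi)) = pi * fact n * rGamma (1 + \<alpha> * n) * rGamma (1 + real n - \<alpha> * n)"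
    using binomial_exp_primitive[of n "\<alpha> * n"] by blast
  define \<rho> where "\<rho> = (\<lambda>t. sin (\<alpha> * t) / sin (b * t))"
  define \<zeta> where "\<zeta> = (\<lambda>t. complex_of_real (ln (\<rho> t)) + \<i> * of_real t)"
  have pos: "0 < sin (\<alpha> * t)" "0 < sin (b * t)" "0 < \<rho> t" if "0 < t" "t < pi" for t
    using sin_scaled_pos[OF assms that] by (auto simp: b_def \<rho>_def)
  have contPhi: "isCont \<Phi> z" for z using \<Phi>(1) DERIV_isCont by blast
  \<comment> \<open>On this curve the argument of 1 + e^\<zeta> is \<alpha>t, exactly \<alpha> times
    that of e^\<zeta>, so the phases of the two factors cancel.\<close>
  have key: "(1 + exp (\<zeta> t)) ^ n * exp (- (of_real (\<alpha> * n) * \<zeta> t)) = of_real (kanter \<alpha> t ^ n)"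
    if t: "0 < t" "t < pi" for t
  proof -
    note p = pos[OF t]
    have bt: "b * t = t - \<alpha> * t" by (simp add: b_def algebra_simps)
    have ez: "exp (\<zeta> t) = of_real (\<rho> t) * exp (\<i> * of_real t)"
      unfolding \<zeta>_def exp_add using p by (simp add: exp_of_real)
    have "1 + exp (\<zeta> t) = of_real (sin t / sin (b * t)) * exp (\<i> * of_real (\<alpha> * t))"
    proof (rule complex_eqI)
      have "sin (b * t) + cos t * sin (\<alpha> * t) = cos (\<alpha> * t) * sin t"
        unfolding bt sin_diff by simp
      then show "Re (1 + exp (\<zeta> t)) = Re (of_real (sin t / sin (b * t)) * exp (\<i> * of_real (\<alpha> * t)))"
        unfolding ez \<rho>_def using p by (simp add: Re_exp field_simps)
      show "Im (1 + exp (\<zeta> t)) = Im (of_real (sin t / sin (b * t)) * exp (\<i> * of_real (\<alpha> * t)))"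
        unfolding ez \<rho>_def using p by (simp add: Im_exp field_simps)
    qed
    then have "(1 + exp (\<zeta> t)) ^ n = of_real ((sin t / sin (b * t)) ^ n) * exp (\<i> * of_real (\<alpha> * t)) ^ n"
      by (simp only: power_mult_distrib of_real_power)
    also have "exp (\<i> * of_real (\<alpha> * t)) ^ n = exp (\<i> * of_real (\<alpha> * n * t))"
      unfolding exp_of_nat_mult[symmetric] by (simp add: mult_ac)
    finally have 1: "(1 + exp (\<zeta> t)) ^ n = of_real ((sin t / sin (b * t)) ^ n) * exp (\<i> * of_real (\<alpha> * n * t))" .
    have "exp (- (of_real (\<alpha> * n) * \<zeta> t)) = exp (of_real (- (\<alpha> * n) * ln (\<rho> t))) * exp (- (\<i> * of_real (\<alpha> * n * t)))"
      unfolding \<zeta>_def by (simp add: algebra_simps flip: exp_add)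
    also have "exp (of_real (- (\<alpha> * n) * ln (\<rho> t))) = complex_of_real (\<rho> t powr (- (\<alpha> * n)))"
      using p unfolding exp_of_real by (simp add: powr_def)
    finally have 2: "exp (- (of_real (\<alpha> * n) * \<zeta> t)) = of_real (\<rho> t powr (- (\<alpha> * n))) * exp (- (\<i> * of_real (\<alpha> * n * t)))" .
    have "(1 + exp (\<zeta> t)) ^ n * exp (- (of_real (\<alpha> * n) * \<zeta> t)) =
        of_real ((sin t / sin (b * t)) ^ n * \<rho> t powr (- (\<alpha> * n))) * (exp (\<i> * of_real (\<alpha> * n * t)) * exp (- (\<i> * of_real (\<alpha> * n * t))))"
      unfolding 1 2 by simp
    also have "exp (\<i> * of_real (\<alpha> * n * t)) * exp (- (\<i> * of_real (\<alpha> * n * t))) = 1"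
      by (simp flip: exp_add)
    finally have 3: "(1 + exp (\<zeta> t)) ^ n * exp (- (of_real (\<alpha> * n) * \<zeta> t)) = of_real ((sin t / sin (b * t)) ^ n * \<rho> t powr (- (\<alpha> * n)))"
      by simp
    have "\<rho> t powr (- (\<alpha> * n)) = (\<rho> t powr - \<alpha>) ^ n"
      using p by (simp add: powr_powr flip: powr_realpow)
    also have "\<rho> t powr - \<alpha> = sin (b * t) powr \<alpha> / sin (\<alpha> * t) powr \<alpha>"
      using p by (simp add: \<rho>_def powr_minus powr_divide)
    also have "sin (b * t) powr \<alpha> = sin (b * t) / sin (b * t) powr b"
      using p by (simp add: b_def powr_diff field_simps)
    finally have "(sin t / sin (b * t)) ^ n * \<rho> t powr (- (\<alpha> * n)) = kanter \<alpha> t ^ n"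
      using p unfolding kanter_def b_def by (simp add: field_simps)
    with 3 show ?thesis by simp
  qed
  have d\<rho>: "\<exists>d. (\<rho> has_real_derivative d) (at t)" if t: "0 < t" "t < pi" for t
    unfolding \<rho>_def using pos[OF t] by (auto intro!: exI derivative_eq_intros)
  define F where "F = (\<lambda>t. Im (\<Phi> (\<zeta> t)))"
  have D: "DERIV F t :> kanter \<alpha> t ^ n" if t: "0 < t" "t < pi" for t
  proof -
    obtain d where "(\<rho> has_real_derivative d) (at t)" using d\<rho>[OF t] by blast
    then have l: "((\<lambda>t. ln (\<rho> t)) has_real_derivative (d / \<rho> t)) (at t)"
      using pos[OF t] by (auto intro!: derivative_eq_intros)
    have "((\<lambda>t. complex_of_real (ln (\<rho> t))) has_vector_derivative of_real (d / \<rho> t)) (at t)"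
      by (rule has_vector_derivative_of_real) (use l in \<open>simp add: has_real_derivative_iff_has_vector_derivative\<close>)
    moreover have "((\<lambda>t. \<i> * complex_of_real t) has_vector_derivative \<i>) (at t)"
      by (auto intro!: derivative_eq_intros)
    ultimately have "(\<zeta> has_vector_derivative (of_real (d / \<rho> t) + \<i>)) (at t)"
      unfolding \<zeta>_def by (rule has_vector_derivative_add)
    from field_vector_diff_chain_at[OF this \<Phi>(1)]
    have "((\<Phi> \<circ> \<zeta>) has_vector_derivative (of_real (d / \<rho> t) + \<i>) * of_real (kanter \<alpha> t ^ n)) (at t)"
      unfolding key[OF t] .
    from bounded_linear.has_vector_derivative[OF bounded_linear_Im this]
    show ?thesis unfolding F_def has_real_derivative_iff_has_vector_derivative
      by (simp add: o_def)
  qed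
  \<comment> \<open>The curve starts at the real point ln(\<alpha>/(1-\<alpha>)), where the
    imaginary part of \<Phi> vanishes.\<close>
  have \<rho>0: "(\<rho> \<longlongrightarrow> \<alpha> / b) (at_right 0)"
  proof -
    have "((\<lambda>t. (sin (\<alpha> * t) / t) / (sin (b * t) / t)) \<longlongrightarrow> \<alpha> / b) (at_right 0)"
      using b by (intro tendsto_divide tendsto_within_subset[OF tendsto_sin_scaled]) auto
    moreover have "\<forall>\<^sub>F t in at_right 0. (sin (\<alpha> * t) / t) / (sin (b * t) / t) = \<rho> t"
      unfolding \<rho>_def eventually_at_right_field by (auto intro!: exI[of _ 1])
    ultimately show ?thesis by (rule Lim_transform_eventually)
  qed
  have F0: "(F \<longlongrightarrow> 0) (at_right 0)"
  proof -
    have "(\<zeta> \<longlongrightarrow> of_real (ln (\<alpha> / b)) + \<i> * of_real 0) (at_right 0)"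
      unfolding \<zeta>_def using assms b
      by (intro tendsto_intros \<rho>0) auto
    from isCont_tendsto_compose[OF contPhi this]
    have "(F \<longlongrightarrow> Im (\<Phi> (of_real (ln (\<alpha> / b)) + \<i> * of_real 0))) (at_right 0)"
      unfolding F_def by (intro tendsto_Im)
    then show ?thesis using \<Phi>(2) by simp
  qed
  have Fpi: "(F \<longlongrightarrow> Im (\<Phi> (\<i> * of_real pi))) (at_left pi)"
  proof -
    \<comment> \<open>The angles (1-\<alpha>)pi and \<alpha>pi are supplementary, so \<rho>(pi) = 1
      and the curve ends at \<open>\<i> * of_real pi\<close>.\<close>
    have s: "sin (b * pi) = sin (\<alpha> * pi)" by (simp add: b_def algebra_simps sin_diff)
    have sp: "0 < sin (\<alpha> * pi)" using assms by (intro sin_gt_zero) auto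
    have "isCont \<rho> pi" unfolding \<rho>_def using s sp by (intro continuous_intros) auto
    then have "(\<rho> \<longlongrightarrow> \<rho> pi) (at_left pi)" by (simp add: isCont_def filterlim_at_split)
    moreover have "\<rho> pi = 1" using s sp by (simp add: \<rho>_def)
    ultimately have "(\<zeta> \<longlongrightarrow> of_real (ln 1) + \<i> * of_real pi) (at_left pi)"
      unfolding \<zeta>_def by (intro tendsto_intros) auto
    from isCont_tendsto_compose[OF contPhi this]
    show ?thesis unfolding F_def by (intro tendsto_Im) simp
  qed
  have isC: "isCont (\<lambda>t. kanter \<alpha> t ^ n) t" if "0 < t" "t < pi" for t
    unfolding kanter_def using pos[OF that] by (auto intro!: continuous_intros simp: b_def)
  have nn: "0 \<le> kanter \<alpha> t ^ n" if "0 < t" "t < pi" for t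
    using kanter_pos[OF assms that] by simp
  \<comment> \<open>Limits of \<open>F\<close> at the open ends suffice, and since the integrand is
    nonnegative, integrability comes together with the value.\<close>
  note I = interval_integral_FTC_nonneg[where F = F and f = "\<lambda>t. kanter \<alpha> t ^ n" and a = 0 and b = "ereal pi"
     and A = 0 and B = "Im (\<Phi> (\<i> * of_real pi))"]
  have e: "einterval 0 (ereal pi) = {0<..<pi}" by (auto simp: einterval_def)
  have I1: "set_integrable lborel {0<..<pi} (\<lambda>t. kanter \<alpha> t ^ n)"
    unfolding e[symmetric]
    by (rule I(1)) (use D isC nn F0 Fpi in \<open>auto simp: ereal_tendsto_simps zero_ereal_def\<close>)
  have I2: "(LBINT t=0..ereal pi. kanter \<alpha> t ^ n) = Im (\<Phi> (\<i> * of_real pi)) - 0"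
    by (rule I(2)) (use D isC nn F0 Fpi in \<open>auto simp: ereal_tendsto_simps zero_ereal_def\<close>)
  have "(\<integral>\<^sup>+\<phi>\<in>{0<..<pi}. ennreal (kanter \<alpha> \<phi> ^ n) \<partial>lborel) = ennreal (LBINT t:{0<..<pi}. kanter \<alpha> t ^ n)"
    using I1 nn unfolding nn_integral_set_ennreal set_lebesgue_integral_def set_integrable_def
    by (subst nn_integral_eq_integral[symmetric]) (auto simp: mult.commute indicator_def)
  also have "(LBINT t:{0<..<pi}. kanter \<alpha> t ^ n) = (LBINT t=0..ereal pi. kanter \<alpha> t ^ n)"
    by (simp add: interval_lebesgue_integral_def e)
  also have "\<dots> = pi * fact n * rGamma (1 + \<alpha> * n) * rGamma (1 + (1 - \<alpha>) * n)"
    unfolding I2 \<Phi>(3) by (simp add: algebra_simps)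
  finally show ?thesis .
qed

section \<open>The density as a mixture over the angle\<close>

text \<open>Both sides are monotone limits over compact intervals exhausting the half-line, on each
  of which the substitution has a continuous derivative.\<close>

lemma nn_integral_power_substitution:
  fixes f :: "real \<Rightarrow> ennreal"
  assumes f [measurable]: "f \<in> borel_measurable borel" and c: "0 < c" and r: "0 < r"
  shows "(\<integral>\<^sup>+l\<in>{0<..}. f l \<partial>lborel) =
    (\<integral>\<^sup>+x\<in>{0<..}. f (c * x powr r) * ennreal (c * (r * x powr (r - 1))) \<partial>lborel)"
proof -
  define g where "g = (\<lambda>x::real. c * x powr r)"
  define g' where "g' = (\<lambda>x::real. c * (r * x powr (r - 1)))"
  \<comment> \<open>The offset 2 makes the endpoints distinct already for n = 0, as the substitution
    rule on an interval asks for a strict inequality.\<close>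
  define I where "I = (\<lambda>n::nat. {1 / (real n + 2) .. real n + 2})"
  define J where "J = (\<lambda>n::nat. {g (1 / (real n + 2)) .. g (real n + 2)})"
  have step: "(\<integral>\<^sup>+l. f l * indicator (J n) l \<partial>lborel) = (\<integral>\<^sup>+x. f (g x) * g' x * indicator (I n) x \<partial>lborel)" for n
    unfolding I_def J_def
  proof (rule nn_integral_substitution_aux)
    fix x assume "x \<in> {1 / (real n + 2) .. real n + 2}"
    moreover have "0 < 1 / (real n + 2)" by simp
    ultimately have x: "0 < x" unfolding atLeastAtMost_iff by linarith
    show "(g has_real_derivative g' x) (at x)" unfolding g_def g'_def using x
      by (auto intro!: derivative_eq_intros simp: powr_diff field_simps)
    show "0 \<le> g' x" unfolding g'_def using x c r by simp
  next
    have "continuous_on {0<..} g'" unfolding g'_def by (intro continuous_intros) auto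
    then show "continuous_on {1 / (real n + 2) .. real n + 2} g'"
      by (rule continuous_on_subset) (auto intro: less_le_trans[of 0 "1 / (real n + 2)"])
  next
    have "1 / (real n + 2) < 1" by simp
    also have "1 < real n + 2" by simp
    finally show "1 / (real n + 2) < real n + 2" .
  qed (auto simp: f)
  have incI: "incseq I"
    unfolding incseq_def
  proof (intro allI impI)
    fix m n :: nat assume "m \<le> n"
    then have "1 / (real n + 2) \<le> 1 / (real m + 2)" by (intro divide_left_mono) auto
    then show "I m \<subseteq> I n" using \<open>m \<le> n\<close> unfolding I_def by auto
  qed
  have UI: "(\<Union>n. I n) = {0<..}"
  proof safe
    fix x n assume "x \<in> I n"
    then show "0 < x" unfolding I_def by (auto intro: less_le_trans[of 0 "1 / (real n + 2)"])
  next
    fix x :: real assume x: "0 < x"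
    obtain n where n: "max x (1 / x) < real n" using reals_Archimedean2 by blast
    then have "1 \<le> x * (real n + 2)" using x by (simp add: field_simps)
    then have "1 / (real n + 2) \<le> x" by (simp add: divide_le_eq)
    with n show "x \<in> (\<Union>n. I n)" unfolding I_def by (auto intro!: exI[of _ n])
  qed
  have gmono: "g x \<le> g y" if "0 < x" "x \<le> y" for x y
    unfolding g_def using that c r by (intro mult_left_mono powr_mono2) auto
  have incJ: "incseq J"
    unfolding J_def incseq_def
  proof (intro allI impI)
    fix m n :: nat assume "m \<le> n"
    then have "1 / (real n + 2) \<le> 1 / (real m + 2)" by (intro divide_left_mono) auto
    then have "g (1 / (real n + 2)) \<le> g (1 / (real m + 2))" by (intro gmono) auto
    moreover have "g (real m + 2) \<le> g (real n + 2)" using \<open>m \<le> n\<close> by (intro gmono) auto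
    ultimately show "{g (1 / (real m + 2)) .. g (real m + 2)} \<subseteq> {g (1 / (real n + 2)) .. g (real n + 2)}" by auto
  qed
  have UJ: "(\<Union>n. J n) = {0<..}"
  proof safe
    fix x n assume "x \<in> J n"
    moreover have "0 < g (1 / (real n + 2))" using c by (simp add: g_def)
    ultimately show "0 < x" unfolding J_def by auto
  next
    fix y :: real assume y: "0 < y"
    define x where "x = (y / c) powr (1 / r)"
    have x: "0 < x" using y c by (simp add: x_def)
    have gx: "g x = y" unfolding g_def x_def using y c r by (simp add: powr_powr)
    obtain n where "x \<in> I n" using UI x by blast
    then have "y \<in> J n" unfolding I_def J_def gx[symmetric] by (auto intro!: gmono x)
    then show "y \<in> (\<Union>n. J n)" by blast
  qed
  have lim: "(\<lambda>n. \<integral>\<^sup>+x. h x * indicator (A n) x \<partial>lborel) \<longlonglongrightarrow> (\<integral>\<^sup>+x. h x * indicator (\<Union>n. A n) x \<partial>lborel)"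
    if "incseq A" "\<And>n. A n \<in> sets borel" and [measurable]: "h \<in> borel_measurable borel" for h :: "real \<Rightarrow> ennreal" and A
  proof -
    have "(\<lambda>n. emeasure (density lborel h) (A n)) \<longlonglongrightarrow> emeasure (density lborel h) (\<Union>n. A n)"
      using that by (intro Lim_emeasure_incseq) auto
    then show ?thesis using that by (simp add: emeasure_density)
  qed
  have [measurable]: "g \<in> borel_measurable borel" "g' \<in> borel_measurable borel"
    unfolding g_def g'_def by measurable
  have "(\<lambda>n. \<integral>\<^sup>+l. f l * indicator (J n) l \<partial>lborel) \<longlonglongrightarrow> (\<integral>\<^sup>+l. f l * indicator (\<Union>n. J n) l \<partial>lborel)"
    by (rule lim[OF incJ]) (auto simp: J_def f)
  moreover have "(\<lambda>n. \<integral>\<^sup>+x. f (g x) * g' x * indicator (I n) x \<partial>lborel) \<longlonglongrightarrow> (\<integral>\<^sup>+x. f (g x) * g' x * indicator (\<Union>n. I n) x \<partial>lborel)"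
    by (rule lim[OF incI]) (auto simp: I_def)
  ultimately show ?thesis unfolding step UI UJ g_def g'_def by (rule LIMSEQ_unique)
qed

text \<open>For fixed \<open>\<phi>\<close> this is \<open>1/\<pi>\<close> times the density of \<open>kanter \<alpha> \<phi> * l\<^bsup>1-\<alpha>\<^esup>\<close>, with \<open>l\<close>
  exponentially distributed.\<close>

definition wright_integrand :: "real \<Rightarrow> real \<Rightarrow> real \<Rightarrow> real" where
  "wright_integrand \<alpha> \<phi> \<theta> = (let r = 1 / (1 - \<alpha>); c = kanter \<alpha> \<phi> powr (- r)
     in exp (- (c * \<theta> powr r)) * (c * (r * \<theta> powr (r - 1))) / pi)"

text \<open>\<open>enn2real\<close> would send an infinite integral to 0; for 0 < \<theta> the
  integral is finite by \<open>ennreal_wright_density\<close>.\<close>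

definition wright_density :: "real \<Rightarrow> real \<Rightarrow> real" where
  "wright_density \<alpha> \<theta> = enn2real (\<integral>\<^sup>+\<phi>\<in>{0<..<pi}. ennreal (wright_integrand \<alpha> \<phi> \<theta>) \<partial>lborel)"

lemma measurable_kanter [measurable]: "kanter \<alpha> \<in> borel_measurable borel"
  unfolding kanter_def[abs_def] by measurable

lemma measurable_wright_integrand [measurable]:
  "(\<lambda>(\<phi>, \<theta>). wright_integrand \<alpha> \<phi> \<theta>) \<in> borel_measurable (borel \<Otimes>\<^sub>M borel)"
  unfolding wright_integrand_def[abs_def] Let_def split_beta by measurable

lemma measurable_wright_density [measurable]: "wright_density \<alpha> \<in> borel_measurable borel"
proof -
  have [measurable]: "(\<lambda>(\<theta>, \<phi>). wright_integrand \<alpha> \<phi> \<theta>) \<in> borel_measurable (borel \<Otimes>\<^sub>M borel)"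
    using measurable_compose[OF measurable_pair_swap' measurable_wright_integrand] by (simp add: split_beta')
  show ?thesis unfolding wright_density_def[abs_def] by measurable
qed

text \<open>Finiteness: with y = c \<theta>^r the integrand is e^(-y) y r/(\<theta> pi) <=
  r/\<theta>, a bound independent of \<phi>. Positivity: the integrand is strictly positive on an
  interval of positive length.\<close>

lemma
  assumes \<alpha>: "0 < \<alpha>" "\<alpha> < 1" and \<theta>: "0 < \<theta>"
  shows wright_density_pos: "0 < wright_density \<alpha> \<theta>"
    and ennreal_wright_density:
      "ennreal (wright_density \<alpha> \<theta>) = (\<integral>\<^sup>+\<phi>\<in>{0<..<pi}. ennreal (wright_integrand \<alpha> \<phi> \<theta>) \<partial>lborel)"
proof -
  define r where "r = 1 / (1 - \<alpha>)"
  have r: "0 < r" using \<alpha> by (simp add: r_def)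
  let ?I = "\<integral>\<^sup>+\<phi>\<in>{0<..<pi}. ennreal (wright_integrand \<alpha> \<phi> \<theta>) \<partial>lborel"
  have pos: "0 < wright_integrand \<alpha> \<phi> \<theta>" if "\<phi> \<in> {0<..<pi}" for \<phi>
    unfolding wright_integrand_def Let_def using kanter_pos[OF \<alpha>, of \<phi>] that \<theta> \<alpha> by auto
  have le: "wright_integrand \<alpha> \<phi> \<theta> \<le> r / \<theta>" if "\<phi> \<in> {0<..<pi}" for \<phi>
  proof -
    define c where "c = kanter \<alpha> \<phi> powr (- r)"
    have c: "0 < c" using kanter_pos[OF \<alpha>, of \<phi>] that by (simp add: c_def)
    define y where "y = c * \<theta> powr r"
    have y: "0 < y" using c \<theta> by (simp add: y_def)
    have "y \<le> exp y" using exp_ge_add_one_self[of y] by linarith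
    then have 1: "exp (- y) * y \<le> 1" using y by (simp add: exp_minus field_simps)
    have "wright_integrand \<alpha> \<phi> \<theta> = (exp (- y) * y) * (r / \<theta>) / pi"
      unfolding wright_integrand_def Let_def r_def[symmetric] c_def[symmetric] y_def
      using \<theta> by (simp add: powr_diff field_simps)
    also have "\<dots> \<le> 1 * (r / \<theta>) / pi"
      by (intro divide_right_mono mult_right_mono 1) (use r \<theta> in auto)
    also have "\<dots> \<le> r / \<theta>" using r \<theta> pi_gt3
      by (simp add: divide_le_eq)
    finally show ?thesis .
  qed
  have "?I \<le> (\<integral>\<^sup>+\<phi>\<in>{0<..<pi}. ennreal (r / \<theta>) \<partial>lborel)"
    by (intro nn_integral_mono) (use le in \<open>auto simp: indicator_def intro!: ennreal_leI\<close>)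
  also have "\<dots> = ennreal (r / \<theta>) * ennreal pi"
    by (subst nn_integral_cmult) auto
  also have "\<dots> < top" by (simp add: ennreal_mult_less_top)
  finally have fin: "?I < top" .
  have [measurable]: "(\<lambda>\<phi>. wright_integrand \<alpha> \<phi> \<theta>) \<in> borel_measurable borel"
    using measurable_compose[OF measurable_Pair2'[of \<theta> borel borel] measurable_wright_integrand]
    by simp
  have "?I \<noteq> 0"
  proof
    assume "?I = 0"
    then have "AE \<phi> in lborel. ennreal (wright_integrand \<alpha> \<phi> \<theta>) * indicator {0<..<pi} \<phi> = 0"
      by (subst (asm) nn_integral_0_iff_AE) auto
    then have "AE \<phi> in lborel. \<phi> \<notin> {0<..<pi}"
      by eventually_elim (use pos in \<open>force simp: indicator_def split: if_splits\<close>)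
    then have "{0<..<pi} \<in> null_sets lborel" by (subst (asm) AE_iff_null_sets[symmetric]) auto
    then have "emeasure lborel {0<..<pi} = 0" by auto
    then show False by simp
  qed
  then have "0 < ?I" by (simp add: zero_less_iff_neq_zero)
  then show "0 < wright_density \<alpha> \<theta>" unfolding wright_density_def using fin
    by (simp add: enn2real_positive_iff)
  show "ennreal (wright_density \<alpha> \<theta>) = ?I"
    unfolding wright_density_def using fin by simp
qed

text \<open>This is the expectation of f(\<Theta>). Tonelli puts the \<phi>-integral outside; for
  fixed \<phi> the substitution l = c \<theta>^(1/(1-\<alpha>)) inverts the map from l to
  \<open>kanter \<alpha> \<phi>\<close> l^(1-\<alpha>). The factor 1/pi is the uniform density of
  \<phi>.\<close>

lemma nn_integral_wright_density:
  fixes f :: "real \<Rightarrow> ennreal"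
  assumes \<alpha>: "0 < \<alpha>" "\<alpha> < 1" and f [measurable]: "f \<in> borel_measurable borel"
  shows "(\<integral>\<^sup>+\<theta>\<in>{0<..}. ennreal (wright_density \<alpha> \<theta>) * f \<theta> \<partial>lborel) =
    (\<integral>\<^sup>+\<phi>\<in>{0<..<pi}. (\<integral>\<^sup>+l\<in>{0<..}. f (kanter \<alpha> \<phi> * l powr (1 - \<alpha>)) * ennreal (exp (- l) / pi) \<partial>lborel) \<partial>lborel)"
proof -
  have "(\<integral>\<^sup>+\<theta>\<in>{0<..}. ennreal (wright_density \<alpha> \<theta>) * f \<theta> \<partial>lborel) =
    (\<integral>\<^sup>+\<theta>. \<integral>\<^sup>+\<phi>. ennreal (wright_integrand \<alpha> \<phi> \<theta>) * indicator {0<..<pi} \<phi> * (f \<theta> * indicator {0<..} \<theta>) \<partial>lborel \<partial>lborel)"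
  proof (intro nn_integral_cong)
    fix \<theta> :: real
    have [measurable]: "(\<lambda>\<phi>. wright_integrand \<alpha> \<phi> \<theta>) \<in> borel_measurable borel"
      using measurable_compose[OF measurable_Pair2'[of \<theta> borel borel] measurable_wright_integrand]
      by simp
    show "ennreal (wright_density \<alpha> \<theta>) * f \<theta> * indicator {0<..} \<theta> =
      (\<integral>\<^sup>+\<phi>. ennreal (wright_integrand \<alpha> \<phi> \<theta>) * indicator {0<..<pi} \<phi> * (f \<theta> * indicator {0<..} \<theta>) \<partial>lborel)"
      by (subst nn_integral_multc) (auto simp: indicator_def ennreal_wright_density[OF \<alpha>])
  qed
  also have "\<dots> = (\<integral>\<^sup>+\<phi>. \<integral>\<^sup>+\<theta>. ennreal (wright_integrand \<alpha> \<phi> \<theta>) * indicator {0<..<pi} \<phi> * (f \<theta> * indicator {0<..} \<theta>) \<partial>lborel \<partial>lborel)"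
    by (rule lborel_pair.Fubini') measurable
  also have "\<dots> = (\<integral>\<^sup>+\<phi>\<in>{0<..<pi}. (\<integral>\<^sup>+l\<in>{0<..}. f (kanter \<alpha> \<phi> * l powr (1 - \<alpha>)) * ennreal (exp (- l) / pi) \<partial>lborel) \<partial>lborel)"
  proof (intro nn_integral_cong)
    fix \<phi> :: real
    show "(\<integral>\<^sup>+\<theta>. ennreal (wright_integrand \<alpha> \<phi> \<theta>) * indicator {0<..<pi} \<phi> * (f \<theta> * indicator {0<..} \<theta>) \<partial>lborel) =
      (\<integral>\<^sup>+l\<in>{0<..}. f (kanter \<alpha> \<phi> * l powr (1 - \<alpha>)) * ennreal (exp (- l) / pi) \<partial>lborel) * indicator {0<..<pi} \<phi>"
    proof (cases "\<phi> \<in> {0<..<pi}")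
      case True
      define K where "K = kanter \<alpha> \<phi>"
      have K: "0 < K" using kanter_pos[OF \<alpha>] True by (simp add: K_def)
      define r where "r = 1 / (1 - \<alpha>)"
      have r: "0 < r" using \<alpha> by (simp add: r_def)
      define c where "c = K powr (- r)"
      have c: "0 < c" using K by (simp add: c_def)
      have inv: "K * (c * \<theta> powr r) powr (1 - \<alpha>) = \<theta>" if "0 < \<theta>" for \<theta>
      proof -
        have "c powr (1 - \<alpha>) = K powr (- 1)"
          unfolding c_def r_def powr_powr using \<alpha> by simp
        also have "\<dots> = 1 / K" using K by (simp add: powr_minus_divide)
        finally have "c powr (1 - \<alpha>) = 1 / K" .
        moreover have "(\<theta> powr r) powr (1 - \<alpha>) = \<theta>" unfolding powr_powr r_def using \<alpha> that by simp
        ultimately show ?thesis using K c that by (simp add: powr_mult)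
      qed
      have "(\<integral>\<^sup>+l\<in>{0<..}. f (K * l powr (1 - \<alpha>)) * ennreal (exp (- l) / pi) \<partial>lborel) =
        (\<integral>\<^sup>+\<theta>\<in>{0<..}. f (K * (c * \<theta> powr r) powr (1 - \<alpha>)) * ennreal (exp (- (c * \<theta> powr r)) / pi) *
           ennreal (c * (r * \<theta> powr (r - 1))) \<partial>lborel)"
        using c r by (intro nn_integral_power_substitution) auto
      also have "\<dots> = (\<integral>\<^sup>+\<theta>. ennreal (wright_integrand \<alpha> \<phi> \<theta>) * indicator {0<..<pi} \<phi> * (f \<theta> * indicator {0<..} \<theta>) \<partial>lborel)"
      proof (intro nn_integral_cong)
        fix \<theta> :: real
        show "f (K * (c * \<theta> powr r) powr (1 - \<alpha>)) * ennreal (exp (- (c * \<theta> powr r)) / pi) *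
            ennreal (c * (r * \<theta> powr (r - 1))) * indicator {0<..} \<theta> =
          ennreal (wright_integrand \<alpha> \<phi> \<theta>) * indicator {0<..<pi} \<phi> * (f \<theta> * indicator {0<..} \<theta>)"
        proof (cases "0 < \<theta>")
          case pos: True
          have "ennreal (wright_integrand \<alpha> \<phi> \<theta>) = ennreal (exp (- (c * \<theta> powr r)) / pi) * ennreal (c * (r * \<theta> powr (r - 1)))"
            unfolding wright_integrand_def Let_def r_def[symmetric] K_def[symmetric] c_def[symmetric]
            using c r pos by (simp flip: ennreal_mult)
          then show ?thesis using pos True inv[OF pos] by (simp add: mult_ac)
        qed simp
      qed
      finally show ?thesis using True by (simp add: K_def)
    qed simp
  qed
  finally show ?thesis .
qed

section \<open>Bounds on Kanter's function and moments of the density\<close>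

text \<open>Concavity of the sine on [0, pi]: the difference of the two sides has derivative
  \<alpha> (cos(\<alpha>x) - cos x) >= 0.\<close>

lemma sin_scaled_ge:
  assumes "0 \<le> \<alpha>" "\<alpha> \<le> 1" "0 \<le> y" "y \<le> pi"
  shows "\<alpha> * sin y \<le> sin (\<alpha> * y)"
proof -
  have "sin (\<alpha> * 0) - \<alpha> * sin 0 \<le> sin (\<alpha> * y) - \<alpha> * sin y"
  proof (rule DERIV_nonneg_imp_nondecreasing[OF assms(3)])
    fix x assume x: "0 \<le> x" "x \<le> y"
    have "\<alpha> * x \<le> 1 * x" using assms x by (intro mult_right_mono) auto
    then have "cos x \<le> cos (\<alpha> * x)" using assms x by (intro cos_monotone_0_pi_le) auto
    then show "\<exists>D. ((\<lambda>x. sin (\<alpha> * x) - \<alpha> * sin x) has_real_derivative D) (at x) \<and> 0 \<le> D"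
      using assms by (intro exI[of _ "\<alpha> * (cos (\<alpha> * x) - cos x)"])
        (auto intro!: derivative_eq_intros mult_left_mono simp: algebra_simps)
  qed
  then show ?thesis by simp
qed

text \<open>This is ln u <= u - 1 at u = 1/\<alpha>. Multiplied by the same bound for 1 - \<alpha>
  it gives e^(-1), the source of \<open>exp 1\<close> in \<open>kanter_le\<close>.\<close>

lemma self_powr_self_ge:
  assumes "0 < (\<alpha>::real)"
  shows "exp (\<alpha> - 1) \<le> \<alpha> powr \<alpha>"
proof -
  have "ln (1 / \<alpha>) \<le> 1 / \<alpha> - 1" using assms by (intro ln_le_minus_one) auto
  then have "\<alpha> - 1 \<le> \<alpha> * ln \<alpha>" using assms by (simp add: ln_div field_simps)
  then show ?thesis using assms by (simp add: powr_def)
qed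

text \<open>The denominator of \<open>kanter\<close> is at most 1, and by
  \<open>sin_scaled_ge\<close> it is at least \<alpha>^\<alpha> (1-\<alpha>)^(1-\<alpha>) sin \<phi>
  >= e^(-1) sin \<phi>. Neither bound depends on \<alpha>.\<close>

lemma
  assumes "0 < \<alpha>" "\<alpha> < 1" "0 < \<phi>" "\<phi> < pi"
  shows kanter_ge_sin: "sin \<phi> \<le> kanter \<alpha> \<phi>"
    and kanter_le: "kanter \<alpha> \<phi> \<le> exp 1"
proof -
  define s where "s = sin \<phi>"
  have s: "0 < s" unfolding s_def using assms by (simp add: sin_gt_zero)
  define d where "d = sin (\<alpha> * \<phi>) powr \<alpha> * sin ((1 - \<alpha>) * \<phi>) powr (1 - \<alpha>)"
  have K: "kanter \<alpha> \<phi> = s / d" by (simp add: kanter_def d_def s_def)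
  note p = sin_scaled_pos[OF assms]
  have "d \<le> 1 * 1" unfolding d_def using p assms
    by (intro mult_mono powr_le1) auto
  moreover have d: "0 < d" unfolding d_def using p by simp
  ultimately show "sin \<phi> \<le> kanter \<alpha> \<phi>" unfolding K s_def[symmetric] using s
    by (simp add: le_divide_eq)
  have "exp (- 1) * s = (exp (\<alpha> - 1) * s powr \<alpha>) * (exp ((1 - \<alpha>) - 1) * s powr (1 - \<alpha>))"
  proof -
    have "exp (\<alpha> - 1) * exp ((1 - \<alpha>) - 1) = exp (- 1)" unfolding exp_add[symmetric] by simp
    moreover have "s powr \<alpha> * s powr (1 - \<alpha>) = s" using s unfolding powr_add[symmetric] by simp
    ultimately show ?thesis by (metis (no_types, lifting) mult.assoc mult.left_commute)
  qed
  also have "\<dots> \<le> (\<alpha> powr \<alpha> * s powr \<alpha>) * ((1 - \<alpha>) powr (1 - \<alpha>) * s powr (1 - \<alpha>))"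
    using s assms by (intro mult_mono mult_right_mono self_powr_self_ge) auto
  also have "\<dots> = (\<alpha> * s) powr \<alpha> * ((1 - \<alpha>) * s) powr (1 - \<alpha>)"
    using s assms by (simp add: powr_mult)
  also have "\<dots> \<le> d" unfolding d_def s_def
    using s assms by (intro mult_mono powr_mono2 sin_scaled_ge) (auto simp: s_def)
  finally have "s \<le> exp 1 * d" by (simp add: exp_minus field_simps)
  then show "kanter \<alpha> \<phi> \<le> exp 1" unfolding K using d by (simp add: divide_le_eq)
qed

lemma nn_integral_Gamma:
  assumes "-1 < (a::real)"
  shows "(\<integral>\<^sup>+l\<in>{0<..}. ennreal (l powr a * exp (- l)) \<partial>lborel) = ennreal (Gamma (1 + a))"
proof -
  have "ennreal (Gamma (1 + a)) = (\<integral>\<^sup>+l. ennreal (indicator {0..} l * l powr (1 + a - 1) / exp l) \<partial>lborel)"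
    using assms by (intro Gamma_conv_nn_integral_real) auto
  also have "\<dots> = (\<integral>\<^sup>+l\<in>{0<..}. ennreal (l powr a * exp (- l)) \<partial>lborel)"
    by (intro nn_integral_cong) (auto simp: indicator_def exp_minus field_simps)
  finally show ?thesis ..
qed

text \<open>The moment factors into that of \<open>kanter\<close> under the uniform law and that of
  l^(1-\<alpha>) under the exponential law. The latter, Gamma(1+(1-\<alpha>)n), cancels one
  reciprocal Gamma factor of the former.\<close>

lemma wright_density_moment:
  assumes \<alpha>: "0 < \<alpha>" "\<alpha> < 1"
  shows "(\<integral>\<^sup>+\<theta>\<in>{0<..}. ennreal (wright_density \<alpha> \<theta>) * ennreal (\<theta> ^ n) \<partial>lborel) =
    ennreal (fact n / Gamma (1 + \<alpha> * real n))"
proof -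
  define b where "b = 1 - \<alpha>"
  have b: "0 < b" "b < 1" using \<alpha> by (auto simp: b_def)
  have G: "0 < Gamma (1 + b * real n)" "0 < Gamma (1 + \<alpha> * real n)"
    using b \<alpha> by (auto intro!: Gamma_real_pos add_pos_nonneg)
  have "(\<integral>\<^sup>+\<theta>\<in>{0<..}. ennreal (wright_density \<alpha> \<theta>) * ennreal (\<theta> ^ n) \<partial>lborel) =
    (\<integral>\<^sup>+\<phi>\<in>{0<..<pi}. (\<integral>\<^sup>+l\<in>{0<..}. ennreal ((kanter \<alpha> \<phi> * l powr b) ^ n) * ennreal (exp (- l) / pi) \<partial>lborel) \<partial>lborel)"
    unfolding b_def by (intro nn_integral_wright_density[OF \<alpha>]) auto
  also have "\<dots> = (\<integral>\<^sup>+\<phi>\<in>{0<..<pi}. ennreal (Gamma (1 + b * n) / pi) * ennreal (kanter \<alpha> \<phi> ^ n) \<partial>lborel)"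
  proof (intro nn_integral_cong)
    fix \<phi> :: real
    show "(\<integral>\<^sup>+l\<in>{0<..}. ennreal ((kanter \<alpha> \<phi> * l powr b) ^ n) * ennreal (exp (- l) / pi) \<partial>lborel) * indicator {0<..<pi} \<phi> =
       ennreal (Gamma (1 + b * n) / pi) * ennreal (kanter \<alpha> \<phi> ^ n) * indicator {0<..<pi} \<phi>"
    proof (cases "\<phi> \<in> {0<..<pi}")
      case True
      have K: "0 < kanter \<alpha> \<phi>" using kanter_pos[OF \<alpha>] True by simp
      have "(\<integral>\<^sup>+l\<in>{0<..}. ennreal ((kanter \<alpha> \<phi> * l powr b) ^ n) * ennreal (exp (- l) / pi) \<partial>lborel) =
        (\<integral>\<^sup>+l. ennreal (kanter \<alpha> \<phi> ^ n / pi) * (ennreal (l powr (b * n) * exp (- l)) * indicator {0<..} l) \<partial>lborel)"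
      proof (intro nn_integral_cong)
        fix l :: real
        have "(kanter \<alpha> \<phi> * l powr b) ^ n = kanter \<alpha> \<phi> ^ n * l powr (b * n)" if "0 < l"
          using that by (simp add: power_mult_distrib powr_powr flip: powr_realpow)
        then show "ennreal ((kanter \<alpha> \<phi> * l powr b) ^ n) * ennreal (exp (- l) / pi) * indicator {0<..} l =
          ennreal (kanter \<alpha> \<phi> ^ n / pi) * (ennreal (l powr (b * n) * exp (- l)) * indicator {0<..} l)"
          using K by (auto simp: indicator_def simp flip: ennreal_mult)
      qed
      also have "\<dots> = ennreal (kanter \<alpha> \<phi> ^ n / pi) * ennreal (Gamma (1 + b * n))"
        by (subst nn_integral_cmult, measurable) (subst nn_integral_Gamma, use b in \<open>auto intro: less_le_trans[of _ 0]\<close>)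
      also have "\<dots> = ennreal (Gamma (1 + b * n) / pi) * ennreal (kanter \<alpha> \<phi> ^ n)"
        using K G by (simp add: mult_ac flip: ennreal_mult)
      finally show ?thesis by simp
    qed simp
  qed
  also have "\<dots> = ennreal (Gamma (1 + b * n) / pi) * (\<integral>\<^sup>+\<phi>\<in>{0<..<pi}. ennreal (kanter \<alpha> \<phi> ^ n) \<partial>lborel)"
    by (subst nn_integral_cmult[symmetric]) (auto simp: mult.assoc)
  also have "\<dots> = ennreal (Gamma (1 + b * n) / pi) * ennreal (pi * fact n * rGamma (1 + \<alpha> * real n) * rGamma (1 + b * real n))"
    unfolding b_def by (simp only: kanter_power_integral[OF \<alpha>])
  also have "\<dots> = ennreal (fact n / Gamma (1 + \<alpha> * real n))"
    using G by (subst ennreal_mult[symmetric]) (auto simp: rGamma_inverse_Gamma field_simps)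
  finally show ?thesis .
qed

text \<open>Serves to absorb e^(c\<Theta>) while keeping half of the decay of e^(-l).\<close>

lemma powr_le_linear:
  assumes "0 \<le> c" "0 < b" "b < (1::real)"
  shows "\<exists>C. \<forall>l>0. c * l powr b \<le> l / 2 + C"
proof -
  \<comment> \<open>Beyond L the power l^(1-b) is at least 2(c+1), so c l^b is at most l/2. Adding 1
    to c keeps L positive when c = 0.\<close>
  define L where "L = (2 * (c + 1)) powr (1 / (1 - b))"
  have L: "0 < L" using assms by (simp add: L_def)
  have "c * l powr b \<le> l / 2 + c * L powr b" if l: "0 < l" for l
  proof (cases "l \<le> L")
    case True
    then have "c * l powr b \<le> c * L powr b" using assms l by (intro mult_left_mono powr_mono2) auto
    then show ?thesis using l by linarith
  next
    case False
    have "2 * (c + 1) = L powr (1 - b)" using assms by (simp add: L_def powr_powr)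
    also have "\<dots> \<le> l powr (1 - b)" using False assms L by (intro powr_mono2) auto
    finally have "2 * c \<le> l powr (1 - b)" by (simp add: algebra_simps)
    then have "2 * c * l powr b \<le> l powr (1 - b) * l powr b" by (intro mult_right_mono) auto
    also have "\<dots> = l" using l by (simp flip: powr_add)
    finally have "c * l powr b \<le> l / 2" by simp
    moreover have "0 \<le> c * L powr b" using assms by simp
    ultimately show ?thesis by linarith
  qed
  then show ?thesis by blast
qed

text \<open>Comparison with a Gamma integral, as e^(c-x) >= 1 on the interval.\<close>

lemma nn_integral_powr_neg_finite:
  assumes "0 \<le> a" "a < (1::real)"
  shows "(\<integral>\<^sup>+x\<in>{0<..<c}. ennreal (x powr - a) \<partial>lborel) < \<infinity>"
proof -
  have "(\<integral>\<^sup>+x\<in>{0<..<c}. ennreal (x powr - a) \<partial>lborel) \<le>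
    (\<integral>\<^sup>+x. ennreal (exp c) * (ennreal (x powr - a * exp (- x)) * indicator {0<..} x) \<partial>lborel)"
  proof (intro nn_integral_mono)
    fix x :: real
    have "x powr - a \<le> exp c * (x powr - a * exp (- x))" if "0 < x" "x < c"
    proof -
      have "1 \<le> exp (c - x)" using that by simp
      then have "x powr - a * 1 \<le> x powr - a * exp (c - x)" by (intro mult_left_mono) auto
      then show ?thesis by (simp add: exp_diff exp_minus field_simps)
    qed
    then show "ennreal (x powr - a) * indicator {0<..<c} x \<le> ennreal (exp c) * (ennreal (x powr - a * exp (- x)) * indicator {0<..} x)"
      by (auto simp: indicator_def simp flip: ennreal_mult intro!: ennreal_leI)
  qed
  also have "\<dots> = ennreal (exp c) * ennreal (Gamma (1 + - a))"
    by (subst nn_integral_cmult, measurable) (subst nn_integral_Gamma, use assms in auto)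
  also have "\<dots> < \<infinity>" by (simp add: ennreal_mult_less_top)
  finally show ?thesis .
qed

lemma nn_integral_sin_powr_neg_finite:
  assumes a: "0 \<le> a" "a < (1::real)"
  shows "(\<integral>\<^sup>+\<phi>\<in>{0<..<pi}. ennreal (sin \<phi> powr - a) \<partial>lborel) < \<infinity>"
proof -
  \<comment> \<open>Jordan's inequality is concavity of the sine between 0 and pi/2; the right half
    of the interval is reduced to the left one by reflecting x to pi - x.\<close>
  have jordan: "2 / pi * x \<le> sin x" if "0 \<le> x" "x \<le> pi / 2" for x
    using sin_scaled_ge[of "2 / pi * x" "pi / 2"] that by (simp add: field_simps)
  have *: "sin x powr - a \<le> (2 / pi) powr - a * x powr - a" if "0 < x" "x \<le> pi / 2" for x
  proof -
    have "sin x powr - a \<le> (2 / pi * x) powr - a"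
      using that a jordan[of x] by (intro powr_mono2') (auto intro: mult_pos_pos)
    then show ?thesis using that unfolding powr_mult by simp
  qed
  have "(\<integral>\<^sup>+\<phi>\<in>{0<..<pi}. ennreal (sin \<phi> powr - a) \<partial>lborel) \<le>
    (\<integral>\<^sup>+x. ennreal ((2 / pi) powr - a) * (ennreal (x powr - a) * indicator {0<..<pi} x +
       ennreal ((pi - x) powr - a) * indicator {0<..<pi} x) \<partial>lborel)"
  proof (intro nn_integral_mono)
    fix x :: real
    show "ennreal (sin x powr - a) * indicator {0<..<pi} x \<le>
      ennreal ((2 / pi) powr - a) * (ennreal (x powr - a) * indicator {0<..<pi} x +
       ennreal ((pi - x) powr - a) * indicator {0<..<pi} x)"
    proof (cases "x \<in> {0<..<pi}")
      case True
      have "sin x powr - a \<le> (2 / pi) powr - a * (x powr - a + (pi - x) powr - a)"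
      proof (cases "x \<le> pi / 2")
        case le: True
        have "sin x powr - a \<le> (2 / pi) powr - a * x powr - a" using * True le by auto
        also have "\<dots> \<le> (2 / pi) powr - a * (x powr - a + (pi - x) powr - a)"
          by (intro mult_left_mono) auto
        finally show ?thesis .
      next
        case False
        have "sin (pi - x) powr - a \<le> (2 / pi) powr - a * (pi - x) powr - a" using True False by (intro *) auto
        also have "\<dots> \<le> (2 / pi) powr - a * (x powr - a + (pi - x) powr - a)"
          by (intro mult_left_mono) auto
        finally show ?thesis by simp
      qed
      then show ?thesis using True
        by (simp flip: ennreal_mult ennreal_plus del: ennreal_plus add: ennreal_leI)
    qed simp
  qed
  also have "\<dots> = ennreal ((2 / pi) powr - a) * ((\<integral>\<^sup>+x\<in>{0<..<pi}. ennreal (x powr - a) \<partial>lborel) +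
      (\<integral>\<^sup>+x\<in>{0<..<pi}. ennreal ((pi - x) powr - a) \<partial>lborel))"
    by (simp add: nn_integral_cmult nn_integral_add)
  also have "(\<integral>\<^sup>+x\<in>{0<..<pi}. ennreal ((pi - x) powr - a) \<partial>lborel) = (\<integral>\<^sup>+x\<in>{0<..<pi}. ennreal (x powr - a) \<partial>lborel)"
    by (subst nn_integral_real_affine[where c = "-1" and t = pi]) (auto intro!: nn_integral_cong simp: indicator_def)
  also have "ennreal ((2 / pi) powr - a) * ((\<integral>\<^sup>+x\<in>{0<..<pi}. ennreal (x powr - a) \<partial>lborel) + (\<integral>\<^sup>+x\<in>{0<..<pi}. ennreal (x powr - a) \<partial>lborel)) < \<infinity>"
    using nn_integral_powr_neg_finite[OF a, of pi] by (auto simp: ennreal_mult_less_top)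
  finally show ?thesis .
qed

text \<open>The bound is uniform as \<open>\<alpha>\<close> approaches 1: it only uses \<open>sin \<phi> \<le> kanter \<alpha> \<phi> \<le> exp 1\<close> and
  that \<open>l\<^sup>1\<^sup>-\<^sup>\<alpha>\<close> grows sublinearly.\<close>

lemma wright_density_bound:
  assumes \<alpha>0: "0 < \<alpha>0" "\<alpha>0 < 1" and a: "0 \<le> a" "a < 1" and c: "0 \<le> c"
  shows "\<exists>D>0. \<forall>\<alpha>\<in>{\<alpha>0..<1}.
    (\<integral>\<^sup>+\<theta>\<in>{0<..}. ennreal (wright_density \<alpha> \<theta>) * ennreal (\<theta> powr - a * exp (c * \<theta>)) \<partial>lborel) \<le> ennreal D"
proof -
  obtain C where C: "\<And>l. 0 < l \<Longrightarrow> (c * exp 1) * l powr (1 - \<alpha>0) \<le> l / 2 + C"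
    using powr_le_linear[of "c * exp 1" "1 - \<alpha>0"] \<alpha>0 c by auto
  define B where "B = exp (c * exp 1 + C) / pi"
  have B: "0 < B" by (simp add: B_def)
  define S where "S = (\<integral>\<^sup>+\<phi>\<in>{0<..<pi}. ennreal (sin \<phi> powr - a) \<partial>lborel)"
  have S: "S < \<infinity>" unfolding S_def using a by (rule nn_integral_sin_powr_neg_finite)
  define L where "L = (\<integral>\<^sup>+l\<in>{0<..}. ennreal ((1 + l powr - a) * exp (- (l / 2))) \<partial>lborel)"
  have L: "L < \<infinity>"
  proof -
    \<comment> \<open>The substitution l = 2x turns e^(-l/2) into e^(-x).\<close>
    have "L = (\<integral>\<^sup>+x\<in>{0<..}. ennreal ((1 + (2 * x powr 1) powr - a) * exp (- (2 * x powr 1 / 2))) * ennreal (2 * (1 * x powr (1 - 1))) \<partial>lborel)"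
      unfolding L_def by (intro nn_integral_power_substitution) auto
    also have "\<dots> \<le> (\<integral>\<^sup>+x. 2 * (ennreal (x powr 0 * exp (- x)) * indicator {0<..} x + ennreal (x powr - a * exp (- x)) * indicator {0<..} x) \<partial>lborel)"
    proof (intro nn_integral_mono)
      fix x :: real
      have "(1 + (2 * x) powr - a) * exp (- x) * 2 \<le> 2 * (exp (- x) + x powr - a * exp (- x))" if "0 < x"
      proof -
        have "(2 * x) powr - a \<le> x powr - a" using that a by (intro powr_mono2') auto
        then have "(2 * x) powr - a * exp (- x) \<le> x powr - a * exp (- x)" by (intro mult_right_mono) auto
        then show ?thesis by (simp add: algebra_simps)
      qed
      then show "ennreal ((1 + (2 * x powr 1) powr - a) * exp (- (2 * x powr 1 / 2))) * ennreal (2 * (1 * x powr (1 - 1))) * indicator {0<..} x \<le>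
        2 * (ennreal (x powr 0 * exp (- x)) * indicator {0<..} x + ennreal (x powr - a * exp (- x)) * indicator {0<..} x)"
        by (auto simp: indicator_def ennreal_leI simp flip: ennreal_mult ennreal_plus ennreal_numeral simp del: ennreal_plus)
    qed
    also have "\<dots> = 2 * (ennreal (Gamma (1 + 0)) + ennreal (Gamma (1 + - a)))"
      using a by (simp add: nn_integral_cmult nn_integral_add nn_integral_Gamma del: powr_zero_eq_one)
    also have "\<dots> < \<infinity>" by (simp add: ennreal_mult_less_top)
    finally show ?thesis .
  qed
  have bd: "(\<integral>\<^sup>+\<theta>\<in>{0<..}. ennreal (wright_density \<alpha> \<theta>) * ennreal (\<theta> powr - a * exp (c * \<theta>)) \<partial>lborel) \<le> ennreal B * L * S"
    if \<alpha>: "\<alpha>0 \<le> \<alpha>" "\<alpha> < 1" for \<alpha>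
  proof -
    have \<alpha>': "0 < \<alpha>" using \<alpha> \<alpha>0 by simp
    have pw: "(kanter \<alpha> \<phi> * l powr (1 - \<alpha>)) powr - a * exp (c * (kanter \<alpha> \<phi> * l powr (1 - \<alpha>))) * (exp (- l) / pi) \<le>
        sin \<phi> powr - a * (B * ((1 + l powr - a) * exp (- (l / 2))))" if \<phi>: "0 < \<phi>" "\<phi> < pi" and l: "0 < l" for \<phi> l
    proof -
      define K where "K = kanter \<alpha> \<phi>"
      have K: "0 < K" "sin \<phi> \<le> K" "K \<le> exp 1" unfolding K_def
        using kanter_pos kanter_ge_sin kanter_le \<alpha>' \<alpha> \<phi> by auto
      have s: "0 < sin \<phi>" using \<phi> by (simp add: sin_gt_zero)
      have Ka: "K powr - a \<le> sin \<phi> powr - a" using K s a by (intro powr_mono2') auto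
      \<comment> \<open>For l <= 1 the term l^(-a) dominates, for l > 1 the constant 1, so the bound
        holds for all \<alpha> at once. The estimate of l^(1-\<alpha>) is split at the same
        point.\<close>
      have la: "l powr (- a * (1 - \<alpha>)) \<le> 1 + l powr - a"
      proof (cases "l \<le> 1")
        case True
        have "l powr (- a * (1 - \<alpha>)) \<le> l powr - a" using True l a \<alpha>' \<alpha>
          by (intro powr_mono') (auto simp: algebra_simps)
        then show ?thesis by simp
      next
        case False
        have "l powr (- a * (1 - \<alpha>)) \<le> l powr 0" using False a \<alpha>
          by (intro powr_mono) (auto simp: mult_nonneg_nonneg)
        moreover have "0 \<le> l powr - a" by simp
        ultimately show ?thesis using l by (simp add: add_increasing2)
      qed
      have lb: "l powr (1 - \<alpha>) \<le> 1 + l powr (1 - \<alpha>0)"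
      proof (cases "l \<le> 1")
        case True
        then have "l powr (1 - \<alpha>) \<le> 1" using l \<alpha> by (intro powr_le1) auto
        then show ?thesis by (simp add: add_increasing2)
      next
        case False
        then have "l powr (1 - \<alpha>) \<le> l powr (1 - \<alpha>0)" using \<alpha> by (intro powr_mono) auto
        then show ?thesis by simp
      qed
      have "c * (K * l powr (1 - \<alpha>)) \<le> c * (exp 1 * (1 + l powr (1 - \<alpha>0)))"
        using c K lb by (intro mult_left_mono mult_mono) auto
      also have "\<dots> \<le> c * exp 1 + (l / 2 + C)" using C[OF l] by (simp add: algebra_simps)
      finally have ex: "c * (K * l powr (1 - \<alpha>)) \<le> c * exp 1 + (l / 2 + C)" .
      have "(K * l powr (1 - \<alpha>)) powr - a * exp (c * (K * l powr (1 - \<alpha>))) * (exp (- l) / pi) =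
         (K powr - a * l powr (- a * (1 - \<alpha>))) * (exp (c * (K * l powr (1 - \<alpha>))) * (exp (- l) / pi))"
        using K l by (simp add: powr_mult powr_powr mult_ac)
      also have "\<dots> \<le> (sin \<phi> powr - a * (1 + l powr - a)) * (exp (c * exp 1 + (l / 2 + C)) * (exp (- l) / pi))"
        by (intro mult_mono Ka la mult_right_mono) (use ex in auto)
      also have "exp (c * exp 1 + (l / 2 + C)) * (exp (- l) / pi) = B * exp (- (l / 2))"
      proof -
        have "c * exp 1 + (l / 2 + C) + - l = (c * exp 1 + C) + - (l / 2)" by simp
        then have "exp (c * exp 1 + (l / 2 + C)) * exp (- l) = exp (c * exp 1 + C) * exp (- (l / 2))"
          unfolding exp_add[symmetric] by presburger
        then show ?thesis unfolding B_def by simp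
      qed
      finally show ?thesis unfolding K_def by (simp add: mult_ac)
    qed
    have "(\<integral>\<^sup>+\<theta>\<in>{0<..}. ennreal (wright_density \<alpha> \<theta>) * ennreal (\<theta> powr - a * exp (c * \<theta>)) \<partial>lborel) =
      (\<integral>\<^sup>+\<phi>\<in>{0<..<pi}. (\<integral>\<^sup>+l\<in>{0<..}. ennreal ((kanter \<alpha> \<phi> * l powr (1 - \<alpha>)) powr - a * exp (c * (kanter \<alpha> \<phi> * l powr (1 - \<alpha>)))) *
        ennreal (exp (- l) / pi) \<partial>lborel) \<partial>lborel)"
      by (intro nn_integral_wright_density \<alpha>' \<alpha>) auto
    also have "\<dots> \<le> (\<integral>\<^sup>+\<phi>. (\<integral>\<^sup>+l. (ennreal (sin \<phi> powr - a) * indicator {0<..<pi} \<phi>) * (ennreal B * (ennreal ((1 + l powr - a) * exp (- (l / 2))) * indicator {0<..} l)) \<partial>lborel) \<partial>lborel)"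
    proof (intro nn_integral_mono)
      fix \<phi> :: real
      have "(\<integral>\<^sup>+l\<in>{0<..}. ennreal ((kanter \<alpha> \<phi> * l powr (1 - \<alpha>)) powr - a * exp (c * (kanter \<alpha> \<phi> * l powr (1 - \<alpha>)))) *
        ennreal (exp (- l) / pi) \<partial>lborel) \<le>
        (\<integral>\<^sup>+l. ennreal (sin \<phi> powr - a) * (ennreal B * (ennreal ((1 + l powr - a) * exp (- (l / 2))) * indicator {0<..} l)) \<partial>lborel)"
        if "0 < \<phi>" "\<phi> < pi"
        using B pw[OF that]
        by (intro nn_integral_mono) (auto simp: indicator_def simp flip: ennreal_mult intro!: ennreal_leI)
      then show "(\<integral>\<^sup>+l\<in>{0<..}. ennreal ((kanter \<alpha> \<phi> * l powr (1 - \<alpha>)) powr - a * exp (c * (kanter \<alpha> \<phi> * l powr (1 - \<alpha>)))) *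
        ennreal (exp (- l) / pi) \<partial>lborel) * indicator {0<..<pi} \<phi> \<le>
        (\<integral>\<^sup>+l. (ennreal (sin \<phi> powr - a) * indicator {0<..<pi} \<phi>) * (ennreal B * (ennreal ((1 + l powr - a) * exp (- (l / 2))) * indicator {0<..} l)) \<partial>lborel)"
        by (auto simp: indicator_def)
    qed
    also have "\<dots> = ennreal B * L * S"
      unfolding L_def S_def by (simp add: nn_integral_cmult nn_integral_multc) (simp add: mult_ac)
    finally show ?thesis .
  qed
  have fin: "ennreal B * L * S < top" using L S by (auto simp: ennreal_mult_less_top)
  then have "ennreal B * L * S \<le> ennreal (enn2real (ennreal B * L * S) + 1)"
    by (metis ennreal_enn2real ennreal_leI enn2real_nonneg le_add_same_cancel1 zero_le_one)
  note le = order_trans[OF bd this]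
  show ?thesis
    by (rule exI[of _ "enn2real (ennreal B * L * S) + 1"])
       (intro conjI ballI le, auto intro: add_nonneg_pos)
qed

section \<open>The Mittag-Leffler transform and uniqueness of the density\<close>

lemma wright_density_nonneg: "0 \<le> wright_density \<alpha> \<theta>"
  by (simp add: wright_density_def)

text \<open>Termwise integration of e^(z\<theta>): the moment n!/Gamma(1+\<alpha>n) turns z^n/n!
  into the n-th term of the Mittag-Leffler series. The exponential moment of order |z| dominates the
  partial sums of the norms.\<close>

lemma is_subordination_density_wright:
  assumes \<alpha>: "0 < \<alpha>" "\<alpha> < 1"
  shows "is_subordination_density \<alpha> (wright_density \<alpha>)"
  unfolding is_subordination_density_def
proof (intro conjI allI impI measurable_wright_density)
  show "0 < wright_density \<alpha> \<theta>" if "0 < \<theta>" for \<theta> using that wright_density_pos[OF \<alpha>] by blast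
  show "(\<integral>\<^sup>+ \<theta>\<in>{0<..}. ennreal (wright_density \<alpha> \<theta>) \<partial>lborel) = 1"
    using wright_density_moment[OF \<alpha>, of 0] by simp
  fix z :: complex
  \<comment> \<open>The cut-off at 0 keeps w(\<theta>) \<theta>^n nonnegative on the whole line,
    also for odd n.\<close>
  define w where "w = (\<lambda>\<theta>. indicator {0<..} \<theta> * wright_density \<alpha> \<theta>)"
  have [measurable]: "w \<in> borel_measurable borel" unfolding w_def by measurable
  have w0: "0 \<le> w \<theta>" for \<theta> unfolding w_def by (simp add: wright_density_nonneg)
  have wn: "0 \<le> w \<theta> * \<theta> ^ n" for \<theta> n
    using w0[of \<theta>] by (cases "0 < \<theta>") (auto simp: w_def)
  define m where "m = (\<lambda>n. fact n / Gamma (1 + \<alpha> * real n))"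
  have m0: "0 \<le> m n" for n using \<alpha> unfolding m_def
    by (intro divide_nonneg_nonneg less_imp_le[OF Gamma_real_pos] add_pos_nonneg) auto
  have mom: "(\<integral>\<^sup>+ \<theta>. ennreal (w \<theta> * \<theta> ^ n) \<partial>lborel) = ennreal (m n)" for n
    unfolding m_def wright_density_moment[OF \<alpha>, symmetric]
    by (intro nn_integral_cong) (auto simp: w_def indicator_def ennreal_mult wright_density_nonneg)
  have hb: "has_bochner_integral lborel (\<lambda>\<theta>. w \<theta> * \<theta> ^ n) (m n)" for n
    by (rule has_bochner_integral_nn_integral) (use wn m0 mom in auto)
  define f where "f = (\<lambda>n \<theta>. (z ^ n / fact n) * complex_of_real (w \<theta> * \<theta> ^ n))"
  have hbf: "has_bochner_integral lborel (f n) ((z ^ n / fact n) * of_real (m n))" for n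
    unfolding f_def by (intro has_bochner_integral_mult_right has_bochner_integral_of_real hb)
  have nf: "norm (f n \<theta>) = cmod z ^ n / fact n * (w \<theta> * \<theta> ^ n)" for n \<theta>
    unfolding f_def norm_mult[of "z ^ n / fact n"] norm_of_real abs_of_nonneg[OF wn]
    by (simp add: norm_divide norm_power)
  have hbn: "has_bochner_integral lborel (\<lambda>\<theta>. norm (f n \<theta>)) (cmod z ^ n / fact n * m n)" for n
    unfolding nf by (intro has_bochner_integral_mult_right hb)
  have es: "(\<lambda>n. cmod z ^ n / fact n * (w \<theta> * \<theta> ^ n)) sums (w \<theta> * exp (cmod z * \<theta>))" for \<theta>
  proof -
    have "(\<lambda>n. w \<theta> * ((cmod z * \<theta>) ^ n /\<^sub>R fact n)) sums (w \<theta> * exp (cmod z * \<theta>))"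
      by (intro sums_mult exp_converges)
    then show ?thesis by (simp add: power_mult_distrib field_simps)
  qed
  have s1: "summable (\<lambda>n. norm (f n \<theta>))" for \<theta> using es[of \<theta>] unfolding nf by (rule sums_summable)
  \<comment> \<open>The case a = 0, c = |z| of the uniform bound: an exponential moment.\<close>
  obtain D where D: "(\<integral>\<^sup>+\<theta>\<in>{0<..}. ennreal (wright_density \<alpha> \<theta>) * ennreal (\<theta> powr - 0 * exp (cmod z * \<theta>)) \<partial>lborel) \<le> ennreal D" "0 < D"
  proof -
    obtain D where "0 < D" and *: "\<forall>\<beta>\<in>{\<alpha>..<1}. (\<integral>\<^sup>+\<theta>\<in>{0<..}. ennreal (wright_density \<beta> \<theta>) *
        ennreal (\<theta> powr - 0 * exp (cmod z * \<theta>)) \<partial>lborel) \<le> ennreal D"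
      using wright_density_bound[OF \<alpha> order_refl zero_less_one norm_ge_zero[of z]] by blast
    have "\<alpha> \<in> {\<alpha>..<1}" using \<alpha> by simp
    with * \<open>0 < D\<close> show ?thesis using that by blast
  qed
  have s2: "summable (\<lambda>n. \<integral>\<theta>. norm (f n \<theta>) \<partial>lborel)"
  proof (rule summableI_nonneg_bounded)
    fix N
    have "ennreal (\<Sum>n<N. \<integral>\<theta>. norm (f n \<theta>) \<partial>lborel) = (\<integral>\<^sup>+\<theta>. (\<Sum>n<N. ennreal (norm (f n \<theta>))) \<partial>lborel)"
    proof -
      have [measurable]: "f n \<in> borel_measurable borel" for n unfolding f_def by measurable
      show ?thesis
        by (subst nn_integral_sum)
          (use hbn m0 in \<open>auto simp: nn_integral_eq_integral has_bochner_integral_iff sum_ennreal intro!: sum_nonneg\<close>)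
    qed
    also have "\<dots> \<le> (\<integral>\<^sup>+\<theta>\<in>{0<..}. ennreal (wright_density \<alpha> \<theta>) * ennreal (\<theta> powr - 0 * exp (cmod z * \<theta>)) \<partial>lborel)"
    proof (intro nn_integral_mono)
      fix \<theta> :: real
      have "(\<Sum>n<N. norm (f n \<theta>)) \<le> w \<theta> * exp (cmod z * \<theta>)"
        using es[of \<theta>] s1[of \<theta>] by (subst sums_unique[OF es]) (auto intro!: sum_le_suminf simp: nf wn)
      then have "(\<Sum>n<N. ennreal (norm (f n \<theta>))) \<le> ennreal (w \<theta> * exp (cmod z * \<theta>))"
        by (simp add: ennreal_leI)
      also have "\<dots> = ennreal (wright_density \<alpha> \<theta>) * ennreal (\<theta> powr - 0 * exp (cmod z * \<theta>)) * indicator {0<..} \<theta>"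
        by (auto simp: w_def indicator_def ennreal_mult wright_density_nonneg)
      finally show "(\<Sum>n<N. ennreal (norm (f n \<theta>))) \<le> ennreal (wright_density \<alpha> \<theta>) * ennreal (\<theta> powr - 0 * exp (cmod z * \<theta>)) * indicator {0<..} \<theta>" .
    qed
    also note D(1)
    finally have "ennreal (\<Sum>n<N. \<integral>\<theta>. norm (f n \<theta>) \<partial>lborel) \<le> ennreal D" .
    then show "(\<Sum>n<N. \<integral>\<theta>. norm (f n \<theta>) \<partial>lborel) \<le> D" using D(2) by (simp add: ennreal_le_iff)
  qed auto
  have int: "integrable lborel (f n)" for n using hbf by (simp add: has_bochner_integral_iff)
  note S = integrable_suminf[OF int _ s2] integral_suminf[OF int _ s2]
  have sf: "(\<Sum>n. f n \<theta>) = of_real (w \<theta>) * exp (z * of_real \<theta>)" for \<theta>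
  proof -
    have "(\<lambda>n. of_real (w \<theta>) * ((z * of_real \<theta>) ^ n /\<^sub>R fact n)) sums (of_real (w \<theta>) * exp (z * of_real \<theta>))"
      by (intro sums_mult exp_converges)
    also have "(\<lambda>n. of_real (w \<theta>) * ((z * of_real \<theta>) ^ n /\<^sub>R fact n)) = (\<lambda>n. f n \<theta>)"
      by (auto simp: f_def fun_eq_iff power_mult_distrib scaleR_conv_of_real field_simps)
    finally show ?thesis by (rule sums_unique[symmetric])
  qed
  have wi: "of_real (w \<theta>) * exp (z * of_real \<theta>) =
    indicator {0<..} \<theta> *\<^sub>R (complex_of_real (wright_density \<alpha> \<theta>) * exp (z * of_real \<theta>))" for \<theta>
    by (auto simp: w_def indicator_def)
  show "set_integrable lborel {0<..} (\<lambda>\<theta>. complex_of_real (wright_density \<alpha> \<theta>) * exp (z * complex_of_real \<theta>))"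
    unfolding set_integrable_def wi[symmetric] sf[symmetric] by (rule S(1)) (simp add: s1)
  have "(LINT \<theta>:{0<..}|lborel. complex_of_real (wright_density \<alpha> \<theta>) * exp (z * complex_of_real \<theta>)) =
    (\<Sum>n. integral\<^sup>L lborel (f n))"
    unfolding set_lebesgue_integral_def wi[symmetric] sf[symmetric] by (rule S(2)) (simp add: s1)
  also have "(\<lambda>n. integral\<^sup>L lborel (f n)) = (\<lambda>n. z ^ n / of_real (Gamma (\<alpha> * real n + 1)))"
    using hbf by (simp add: has_bochner_integral_iff m_def add.commute fun_eq_iff)
  finally show "(LINT \<theta>:{0<..}|lborel. complex_of_real (wright_density \<alpha> \<theta>) * exp (z * complex_of_real \<theta>)) = mittag_leffler \<alpha> 1 z"
    unfolding mittag_leffler_def .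
qed

lemma subordination_density_spec:
  assumes "0 < \<alpha>" "\<alpha> < 1"
  shows "is_subordination_density \<alpha> (subordination_density \<alpha>)"
  unfolding subordination_density_def
  by (rule someI[where P = "is_subordination_density \<alpha>", OF is_subordination_density_wright[OF assms]])

lemma is_subordination_density_measurable:
  "is_subordination_density \<alpha> h \<Longrightarrow> h \<in> borel_measurable borel"
  unfolding is_subordination_density_def by blast

text \<open>At z = it the exponential transform is the characteristic function of the law that the
  density defines on the half-line.\<close>

lemma
  assumes "is_subordination_density \<alpha> h"
  defines "M \<equiv> density lborel (\<lambda>\<theta>. ennreal (indicator {0<..} \<theta> * h \<theta>))"
  shows real_distribution_subordination_density: "real_distribution M"
    and char_subordination_density: "char M t = mittag_leffler \<alpha> 1 (\<i> * of_real t)"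
proof -
  have [measurable]: "h \<in> borel_measurable borel" and pos: "\<And>\<theta>. 0 < \<theta> \<Longrightarrow> 0 < h \<theta>"
    and one: "(\<integral>\<^sup>+ \<theta>\<in>{0<..}. ennreal (h \<theta>) \<partial>lborel) = 1"
    and ml: "\<And>z. (LINT \<theta>:{0<..}|lborel. of_real (h \<theta>) * exp (z * of_real \<theta>)) = mittag_leffler \<alpha> 1 z"
    using assms(1) unfolding is_subordination_density_def by blast+
  show "real_distribution M"
  proof (rule real_distribution.intro)
    have "emeasure M (space M) = (\<integral>\<^sup>+ \<theta>\<in>{0<..}. ennreal (h \<theta>) \<partial>lborel)"
      unfolding M_def by (subst emeasure_density) (auto intro!: nn_integral_cong simp: indicator_def)
    then show "prob_space M" unfolding one by (rule prob_spaceI)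
    show "real_distribution_axioms M" by standard (simp add: M_def)
  qed
  have "char M t = (\<integral>\<theta>. (indicator {0<..} \<theta> * h \<theta>) *\<^sub>R iexp (t * \<theta>) \<partial>lborel)"
    unfolding char_def M_def using pos
    by (subst integral_density) (auto simp: indicator_def less_imp_le)
  also have "\<dots> = (LINT \<theta>:{0<..}|lborel. of_real (h \<theta>) * exp (\<i> * of_real t * of_real \<theta>))"
    unfolding set_lebesgue_integral_def
    by (intro Bochner_Integration.integral_cong) (auto simp: scaleR_conv_of_real mult.assoc)
  finally show "char M t = mittag_leffler \<alpha> 1 (\<i> * of_real t)" unfolding ml .
qed

text \<open>The choice operator may pick a version other than \<open>wright_density\<close>. All
  versions have the characteristic function E_{\<alpha>,1}(it), hence define the same law, and so
  estimates transfer from one version to another.\<close>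

lemma subordination_density_nn_integral_unique:
  fixes f :: "real \<Rightarrow> ennreal"
  assumes g: "is_subordination_density \<alpha> g" and h: "is_subordination_density \<alpha> h"
    and [measurable]: "f \<in> borel_measurable borel"
  shows "(\<integral>\<^sup>+\<theta>\<in>{0<..}. ennreal (g \<theta>) * f \<theta> \<partial>lborel) = (\<integral>\<^sup>+\<theta>\<in>{0<..}. ennreal (h \<theta>) * f \<theta> \<partial>lborel)"
proof -
  have [measurable]: "g \<in> borel_measurable borel" "h \<in> borel_measurable borel"
    using g h by (auto intro: is_subordination_density_measurable)
  have eq: "density lborel (\<lambda>\<theta>. ennreal (indicator {0<..} \<theta> * g \<theta>)) = density lborel (\<lambda>\<theta>. ennreal (indicator {0<..} \<theta> * h \<theta>))"
    by (rule Levy_uniqueness) (auto simp: fun_eq_iff char_subordination_density[OF g] char_subordination_density[OF h]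
      intro: real_distribution_subordination_density g h)
  have *: "(\<integral>\<^sup>+\<theta>\<in>{0<..}. ennreal (k \<theta>) * f \<theta> \<partial>lborel) = (\<integral>\<^sup>+\<theta>. f \<theta> \<partial>density lborel (\<lambda>\<theta>. ennreal (indicator {0<..} \<theta> * k \<theta>)))"
    if [measurable]: "k \<in> borel_measurable borel" for k
    by (subst nn_integral_density) (auto intro!: nn_integral_cong simp: indicator_def)
  show ?thesis by (simp add: * eq)
qed

lemma subordination_density_measurable:
  "0 < \<alpha> \<Longrightarrow> \<alpha> < 1 \<Longrightarrow> subordination_density \<alpha> \<in> borel_measurable borel"
  by (rule is_subordination_density_measurable[OF subordination_density_spec])

lemma subordination_density_bound:
  assumes "0 < \<alpha>0" "\<alpha>0 < 1" "0 \<le> a" "a < 1" "0 \<le> c"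
  shows "\<exists>D>0. \<forall>\<alpha>\<in>{\<alpha>0..<1}.
    (\<integral>\<^sup>+\<theta>\<in>{0<..}. ennreal (subordination_density \<alpha> \<theta>) * ennreal (\<theta> powr - a * exp (c * \<theta>)) \<partial>lborel) \<le> ennreal D"
proof -
  obtain D where D: "D > 0" "\<And>\<alpha>. \<alpha> \<in> {\<alpha>0..<1} \<Longrightarrow>
    (\<integral>\<^sup>+\<theta>\<in>{0<..}. ennreal (wright_density \<alpha> \<theta>) * ennreal (\<theta> powr - a * exp (c * \<theta>)) \<partial>lborel) \<le> ennreal D"
    using wright_density_bound[OF assms] by blast
  have "(\<integral>\<^sup>+\<theta>\<in>{0<..}. ennreal (subordination_density \<alpha> \<theta>) * ennreal (\<theta> powr - a * exp (c * \<theta>)) \<partial>lborel) \<le> ennreal D"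
    if "\<alpha> \<in> {\<alpha>0..<1}" for \<alpha>
  proof -
    have "0 < \<alpha>" "\<alpha> < 1" using that assms by auto
    then have "(\<integral>\<^sup>+\<theta>\<in>{0<..}. ennreal (subordination_density \<alpha> \<theta>) * ennreal (\<theta> powr - a * exp (c * \<theta>)) \<partial>lborel) =
      (\<integral>\<^sup>+\<theta>\<in>{0<..}. ennreal (wright_density \<alpha> \<theta>) * ennreal (\<theta> powr - a * exp (c * \<theta>)) \<partial>lborel)"
      by (intro subordination_density_nn_integral_unique[where \<alpha> = \<alpha>] subordination_density_spec is_subordination_density_wright) auto
    then show ?thesis using D(2)[OF that] by simp
  qed
  with D(1) show ?thesis by blast
qed

section \<open>Uniformly local estimates for the heat kernel\<close>

lemma ennreal_pow_ennreal [simp]: "0 \<le> r \<Longrightarrow> ennreal_pow (ennreal r) p = ennreal (r powr p)"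
  by (simp add: ennreal_pow_def)

lemma ennreal_pow_top [simp]: "ennreal_pow top p = top"
  by (simp add: ennreal_pow_def)

lemma measurable_ennreal_pow [measurable]: "(\<lambda>v. ennreal_pow v p) \<in> borel_measurable borel"
  unfolding ennreal_pow_def by measurable

lemma ennreal_pow_mono:
  assumes "0 \<le> p" "v \<le> w" shows "ennreal_pow v p \<le> ennreal_pow w p"
proof (cases "w = top")
  case False
  then obtain y where y: "w = ennreal y" "0 \<le> y" by (cases w) auto
  then obtain x where x: "v = ennreal x" "0 \<le> x" using assms by (cases v) (auto simp: top_unique)
  then have "x \<le> y" using assms x y by simp
  then show ?thesis using assms x y by (auto intro!: ennreal_leI powr_mono2)
qed simp

lemma ennreal_pow_inverse:
  assumes "0 < p" shows "ennreal_pow (ennreal_pow v p) (1 / p) = v" "ennreal_pow (ennreal_pow v (1 / p)) p = v"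
  using assms by (cases v; simp add: powr_powr; fail)+

text \<open>The power p is an order isomorphism whose inverse is the power 1/p, so it commutes with
  suprema.\<close>

lemma ennreal_pow_SUP:
  assumes "0 < p" shows "ennreal_pow (SUP n. f n) p = (SUP n. ennreal_pow (f n) p)"
proof (rule antisym)
  let ?S = "SUP n. ennreal_pow (f n) p"
  have "f n \<le> ennreal_pow ?S (1 / p)" for n
  proof -
    have "ennreal_pow (ennreal_pow (f n) p) (1 / p) \<le> ennreal_pow ?S (1 / p)"
      using assms by (intro ennreal_pow_mono SUP_upper) auto
    then show ?thesis using assms by (simp add: ennreal_pow_inverse)
  qed
  then have "(SUP n. f n) \<le> ennreal_pow ?S (1 / p)" by (intro SUP_least)
  then have "ennreal_pow (SUP n. f n) p \<le> ennreal_pow (ennreal_pow ?S (1 / p)) p"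
    using assms by (intro ennreal_pow_mono) auto
  then show "ennreal_pow (SUP n. f n) p \<le> ?S" using assms by (simp add: ennreal_pow_inverse)
  show "?S \<le> ennreal_pow (SUP n. f n) p"
    using assms by (intro SUP_least ennreal_pow_mono SUP_upper) auto
qed

text \<open>From x + y <= 2 max(x, y). It takes the place of the triangle inequality in L^p; its
  constant is paid for by the fractions A/4 in \<open>picard_local_bound\<close>.\<close>

lemma ennreal_pow_add_le:
  assumes "0 < p"
  shows "ennreal_pow (v + w) p \<le> ennreal (2 powr p) * (ennreal_pow v p + ennreal_pow w p)"
proof (cases "v = \<infinity> \<or> w = \<infinity>")
  case True
  then show ?thesis using assms by (auto simp: ennreal_mult_eq_top_iff)
next
  case False
  then obtain x y where xy: "v = ennreal x" "w = ennreal y" "0 \<le> x" "0 \<le> y"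
    by (metis ennreal_cases infinity_ennreal_def)
  have "(x + y) powr p \<le> (2 * max x y) powr p" using xy assms by (intro powr_mono2) auto
  also have "\<dots> = 2 powr p * max x y powr p" by (simp add: powr_mult)
  also have "\<dots> \<le> 2 powr p * (x powr p + y powr p)"
    by (intro mult_left_mono) (auto simp: max_def)
  finally show ?thesis using xy
    by (simp flip: ennreal_plus ennreal_mult add: ennreal_leI)
qed

text \<open>The tangent of u^p at u = 1, obtained as a case of Young's inequality.\<close>

lemma powr_tangent_le:
  fixes u :: real
  assumes "1 < p" "0 \<le> u" shows "p * u \<le> u powr p + (p - 1)"
proof -
  define q where "q = p / (p - 1)"
  have q: "1 < q" "1 / p + 1 / q = 1" using assms by (auto simp: q_def field_simps)
  have "u * 1 \<le> u powr p / p + 1 powr q / q" using assms q by (intro Youngs_inequality) auto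
  then have "p * u \<le> p * (u powr p / p + 1 / q)" using assms by (intro mult_left_mono) auto
  also have "\<dots> = u powr p + (p - 1)" using assms by (simp add: q_def field_simps)
  finally show ?thesis .
qed

text \<open>\<open>powr_tangent_le\<close> at u = F/(m k), multiplied by m k^p. The factor m^(1-p)
  is chosen so that F^p m^(1-p) integrates to at most m when F has L^p norm at most m.\<close>

lemma powr_weighted_tangent_le:
  fixes F m k :: real
  assumes p: "1 < p" and F: "0 \<le> F" and m: "0 < m" and k: "0 < k"
  shows "p * k powr (p - 1) * F \<le> F powr p * m powr (1 - p) + (p - 1) * k powr p * m"
proof -
  have "p * (F / (m * k)) \<le> (F / (m * k)) powr p + (p - 1)"
    using assms by (intro powr_tangent_le) auto
  then have "m * k powr p * (p * (F / (m * k))) \<le> m * k powr p * ((F / (m * k)) powr p + (p - 1))"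
    using m by (intro mult_left_mono) auto
  moreover have "m * k powr p * (p * (F / (m * k))) = p * k powr (p - 1) * F"
    using m k by (simp add: powr_diff)
  moreover have "m * k powr p * (F / (m * k)) powr p = F powr p * m powr (1 - p)"
    using m k F by (simp add: powr_mult powr_divide powr_diff)
  ultimately show ?thesis by (simp add: algebra_simps)
qed

text \<open>The tangent line of \<open>u\<^sup>p\<close> at \<open>k = I(x)/c\<close>, where \<open>I(x)\<close> is the inner integral, takes the place
  of Hoelder's inequality.\<close>

lemma nn_integral_Minkowski:
  fixes F :: "'i \<Rightarrow> 'x \<Rightarrow> real" and m :: "'i \<Rightarrow> real" and w :: "'i \<Rightarrow> ennreal"
  assumes p: "1 < p" and \<nu>: "sigma_finite_measure \<nu>" and \<kappa>: "sigma_finite_measure \<kappa>"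
    and F [measurable]: "(\<lambda>(i, x). F i x) \<in> borel_measurable (\<nu> \<Otimes>\<^sub>M \<kappa>)"
    and m [measurable]: "m \<in> borel_measurable \<nu>"
    and w [measurable]: "w \<in> borel_measurable \<nu>"
    and F0: "\<And>i x. 0 \<le> F i x"
    and m0: "\<And>i. w i \<noteq> 0 \<Longrightarrow> 0 < m i"
    and bd: "\<And>i. w i \<noteq> 0 \<Longrightarrow> (\<integral>\<^sup>+x. ennreal (F i x powr p) \<partial>\<kappa>) \<le> ennreal (m i powr p)"
    and tot: "(\<integral>\<^sup>+i. ennreal (m i) * w i \<partial>\<nu>) \<le> ennreal c" and c: "0 < c"
  shows "(\<integral>\<^sup>+x. ennreal_pow (\<integral>\<^sup>+i. ennreal (F i x) * w i \<partial>\<nu>) p \<partial>\<kappa>) \<le> ennreal (c powr p)"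
proof -
  interpret P: pair_sigma_finite \<nu> \<kappa> using \<nu> \<kappa> by (simp add: pair_sigma_finite_def)
  \<comment> \<open>By the L^p bound on each member of the family, the integral of Q over x is at
    most that of m w, hence at most c.\<close>
  define Q where "Q = (\<lambda>x. \<integral>\<^sup>+i. ennreal (F i x powr p * m i powr (1 - p)) * w i \<partial>\<nu>)"
  have pt: "ennreal_pow (\<integral>\<^sup>+i. ennreal (F i x) * w i \<partial>\<nu>) p \<le> ennreal (c powr (p - 1)) * Q x"
    if x [measurable]: "x \<in> space \<kappa>" for x
  proof -
    define I where "I = (\<integral>\<^sup>+i. ennreal (F i x) * w i \<partial>\<nu>)"
    have [measurable]: "(\<lambda>i. F i x) \<in> borel_measurable \<nu>"
      using measurable_compose[OF measurable_Pair2'[OF x] F] by simp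
    have tan: "ennreal (p * k powr (p - 1)) * I \<le> Q x + ennreal ((p - 1) * k powr p * c)" if k: "0 < k" for k
    proof -
      have "ennreal (p * k powr (p - 1)) * I = (\<integral>\<^sup>+i. ennreal (p * k powr (p - 1) * F i x) * w i \<partial>\<nu>)"
        unfolding I_def using p F0
        by (subst nn_integral_cmult[symmetric]) (auto intro!: nn_integral_cong simp: ennreal_mult mult.assoc)
      also have "\<dots> \<le> (\<integral>\<^sup>+i. ennreal (F i x powr p * m i powr (1 - p)) * w i + ennreal ((p - 1) * k powr p) * (ennreal (m i) * w i) \<partial>\<nu>)"
      proof (intro nn_integral_mono)
        fix i
        show "ennreal (p * k powr (p - 1) * F i x) * w i \<le>
          ennreal (F i x powr p * m i powr (1 - p)) * w i + ennreal ((p - 1) * k powr p) * (ennreal (m i) * w i)"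
        proof (cases "w i = 0")
          case False
          have "ennreal (p * k powr (p - 1) * F i x) \<le> ennreal (F i x powr p * m i powr (1 - p) + (p - 1) * k powr p * m i)"
            using powr_weighted_tangent_le[OF p F0 m0[OF False] k] by (rule ennreal_leI)
          also have "\<dots> = ennreal (F i x powr p * m i powr (1 - p)) + ennreal ((p - 1) * k powr p) * ennreal (m i)"
            using p m0[OF False] by (simp add: ennreal_mult)
          finally have "ennreal (p * k powr (p - 1) * F i x) * w i \<le>
            (ennreal (F i x powr p * m i powr (1 - p)) + ennreal ((p - 1) * k powr p) * ennreal (m i)) * w i"
            by (rule mult_right_mono) simp
          then show ?thesis by (simp add: distrib_right mult.assoc)
        qed simp
      qed
      also have "\<dots> = Q x + ennreal ((p - 1) * k powr p) * (\<integral>\<^sup>+i. ennreal (m i) * w i \<partial>\<nu>)"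
        unfolding Q_def by (simp add: nn_integral_add nn_integral_cmult)
      also have "\<dots> \<le> Q x + ennreal ((p - 1) * k powr p) * ennreal c"
        by (intro add_left_mono mult_left_mono tot) auto
      finally show ?thesis using p c by (simp add: ennreal_mult)
    qed
    show ?thesis
    proof (cases "Q x = \<infinity>")
      case True
      then show ?thesis using c by (simp add: ennreal_mult_eq_top_iff)
    next
      case False
      then obtain q where q: "Q x = ennreal q" "0 \<le> q" by (metis ennreal_cases infinity_ennreal_def)
      \<comment> \<open>Any k > 0 shows that I is finite where Q is; only then can the optimal k =
        I/c be inserted.\<close>
      have "I \<noteq> \<infinity>"
      proof
        assume "I = \<infinity>"
        with tan[of 1] q p c show False by (simp add: ennreal_mult_eq_top_iff top_unique flip: ennreal_plus)
      qed
      then obtain r where r: "I = ennreal r" "0 \<le> r" by (metis ennreal_cases infinity_ennreal_def)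
      have "r powr p \<le> c powr (p - 1) * q"
      proof (cases "r = 0")
        case True then show ?thesis using q by simp
      next
        case False
        then have r0: "0 < r" using r by simp
        have "ennreal (p * (r / c) powr (p - 1) * r) \<le> ennreal (q + (p - 1) * (r / c) powr p * c)"
          using tan[of "r / c"] r0 c p q r by (simp flip: ennreal_mult ennreal_plus)
        then have "p * (r / c) powr (p - 1) * r \<le> q + (p - 1) * (r / c) powr p * c"
          using q c p by (subst (asm) ennreal_le_iff) auto
        moreover have "(r / c) powr (p - 1) * r = r powr p / c powr (p - 1)"
          using r0 c by (simp add: powr_divide powr_diff)
        moreover have "(r / c) powr p * c = r powr p / c powr (p - 1)"
          using r0 c by (simp add: powr_divide powr_diff)
        ultimately have "p * (r powr p / c powr (p - 1)) \<le> q + (p - 1) * (r powr p / c powr (p - 1))"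
          by (simp add: mult.assoc)
        then have "r powr p / c powr (p - 1) \<le> q"
          by (simp only: left_diff_distrib mult_1)
        then show ?thesis using c by (simp add: field_simps)
      qed
      then show ?thesis unfolding I_def[symmetric] using q r c
        by (simp flip: ennreal_mult add: ennreal_leI)
    qed
  qed
  have "(\<integral>\<^sup>+x. Q x \<partial>\<kappa>) = (\<integral>\<^sup>+i. (\<integral>\<^sup>+x. ennreal (F i x powr p * m i powr (1 - p)) * w i \<partial>\<kappa>) \<partial>\<nu>)"
    unfolding Q_def by (rule P.Fubini') measurable
  also have "\<dots> \<le> (\<integral>\<^sup>+i. ennreal (m i) * w i \<partial>\<nu>)"
  proof (intro nn_integral_mono)
    fix i assume i: "i \<in> space \<nu>"
    have [measurable]: "F i \<in> borel_measurable \<kappa>"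
      using measurable_compose[OF measurable_Pair1'[OF i] F] by simp
    show "(\<integral>\<^sup>+x. ennreal (F i x powr p * m i powr (1 - p)) * w i \<partial>\<kappa>) \<le> ennreal (m i) * w i"
    proof (cases "w i = 0")
      case False
      have "(\<integral>\<^sup>+x. ennreal (F i x powr p * m i powr (1 - p)) * w i \<partial>\<kappa>) =
        (\<integral>\<^sup>+x. ennreal (F i x powr p) \<partial>\<kappa>) * (ennreal (m i powr (1 - p)) * w i)"
        by (subst nn_integral_multc[symmetric]) (auto simp: ennreal_mult mult.assoc)
      also have "\<dots> \<le> ennreal (m i powr p) * (ennreal (m i powr (1 - p)) * w i)"
        by (intro mult_right_mono bd False) auto
      also have "\<dots> = ennreal (m i powr p * m i powr (1 - p)) * w i" by (simp add: ennreal_mult mult.assoc)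
      also have "m i powr p * m i powr (1 - p) = m i" using m0[OF False] by (simp flip: powr_add)
      finally show ?thesis .
    qed simp
  qed
  also have "\<dots> \<le> ennreal c" by (rule tot)
  finally have Q: "(\<integral>\<^sup>+x. Q x \<partial>\<kappa>) \<le> ennreal c" .
  have "(\<integral>\<^sup>+x. ennreal_pow (\<integral>\<^sup>+i. ennreal (F i x) * w i \<partial>\<nu>) p \<partial>\<kappa>) \<le> (\<integral>\<^sup>+x. ennreal (c powr (p - 1)) * Q x \<partial>\<kappa>)"
    by (intro nn_integral_mono pt)
  also have "\<dots> = ennreal (c powr (p - 1)) * (\<integral>\<^sup>+x. Q x \<partial>\<kappa>)"
    unfolding Q_def by (intro nn_integral_cmult) measurable
  also have "\<dots> \<le> ennreal (c powr (p - 1)) * ennreal c"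
    by (intro mult_left_mono Q) simp
  also have "\<dots> = ennreal (c powr p)" using c by (simp add: powr_diff flip: ennreal_mult)
  finally show ?thesis .
qed

section \<open>Exponential weights and local norms of the heat kernel\<close>

lemma nn_integral_lborel_scale:
  fixes f :: "'a::euclidean_space \<Rightarrow> ennreal"
  assumes [measurable]: "f \<in> borel_measurable borel" and c: "0 < c"
  shows "(\<integral>\<^sup>+x. f x \<partial>lborel) = ennreal (c ^ DIM('a)) * (\<integral>\<^sup>+x. f (t + c *\<^sub>R x) \<partial>lborel)"
  using c by (subst lborel_affine[of c t]) (auto simp: nn_integral_density nn_integral_distr nn_integral_cmult)

text \<open>Write e^(-|x|) as the integral of e^(-s) over s >= |x|. Tonelli then leaves ball
  volumes, a power of s, against e^(-s): a Gamma integral.\<close>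

lemma nn_integral_exp_neg_norm_finite:
  "(\<integral>\<^sup>+x. ennreal (exp (- norm (x::'a::euclidean_space))) \<partial>lborel) < \<infinity>"
proof -
  have e: "ennreal (exp (- norm x)) = (\<integral>\<^sup>+s. ennreal (exp (- s)) * indicator {norm x..} s \<partial>lborel)" for x :: 'a
  proof -
    have "((\<lambda>s::real. - exp (- s)) \<longlongrightarrow> - 0) at_top"
      by (intro tendsto_minus filterlim_compose[OF exp_at_bot] filterlim_uminus_at_bot_at_top)
    then have "(\<integral>\<^sup>+s. ennreal (exp (- s)) * indicator {norm x..} s \<partial>lborel) = ennreal (0 - (- exp (- norm x)))"
      by (intro nn_integral_FTC_atLeast) (auto intro!: derivative_eq_intros)
    then show ?thesis by simp
  qed
  have "(\<integral>\<^sup>+x. ennreal (exp (- norm (x::'a))) \<partial>lborel) =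
    (\<integral>\<^sup>+x. (\<integral>\<^sup>+s. ennreal (exp (- s)) * indicator {z. norm (fst z) \<le> snd z} (x::'a, s) \<partial>lborel) \<partial>lborel)"
    unfolding e by (intro nn_integral_cong) (auto simp: indicator_def)
  also have "\<dots> = (\<integral>\<^sup>+s. (\<integral>\<^sup>+x. ennreal (exp (- s)) * indicator {z. norm (fst z) \<le> snd z} (x::'a, s) \<partial>lborel) \<partial>lborel)"
    by (rule lborel_pair.Fubini'[symmetric]) measurable
  also have "\<dots> \<le> (\<integral>\<^sup>+s. ennreal (unit_ball_vol (DIM('a))) * (ennreal (s powr DIM('a) * exp (- s)) * indicator {0<..} s) \<partial>lborel)"
  proof (rule nn_integral_mono_AE, rule AE_mp[OF AE_lborel_singleton[of 0]], rule AE_I2, rule impI)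
    fix s :: real assume "s \<noteq> 0"
    have "(\<integral>\<^sup>+x. ennreal (exp (- s)) * indicator {z. norm (fst z) \<le> snd z} (x::'a, s) \<partial>lborel) = ennreal (exp (- s)) * emeasure lborel (cball (0::'a) s)"
      by (subst nn_integral_cmult_indicator[symmetric]) (auto intro!: nn_integral_cong simp: indicator_def)
    also have "\<dots> \<le> ennreal (unit_ball_vol (DIM('a))) * (ennreal (s powr DIM('a) * exp (- s)) * indicator {0<..} s)"
    proof (cases "0 < s")
      case True
      then show ?thesis by (simp add: emeasure_cball powr_realpow mult_ac flip: ennreal_mult)
    qed (use \<open>s \<noteq> 0\<close> in auto)
    finally show "(\<integral>\<^sup>+x. ennreal (exp (- s)) * indicator {z. norm (fst z) \<le> snd z} (x::'a, s) \<partial>lborel) \<le>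
      ennreal (unit_ball_vol (DIM('a))) * (ennreal (s powr DIM('a) * exp (- s)) * indicator {0<..} s)" .
  qed
  also have "\<dots> = ennreal (unit_ball_vol (DIM('a))) * ennreal (Gamma (1 + real DIM('a)))"
    by (subst nn_integral_cmult, measurable) (subst nn_integral_Gamma, auto intro: less_le_trans[of _ 0])
  also have "\<dots> < \<infinity>" by (simp add: ennreal_mult_less_top)
  finally show ?thesis .
qed

text \<open>Averaging over the ball of radius \<open>R\<close> around \<open>y\<close> replaces a covering argument.\<close>

lemma exp_weight_le_local_mass:
  "\<exists>C>0. \<forall>(\<mu> :: 'a::euclidean_space measure) f R z M.
     sigma_finite_measure \<mu> \<longrightarrow> sets \<mu> = sets borel \<longrightarrow> f \<in> borel_measurable borel \<longrightarrow> 0 < R \<longrightarrow>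
     (\<forall>w. (\<integral>\<^sup>+y\<in>ball w R. f y \<partial>\<mu>) \<le> M) \<longrightarrow>
     (\<integral>\<^sup>+y. ennreal (exp (- norm (y - z) / R)) * f y \<partial>\<mu>) \<le> ennreal C * M"
proof -
  define E where "E = (\<integral>\<^sup>+x. ennreal (exp (- norm (x::'a))) \<partial>lborel)"
  have E: "E < \<infinity>" unfolding E_def by (rule nn_integral_exp_neg_norm_finite)
  define v where "v = unit_ball_vol (real DIM('a))"
  have v: "0 < v" unfolding v_def by (simp add: unit_ball_vol_pos)
  \<comment> \<open>The factor e bounds the oscillation of the weight over one ball, and E/v
    compares its total integral with the volume of the unit ball. Powers of R cancel, so C serves
    all radii; the summand 1 makes positivity evident.\<close>
  define C where "C = exp 1 * enn2real E / v + 1"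
  have "(\<integral>\<^sup>+y. ennreal (exp (- norm (y - z) / R)) * f y \<partial>\<mu>) \<le> ennreal C * M"
    if \<mu>: "sigma_finite_measure \<mu>" and s [measurable_cong]: "sets \<mu> = sets borel" and f [measurable]: "f \<in> borel_measurable borel"
      and R: "0 < R" and M: "\<And>w. (\<integral>\<^sup>+y\<in>ball w R. f y \<partial>\<mu>) \<le> M"
    for \<mu> :: "'a measure" and f R z M
  proof -
    interpret P: pair_sigma_finite lborel \<mu> using \<mu> by (simp add: pair_sigma_finite_def lborel.sigma_finite_measure_axioms)
    define I where "I = (\<integral>\<^sup>+y. ennreal (exp (- norm (y - z) / R)) * f y \<partial>\<mu>)"
    have "ennreal (v * R ^ DIM('a)) * I = (\<integral>\<^sup>+y. (\<integral>\<^sup>+w. (ennreal (exp (- norm (y - z) / R)) * f y) * indicator {q. dist (fst q) (snd q) < R} (w, y) \<partial>lborel) \<partial>\<mu>)"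
      unfolding I_def
    proof (subst nn_integral_cmult[symmetric], measurable, intro nn_integral_cong)
      fix y :: 'a
      have "(\<integral>\<^sup>+w. (ennreal (exp (- norm (y - z) / R)) * f y) * indicator {q. dist (fst q) (snd q) < R} (w, y) \<partial>lborel) =
        (\<integral>\<^sup>+w. (ennreal (exp (- norm (y - z) / R)) * f y) * indicator (ball y R) w \<partial>lborel)"
        by (intro nn_integral_cong) (auto simp: indicator_def dist_commute)
      also have "\<dots> = (ennreal (exp (- norm (y - z) / R)) * f y) * ennreal (v * R ^ DIM('a))"
        using R by (subst nn_integral_cmult_indicator) (auto simp: emeasure_ball v_def)
      finally show "ennreal (v * R ^ DIM('a)) * (ennreal (exp (- norm (y - z) / R)) * f y) =
         (\<integral>\<^sup>+w. (ennreal (exp (- norm (y - z) / R)) * f y) * indicator {q. dist (fst q) (snd q) < R} (w, y) \<partial>lborel)"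
        by (simp add: mult_ac)
    qed
    also have "\<dots> = (\<integral>\<^sup>+w. (\<integral>\<^sup>+y. (ennreal (exp (- norm (y - z) / R)) * f y) * indicator {q. dist (fst q) (snd q) < R} (w, y) \<partial>\<mu>) \<partial>lborel)"
      by (rule P.Fubini') measurable
    also have "\<dots> \<le> (\<integral>\<^sup>+w. ennreal (exp 1 * exp (- norm (w - z) / R)) * M \<partial>lborel)"
    proof (intro nn_integral_mono)
      fix w :: 'a
      have "(\<integral>\<^sup>+y. (ennreal (exp (- norm (y - z) / R)) * f y) * indicator {q. dist (fst q) (snd q) < R} (w, y) \<partial>\<mu>) \<le>
        (\<integral>\<^sup>+y. ennreal (exp 1 * exp (- norm (w - z) / R)) * (f y * indicator (ball w R) y) \<partial>\<mu>)"
      proof (intro nn_integral_mono)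
        fix y :: 'a
        have "exp (- norm (y - z) / R) \<le> exp 1 * exp (- norm (w - z) / R)" if "dist w y < R"
        proof -
          have "norm (w - z) \<le> norm (w - y) + norm (y - z)" using norm_triangle_ineq[of "w - y" "y - z"] by simp
          then have "norm (w - z) \<le> R + norm (y - z)" using that by (simp add: dist_norm)
          then have "- norm (y - z) / R \<le> 1 + - norm (w - z) / R" using R by (simp add: field_simps)
          then show ?thesis unfolding exp_add[symmetric] by simp
        qed
        then show "(ennreal (exp (- norm (y - z) / R)) * f y) * indicator {q. dist (fst q) (snd q) < R} (w, y) \<le>
          ennreal (exp 1 * exp (- norm (w - z) / R)) * (f y * indicator (ball w R) y)"
          by (auto simp: indicator_def intro!: mult_right_mono ennreal_leI)
      qed
      also have "\<dots> = ennreal (exp 1 * exp (- norm (w - z) / R)) * (\<integral>\<^sup>+y\<in>ball w R. f y \<partial>\<mu>)"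
        by (rule nn_integral_cmult) (auto intro!: borel_measurable_times_ennreal borel_measurable_indicator simp: s)
      also have "\<dots> \<le> ennreal (exp 1 * exp (- norm (w - z) / R)) * M" by (intro mult_left_mono M) auto
      finally show "(\<integral>\<^sup>+y. (ennreal (exp (- norm (y - z) / R)) * f y) * indicator {q. dist (fst q) (snd q) < R} (w, y) \<partial>\<mu>) \<le>
        ennreal (exp 1 * exp (- norm (w - z) / R)) * M" .
    qed
    also have "\<dots> = ennreal (exp 1) * (\<integral>\<^sup>+w. ennreal (exp (- norm (w - z) / R)) \<partial>lborel) * M"
      by (simp add: nn_integral_multc nn_integral_cmult ennreal_mult)
    also have "(\<integral>\<^sup>+w. ennreal (exp (- norm (w - z) / R)) \<partial>lborel) = ennreal (R ^ DIM('a)) * E"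
      unfolding E_def using R by (subst nn_integral_lborel_scale[of _ R z]) auto
    finally have 1: "ennreal (R ^ DIM('a)) * (ennreal v * I) \<le> ennreal (R ^ DIM('a)) * (ennreal (exp 1) * E * M)"
      using v R by (simp add: ennreal_mult mult_ac)
    have 2: "ennreal v * I \<le> ennreal (exp 1) * E * M"
      using 1 R by (subst (asm) ennreal_mult_le_mult_iff) auto
    have "I = ennreal (1 / v) * (ennreal v * I)"
      using v by (simp flip: mult.assoc ennreal_mult)
    also have "\<dots> \<le> ennreal (1 / v) * (ennreal (exp 1) * E * M)" by (intro mult_left_mono 2) auto
    also have "\<dots> = ennreal (exp 1 * enn2real E / v) * M"
    proof -
      have "E = ennreal (enn2real E)" using E by simp
      moreover have "ennreal (1 / v) * (ennreal (exp 1) * ennreal (enn2real E)) = ennreal (1 / v * (exp 1 * enn2real E))"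
        using v by (simp flip: ennreal_mult)
      ultimately have "ennreal (1 / v) * (ennreal (exp 1) * E) = ennreal (exp 1 * enn2real E / v)" by simp
      then show ?thesis by (simp only: mult.assoc[symmetric])
    qed
    also have "\<dots> \<le> ennreal C * M" unfolding C_def by (intro mult_right_mono ennreal_leI) auto
    finally show ?thesis unfolding I_def .
  qed
  moreover have "0 < C" unfolding C_def using v by (intro add_nonneg_pos) auto
  ultimately show ?thesis by blast
qed

lemma heat_kernel_nonneg: "0 \<le> heat_kernel \<tau> x" by (simp add: heat_kernel_def)

text \<open>Half of the Gaussian exponent provides the L^p norm, of order \<tau>^(-a). The other
  half is traded for decay in |y-z| by |x-y|/R <= |x-y|^2/(8\<tau>) + 2\<tau>/R^2, together with
  |x-z| < R.\<close>

lemma heat_kernel_power_local: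
  assumes p: "1 < p"
  defines "a \<equiv> real CARD('n) * (p - 1) / (2 * p)"
  shows "\<exists>C>0. \<forall>\<tau>>0. \<forall>R>0. \<forall>y z :: real ^ 'n.
    (\<integral>\<^sup>+x. ennreal ((heat_kernel \<tau> (x - y) * indicator (ball z R) x) powr p) \<partial>lborel) \<le>
      ennreal ((C * \<tau> powr - a * exp (2 * \<tau> / R\<^sup>2) * exp (- norm (y - z) / R)) powr p)"
proof -
  define N where "N = real CARD('n)"
  define E where "E = (\<integral>\<^sup>+x. ennreal (exp (- norm (x::real^'n))) \<partial>lborel)"
  have E: "E < \<infinity>" unfolding E_def by (rule nn_integral_exp_neg_norm_finite)
  define H where "H = exp (2 / p) * enn2real E + 1"
  have H: "0 < H" unfolding H_def by (intro add_nonneg_pos) auto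
  define C where "C = exp 1 * (4 * pi) powr (- N / 2) * H powr (1 / p)"
  have C: "0 < C" unfolding C_def using H by auto
  have gauss: "(\<integral>\<^sup>+x. ennreal (exp (- (p * (norm (x::real^'n))\<^sup>2 / 8))) \<partial>lborel) \<le> ennreal H"
  proof -
    have "(\<integral>\<^sup>+x. ennreal (exp (- (p * (norm (x::real^'n))\<^sup>2 / 8))) \<partial>lborel) \<le>
      (\<integral>\<^sup>+x. ennreal (exp (2 / p)) * ennreal (exp (- norm (x::real^'n))) \<partial>lborel)"
    proof (intro nn_integral_mono)
      fix x :: "real^'n"
      \<comment> \<open>Completing the square compares the Gaussian with e^(-|x|), already known to
        be integrable.\<close>
      have "0 \<le> (p * norm x - 4)\<^sup>2 / (8 * p)" using p by simp
      also have "\<dots> = p * (norm x)\<^sup>2 / 8 - norm x + 2 / p"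
        using p by (simp add: power2_eq_square field_simps)
      finally have "- (p * (norm x)\<^sup>2 / 8) \<le> 2 / p + - norm x" by simp
      then show "ennreal (exp (- (p * (norm x)\<^sup>2 / 8))) \<le> ennreal (exp (2 / p)) * ennreal (exp (- norm x))"
        by (simp flip: ennreal_mult exp_add)
    qed
    also have "\<dots> = ennreal (exp (2 / p)) * E" unfolding E_def by (rule nn_integral_cmult) measurable
    also have "\<dots> = ennreal (exp (2 / p) * enn2real E)" using E by (simp add: ennreal_mult)
    also have "\<dots> \<le> ennreal H" unfolding H_def by (intro ennreal_leI) simp
    finally show ?thesis .
  qed
  have "(\<integral>\<^sup>+x. ennreal ((heat_kernel \<tau> (x - y) * indicator (ball z R) x) powr p) \<partial>lborel) \<le>
      ennreal ((C * \<tau> powr - a * exp (2 * \<tau> / R\<^sup>2) * exp (- norm (y - z) / R)) powr p)"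
    if \<tau>: "0 < \<tau>" and R: "0 < R" for \<tau> R and y z :: "real ^ 'n"
  proof -
    have ep: "exp u powr p = exp (p * u)" for u by (simp add: powr_def)
    \<comment> \<open>\<open>A\<close> collects the factors independent of x; e^p is the price of
      |x-z| < R.\<close>
    define A where "A = exp p * exp (- p * norm (y - z) / R) * (4 * pi * \<tau>) powr (- N / 2 * p) * exp (2 * p * \<tau> / R\<^sup>2)"
    have A: "0 \<le> A" unfolding A_def by simp
    have "(\<integral>\<^sup>+x. ennreal ((heat_kernel \<tau> (x - y) * indicator (ball z R) x) powr p) \<partial>lborel) \<le>
      (\<integral>\<^sup>+x. ennreal A * ennreal (exp (- (p * (norm (x - y))\<^sup>2 / (8 * \<tau>)))) \<partial>lborel)"
    proof (intro nn_integral_mono)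
      fix x :: "real ^ 'n"
      have "heat_kernel \<tau> (x - y) powr p \<le> A * exp (- (p * (norm (x - y))\<^sup>2 / (8 * \<tau>)))" if x: "dist z x < R"
      proof -
        define w where "w = norm (x - y)"
        have hk: "heat_kernel \<tau> (x - y) powr p = (4 * pi * \<tau>) powr (- N / 2 * p) * exp (- (p * w\<^sup>2 / (4 * \<tau>)))"
          unfolding heat_kernel_def w_def N_def powr_mult powr_powr ep by simp
        have "norm (y - z) \<le> norm (x - y) + norm (x - z)"
          using norm_triangle_ineq4[of "x - z" "x - y"] by (simp add: algebra_simps)
        then have "norm (y - z) \<le> w + R" using x by (simp add: w_def dist_norm norm_minus_commute)
        then have 1: "0 \<le> p + - p * norm (y - z) / R + p * w / R"
        proof -
          have "p * norm (y - z) / R \<le> p * (w + R) / R"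
            using \<open>norm (y - z) \<le> w + R\<close> R p by (intro divide_right_mono mult_left_mono) auto
          then show ?thesis using R by (simp add: add_divide_distrib distrib_left)
        qed
        have "0 \<le> (w / (2 * sqrt (2 * \<tau>)) - sqrt (2 * \<tau>) / R)\<^sup>2" by simp
        also have "\<dots> = w\<^sup>2 / (8 * \<tau>) - w / R + 2 * \<tau> / R\<^sup>2"
          using \<tau> R by (simp add: power2_diff power_divide power_mult_distrib)
        finally have "w / R \<le> w\<^sup>2 / (8 * \<tau>) + 2 * \<tau> / R\<^sup>2" by simp
        then have "p * (w / R) \<le> p * (w\<^sup>2 / (8 * \<tau>) + 2 * \<tau> / R\<^sup>2)" using p by (intro mult_left_mono) auto
        moreover have "p * w\<^sup>2 / (4 * \<tau>) = p * w\<^sup>2 / (8 * \<tau>) + p * w\<^sup>2 / (8 * \<tau>)" by simp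
        ultimately have "- (p * w\<^sup>2 / (4 * \<tau>)) \<le> (p + - p * norm (y - z) / R + 2 * p * \<tau> / R\<^sup>2) + - (p * w\<^sup>2 / (8 * \<tau>))"
          using 1 by (simp add: algebra_simps)
        then have "exp (- (p * w\<^sup>2 / (4 * \<tau>))) \<le> exp p * exp (- p * norm (y - z) / R) * exp (2 * p * \<tau> / R\<^sup>2) * exp (- (p * w\<^sup>2 / (8 * \<tau>)))"
          unfolding exp_add[symmetric] by simp
        then have "(4 * pi * \<tau>) powr (- N / 2 * p) * exp (- (p * w\<^sup>2 / (4 * \<tau>))) \<le>
          (4 * pi * \<tau>) powr (- N / 2 * p) * (exp p * exp (- p * norm (y - z) / R) * exp (2 * p * \<tau> / R\<^sup>2) * exp (- (p * w\<^sup>2 / (8 * \<tau>))))"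
          by (intro mult_left_mono) auto
        then show ?thesis unfolding hk A_def w_def by (simp add: mult_ac)
      qed
      then show "ennreal ((heat_kernel \<tau> (x - y) * indicator (ball z R) x) powr p) \<le>
        ennreal A * ennreal (exp (- (p * (norm (x - y))\<^sup>2 / (8 * \<tau>))))"
        using A p by (auto simp: indicator_def simp flip: ennreal_mult intro!: ennreal_leI)
    qed
    also have "\<dots> = ennreal A * (\<integral>\<^sup>+x. ennreal (exp (- (p * (norm (x - y))\<^sup>2 / (8 * \<tau>)))) \<partial>lborel)"
      by (rule nn_integral_cmult) measurable
    also have "(\<integral>\<^sup>+x. ennreal (exp (- (p * (norm (x - y))\<^sup>2 / (8 * \<tau>)))) \<partial>lborel) =
      ennreal (sqrt \<tau> ^ CARD('n)) * (\<integral>\<^sup>+x. ennreal (exp (- (p * (norm (x::real^'n))\<^sup>2 / 8))) \<partial>lborel)"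
      using \<tau> by (subst nn_integral_lborel_scale[of _ "sqrt \<tau>" y]) (auto simp: power_mult_distrib)
    also have "ennreal A * (ennreal (sqrt \<tau> ^ CARD('n)) * (\<integral>\<^sup>+x. ennreal (exp (- (p * (norm (x::real^'n))\<^sup>2 / 8))) \<partial>lborel)) \<le>
       ennreal A * (ennreal (sqrt \<tau> ^ CARD('n)) * ennreal H)"
      by (intro mult_left_mono gauss) auto
    also have "\<dots> = ennreal (A * (sqrt \<tau> ^ CARD('n) * H))" using A H \<tau> by (simp add: ennreal_mult)
    also have "A * (sqrt \<tau> ^ CARD('n) * H) = (C * \<tau> powr - a * exp (2 * \<tau> / R\<^sup>2) * exp (- norm (y - z) / R)) powr p"
    proof -
      have t: "sqrt \<tau> ^ CARD('n) = \<tau> powr (N / 2)"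
        using \<tau> by (simp add: powr_half_sqrt[symmetric] N_def powr_powr flip: powr_realpow)
      have "(C * \<tau> powr - a * exp (2 * \<tau> / R\<^sup>2) * exp (- norm (y - z) / R)) powr p =
         C powr p * \<tau> powr (- a * p) * exp (p * (2 * \<tau> / R\<^sup>2)) * exp (p * (- norm (y - z) / R))"
        by (simp add: powr_mult ep powr_powr)
      also have "C powr p = exp p * (4 * pi) powr (- N / 2 * p) * H"
        unfolding C_def using H p by (simp add: powr_mult ep powr_powr)
      also have "\<tau> powr (- a * p) = \<tau> powr (- N / 2 * p) * \<tau> powr (N / 2)"
      proof -
        have "- a * p = - N / 2 * p + N / 2" unfolding a_def N_def using p by (simp add: field_simps)
        then show ?thesis by (simp only: powr_add)
      qed
      finally show ?thesis unfolding A_def t using \<tau>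
        by (simp add: powr_mult mult_ac)
    qed
    finally show ?thesis .
  qed
  with C show ?thesis by blast
qed

section \<open>Picard iteration\<close>

lemma measurable_heat_kernel [measurable]:
  "(\<lambda>(\<tau>, x :: real ^ 'n). heat_kernel \<tau> x) \<in> borel_measurable (borel \<Otimes>\<^sub>M borel)"
  unfolding heat_kernel_def[abs_def] split_beta by measurable

lemma measurable_heat_kernel_comp:
  assumes [measurable]: "f \<in> borel_measurable M" "g \<in> borel_measurable M"
  shows "(\<lambda>i. heat_kernel (f i) (g i :: real ^ 'n)) \<in> borel_measurable M"
proof -
  have "(\<lambda>i. (f i, g i)) \<in> M \<rightarrow>\<^sub>M borel \<Otimes>\<^sub>M borel" by measurable
  from measurable_compose[OF this measurable_heat_kernel] show ?thesis by simp
qed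

lemma nn_integral_triple:
  assumes M2: "sigma_finite_measure M2" and M3: "sigma_finite_measure M3"
    and f: "f \<in> borel_measurable (M1 \<Otimes>\<^sub>M (M2 \<Otimes>\<^sub>M M3))"
  shows "(\<integral>\<^sup>+i. f i \<partial>(M1 \<Otimes>\<^sub>M (M2 \<Otimes>\<^sub>M M3))) = (\<integral>\<^sup>+s. (\<integral>\<^sup>+\<theta>. (\<integral>\<^sup>+y. f (s, \<theta>, y) \<partial>M3) \<partial>M2) \<partial>M1)"
proof -
  interpret pair_sigma_finite M2 M3 using M2 M3 by (simp add: pair_sigma_finite_def)
  have sf: "sigma_finite_measure (M2 \<Otimes>\<^sub>M M3)" by unfold_locales
  have "(\<integral>\<^sup>+i. f i \<partial>(M1 \<Otimes>\<^sub>M (M2 \<Otimes>\<^sub>M M3))) = (\<integral>\<^sup>+s. (\<integral>\<^sup>+j. f (s, j) \<partial>(M2 \<Otimes>\<^sub>M M3)) \<partial>M1)"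
    using sigma_finite_measure.nn_integral_fst[OF sf f] by simp
  also have "\<dots> = (\<integral>\<^sup>+s. (\<integral>\<^sup>+\<theta>. (\<integral>\<^sup>+y. f (s, \<theta>, y) \<partial>M3) \<partial>M2) \<partial>M1)"
    by (intro nn_integral_cong sigma_finite_measure.nn_integral_fst[OF M3, symmetric] measurable_compose[OF measurable_Pair1' f])
  finally show ?thesis .
qed

section \<open>Local estimate for subordinated integrals\<close>

text \<open>The constants of \<open>exp_weight_le_local_mass\<close>,
  \<open>heat_kernel_power_local\<close> and \<open>subordination_density_bound\<close> are
  parameters, so that later bounds display how they depend on \<alpha> and T. The 3 in
  \<open>h_bound\<close> is 2 from the factor e^(2\<tau>/R^2), where \<tau>/R^2 <= \<theta> for R =
  T^(\<alpha>/2), plus 1 for the factor \<theta> in S_\<alpha>.\<close>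

locale fractional_heat =
  fixes \<alpha> p a T D C0 C1 :: real and \<mu> :: "(real ^ 'n) measure"
  assumes p: "1 < p" and a: "a = real CARD('n) * (p - 1) / (2 * p)" and \<alpha>: "0 < \<alpha>" "\<alpha> < 1"
    and T: "0 < T" and D: "0 < D" and C: "0 < C0" "0 < C1"
    and C0: "\<And>(\<kappa> :: (real ^ 'n) measure) f R z M.
     sigma_finite_measure \<kappa> \<Longrightarrow> sets \<kappa> = sets borel \<Longrightarrow> f \<in> borel_measurable borel \<Longrightarrow> 0 < R \<Longrightarrow>
     (\<forall>w. (\<integral>\<^sup>+y\<in>ball w R. f y \<partial>\<kappa>) \<le> M) \<Longrightarrow>
     (\<integral>\<^sup>+y. ennreal (exp (- norm (y - z) / R)) * f y \<partial>\<kappa>) \<le> ennreal C0 * M"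
    and C1: "\<And>\<tau> R (y :: real ^ 'n) z. 0 < \<tau> \<Longrightarrow> 0 < R \<Longrightarrow>
    (\<integral>\<^sup>+x. ennreal ((heat_kernel \<tau> (x - y) * indicator (ball z R) x) powr p) \<partial>lborel) \<le>
      ennreal ((C1 * \<tau> powr - a * exp (2 * \<tau> / R\<^sup>2) * exp (- norm (y - z) / R)) powr p)"
    and h_bound: "(\<integral>\<^sup>+\<theta>\<in>{0<..}. ennreal (subordination_density \<alpha> \<theta>) * ennreal (\<theta> powr - a * exp (3 * \<theta>)) \<partial>lborel) \<le> ennreal D"
    and \<mu>: "sigma_finite_measure \<mu>" and sets_\<mu> [measurable_cong]: "sets \<mu> = sets borel"
begin

lemma h_meas [measurable]: "subordination_density \<alpha> \<in> borel_measurable borel"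
  using \<alpha> by (rule subordination_density_measurable)

text \<open>One estimate for both operators: \<sigma> is a one-point space for P_\<alpha> and
  Lebesgue measure in s for the Duhamel term; q is h_\<alpha> or \<theta> h_\<alpha>. Minkowski's
  inequality over (s, \<theta>, y) reduces everything to the norms of single heat kernels. Then the
  y-integral of e^(-|y-z|/R) gives C0 times the local mass, the \<theta>-integral gives D and the
  s-integral gives c.\<close>

lemma subordinated_local_bound:
  fixes \<sigma> :: "'s measure" and \<kappa> :: "(real ^ 'n) measure" and g :: "'s \<Rightarrow> real ^ 'n \<Rightarrow> ennreal"
  assumes \<sigma>: "sigma_finite_measure \<sigma>" and \<kappa>: "sigma_finite_measure \<kappa>" and sk [measurable_cong]: "sets \<kappa> = sets borel"
    and r [measurable]: "r \<in> borel_measurable \<sigma>" and g [measurable]: "(\<lambda>(s, y). g s y) \<in> borel_measurable (\<sigma> \<Otimes>\<^sub>M borel)"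
    and rg: "\<And>s y. g s y \<noteq> 0 \<Longrightarrow> 0 < r s \<and> r s \<le> T"
    and q [measurable]: "q \<in> borel_measurable borel"
    and qD: "(\<integral>\<^sup>+\<theta>\<in>{0<..}. ennreal (q \<theta>) * ennreal (\<theta> powr - a * exp (2 * \<theta>)) \<partial>lborel) \<le> ennreal D"
    and mass [measurable]: "mass \<in> borel_measurable \<sigma>"
    and gm: "\<And>s w. s \<in> space \<sigma> \<Longrightarrow> (\<integral>\<^sup>+y\<in>ball w (T powr (\<alpha> / 2)). g s y \<partial>\<kappa>) \<le> mass s"
    and tot: "(\<integral>\<^sup>+s. ennreal (r s powr (- (\<alpha> * a))) * mass s \<partial>\<sigma>) \<le> ennreal c" and c: "0 < c"
  shows "(\<integral>\<^sup>+x\<in>ball z (T powr (\<alpha> / 2)). ennreal_pow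
     (\<integral>\<^sup>+(s, \<theta>, y). ennreal (heat_kernel (r s powr \<alpha> * \<theta>) (x - y)) * (ennreal (q \<theta>) * indicator {0<..} \<theta> * g s y)
       \<partial>(\<sigma> \<Otimes>\<^sub>M (lborel \<Otimes>\<^sub>M \<kappa>))) p \<partial>lborel) \<le> ennreal ((C0 * C1 * D * c) powr p)"
proof -
  define R where "R = T powr (\<alpha> / 2)"
  have R: "0 < R" using T by (simp add: R_def)
  have R2: "R\<^sup>2 = T powr \<alpha>" using T by (simp add: R_def powr_powr flip: powr_realpow)
  interpret s: sigma_finite_measure \<sigma> by (rule \<sigma>)
  interpret k: sigma_finite_measure \<kappa> by (rule \<kappa>)
  interpret lk: pair_sigma_finite "lborel :: real measure" \<kappa> by unfold_locales
  interpret slk: pair_sigma_finite \<sigma> "(lborel :: real measure) \<Otimes>\<^sub>M \<kappa>" by unfold_locales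
  define \<nu> where "\<nu> = \<sigma> \<Otimes>\<^sub>M ((lborel :: real measure) \<Otimes>\<^sub>M \<kappa>)"
  define \<tau> where "\<tau> = (\<lambda>i::'s \<times> real \<times> (real ^ 'n). r (fst i) powr \<alpha> * fst (snd i))"
  define F where "F = (\<lambda>i x. heat_kernel (\<tau> i) (x - snd (snd i)) * indicator (ball z R) x)"
  define w where "w = (\<lambda>i::'s \<times> real \<times> (real ^ 'n). ennreal (q (fst (snd i))) * indicator {0<..} (fst (snd i)) * g (fst i) (snd (snd i)))"
  \<comment> \<open>The local L^p bound supplied by \<open>C1\<close> for the heat kernel with index
    i.\<close>
  define m where "m = (\<lambda>i. C1 * \<tau> i powr - a * exp (2 * \<tau> i / R\<^sup>2) * exp (- norm (snd (snd i) - z) / R))"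
  have m\<tau> [measurable]: "\<tau> \<in> borel_measurable \<nu>" unfolding \<tau>_def \<nu>_def by measurable
  have g' [measurable]: "(\<lambda>i. g (fst i) (snd (snd i))) \<in> borel_measurable \<nu>"
  proof -
    have "(\<lambda>i. (fst i, snd (snd i))) \<in> \<nu> \<rightarrow>\<^sub>M \<sigma> \<Otimes>\<^sub>M borel" unfolding \<nu>_def by measurable
    from measurable_compose[OF this g] show ?thesis by simp
  qed
  have snd' [measurable]: "(\<lambda>i. snd (snd i)) \<in> borel_measurable \<nu>" "(\<lambda>i. fst (snd i)) \<in> borel_measurable \<nu>" unfolding \<nu>_def by measurable
  have m [measurable]: "m \<in> borel_measurable \<nu>" unfolding m_def by measurable
  have w [measurable]: "w \<in> borel_measurable \<nu>" unfolding w_def by measurable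
  have pos: "0 < fst (snd i) \<and> 0 < r (fst i) \<and> r (fst i) \<le> T" if "w i \<noteq> 0" for i
    using that rg[of "fst i" "snd (snd i)"] unfolding w_def by (auto simp: indicator_def split: if_splits)
  have \<tau>0: "0 < \<tau> i" if "w i \<noteq> 0" for i using pos[OF that] by (simp add: \<tau>_def)
  have ind: "(indicator (ball z R) :: real ^ 'n \<Rightarrow> real) \<in> borel_measurable borel"
    by (intro borel_measurable_indicator) simp
  have F [measurable]: "(\<lambda>(i, x). F i x) \<in> borel_measurable (\<nu> \<Otimes>\<^sub>M lborel)"
    unfolding F_def split_beta
    by (intro borel_measurable_times measurable_heat_kernel_comp measurable_compose[OF _ ind]
      borel_measurable_diff measurable_compose[OF measurable_fst m\<tau>]
      measurable_compose[OF measurable_fst snd'(1)]) auto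
  have tot': "(\<integral>\<^sup>+i. ennreal (m i) * w i \<partial>\<nu>) \<le> ennreal (C0 * C1 * D * c)"
  proof -
    have "(\<integral>\<^sup>+i. ennreal (m i) * w i \<partial>\<nu>) = (\<integral>\<^sup>+s. (\<integral>\<^sup>+\<theta>. (\<integral>\<^sup>+y. ennreal (m (s, \<theta>, y)) * w (s, \<theta>, y) \<partial>\<kappa>) \<partial>lborel) \<partial>\<sigma>)"
    proof -
      have mw: "(\<lambda>i. ennreal (m i) * w i) \<in> borel_measurable \<nu>" by measurable
      show ?thesis unfolding \<nu>_def
        by (rule nn_integral_triple[OF lborel.sigma_finite_measure_axioms \<kappa> mw[unfolded \<nu>_def]])
    qed
    also have "\<dots> \<le> (\<integral>\<^sup>+s. (\<integral>\<^sup>+\<theta>. (ennreal (C1 * C0) * (ennreal (r s powr (- (\<alpha> * a))) * mass s)) *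
       (ennreal (q \<theta>) * ennreal (\<theta> powr - a * exp (2 * \<theta>)) * indicator {0<..} \<theta>) \<partial>lborel) \<partial>\<sigma>)"
    proof (intro nn_integral_mono)
      fix s \<theta> assume s: "s \<in> space \<sigma>"
      show "(\<integral>\<^sup>+y. ennreal (m (s, \<theta>, y)) * w (s, \<theta>, y) \<partial>\<kappa>) \<le>
        (ennreal (C1 * C0) * (ennreal (r s powr (- (\<alpha> * a))) * mass s)) *
        (ennreal (q \<theta>) * ennreal (\<theta> powr - a * exp (2 * \<theta>)) * indicator {0<..} \<theta>)"
      proof (cases "0 < \<theta> \<and> 0 < r s \<and> r s \<le> T")
        case False
        then have "w (s, \<theta>, y) = 0" for y using pos[of "(s, \<theta>, y)"] by auto
        then show ?thesis by simp
      next
        case True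
        have gs [measurable]: "g s \<in> borel_measurable borel"
          using measurable_compose[OF measurable_Pair1'[OF s] g] by simp
        define B where "B = C1 * (r s powr (- (\<alpha> * a)) * (\<theta> powr - a * exp (2 * \<theta>)))"
        have B: "0 \<le> B" using C by (simp add: B_def)
        \<comment> \<open>The power \<tau>^(-a) splits into a time factor and \<theta>^(-a), and
          \<open>r s \<le> T\<close> yields 2\<tau>/R^2 <= 2\<theta>.\<close>
        have mle: "m (s, \<theta>, y) \<le> B * exp (- norm (y - z) / R)" for y
        proof -
          have "r s powr \<alpha> \<le> T powr \<alpha>" using True \<alpha> by (intro powr_mono2) auto
          then have "r s powr \<alpha> * \<theta> \<le> T powr \<alpha> * \<theta>" using True by (intro mult_right_mono) auto
          then have "2 * \<tau> (s, \<theta>, y) / R\<^sup>2 \<le> 2 * \<theta>"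
            using T unfolding \<tau>_def R2 by (simp add: divide_le_eq mult_ac)
          then have "C1 * \<tau> (s, \<theta>, y) powr - a * exp (2 * \<tau> (s, \<theta>, y) / R\<^sup>2) * exp (- norm (y - z) / R) \<le>
            C1 * \<tau> (s, \<theta>, y) powr - a * exp (2 * \<theta>) * exp (- norm (y - z) / R)"
            using C by (intro mult_right_mono mult_left_mono) auto
          moreover have "\<tau> (s, \<theta>, y) powr - a = r s powr (- (\<alpha> * a)) * \<theta> powr - a"
            unfolding \<tau>_def by (simp add: powr_mult powr_powr)
          ultimately show ?thesis unfolding m_def B_def by (simp add: mult_ac)
        qed
        have "(\<integral>\<^sup>+y. ennreal (m (s, \<theta>, y)) * w (s, \<theta>, y) \<partial>\<kappa>) \<le>
          (\<integral>\<^sup>+y. (ennreal B * ennreal (q \<theta>)) * (ennreal (exp (- norm (y - z) / R)) * g s y) \<partial>\<kappa>)"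
        proof (intro nn_integral_mono)
          fix y
          have "ennreal (m (s, \<theta>, y)) * w (s, \<theta>, y) \<le> ennreal (B * exp (- norm (y - z) / R)) * w (s, \<theta>, y)"
            by (intro mult_right_mono ennreal_leI mle) auto
          then show "ennreal (m (s, \<theta>, y)) * w (s, \<theta>, y) \<le> (ennreal B * ennreal (q \<theta>)) * (ennreal (exp (- norm (y - z) / R)) * g s y)"
            using True B by (simp add: w_def ennreal_mult mult_ac)
        qed
        also have "\<dots> = (ennreal B * ennreal (q \<theta>)) * (\<integral>\<^sup>+y. ennreal (exp (- norm (y - z) / R)) * g s y \<partial>\<kappa>)"
          by (intro nn_integral_cmult) measurable
        also have "\<dots> \<le> (ennreal B * ennreal (q \<theta>)) * (ennreal C0 * mass s)"
          using gm[OF s] R by (intro mult_left_mono C0 \<kappa> sk) (auto simp: R_def)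
        also have "\<dots> = (ennreal (C1 * C0) * (ennreal (r s powr (- (\<alpha> * a))) * mass s)) *
          (ennreal (q \<theta>) * ennreal (\<theta> powr - a * exp (2 * \<theta>)) * indicator {0<..} \<theta>)"
          unfolding B_def using C True by (simp add: ennreal_mult mult_ac)
        finally show ?thesis .
      qed
    qed
    also have "\<dots> = (\<integral>\<^sup>+s. (ennreal (C1 * C0) * (ennreal (r s powr (- (\<alpha> * a))) * mass s)) *
        (\<integral>\<^sup>+\<theta>\<in>{0<..}. ennreal (q \<theta>) * ennreal (\<theta> powr - a * exp (2 * \<theta>)) \<partial>lborel) \<partial>\<sigma>)"
      by (intro nn_integral_cong nn_integral_cmult) measurable
    also have "\<dots> \<le> (\<integral>\<^sup>+s. (ennreal (C1 * C0) * (ennreal (r s powr (- (\<alpha> * a))) * mass s)) * ennreal D \<partial>\<sigma>)"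
      by (intro nn_integral_mono mult_left_mono qD) auto
    also have "\<dots> = ennreal (C1 * C0) * (\<integral>\<^sup>+s. ennreal (r s powr (- (\<alpha> * a))) * mass s \<partial>\<sigma>) * ennreal D"
      by (simp add: nn_integral_cmult nn_integral_multc)
    also have "\<dots> \<le> ennreal (C1 * C0) * ennreal c * ennreal D"
      by (intro mult_right_mono mult_left_mono tot) auto
    also have "\<dots> = ennreal (C0 * C1 * D * c)" using C D c by (simp add: mult_ac flip: ennreal_mult)
    finally show ?thesis .
  qed
  have "(\<integral>\<^sup>+x. ennreal_pow (\<integral>\<^sup>+i. ennreal (F i x) * w i \<partial>\<nu>) p \<partial>lborel) \<le> ennreal ((C0 * C1 * D * c) powr p)"
  proof (rule nn_integral_Minkowski[OF p _ _ F m w])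
    show "sigma_finite_measure \<nu>" unfolding \<nu>_def by unfold_locales
    show "0 \<le> F i x" for i x unfolding F_def by (simp add: heat_kernel_nonneg)
    show "0 < m i" if "w i \<noteq> 0" for i using \<tau>0[OF that] C unfolding m_def by simp
    show "(\<integral>\<^sup>+x. ennreal (F i x powr p) \<partial>lborel) \<le> ennreal (m i powr p)" if "w i \<noteq> 0" for i
      unfolding F_def m_def using \<tau>0[OF that] R by (rule C1)
  qed (use tot' C D c lborel.sigma_finite_measure_axioms in auto)
  also have "(\<integral>\<^sup>+x. ennreal_pow (\<integral>\<^sup>+i. ennreal (F i x) * w i \<partial>\<nu>) p \<partial>lborel) =
    (\<integral>\<^sup>+x\<in>ball z R. ennreal_pow
     (\<integral>\<^sup>+(s, \<theta>, y). ennreal (heat_kernel (r s powr \<alpha> * \<theta>) (x - y)) * (ennreal (q \<theta>) * indicator {0<..} \<theta> * g s y) \<partial>\<nu>) p \<partial>lborel)"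
  proof (intro nn_integral_cong)
    fix x :: "real ^ 'n"
    have z: "ennreal_pow 0 p = 0" using ennreal_pow_ennreal[of 0 p] by simp
    show "ennreal_pow (\<integral>\<^sup>+i. ennreal (F i x) * w i \<partial>\<nu>) p = ennreal_pow
     (\<integral>\<^sup>+(s, \<theta>, y). ennreal (heat_kernel (r s powr \<alpha> * \<theta>) (x - y)) * (ennreal (q \<theta>) * indicator {0<..} \<theta> * g s y) \<partial>\<nu>) p * indicator (ball z R) x"
      by (cases "x \<in> ball z R") (auto simp: F_def w_def \<tau>_def split_beta' z)
  qed
  finally show ?thesis unfolding R_def \<nu>_def .
qed

text \<open>A single integral over (s, \<theta>, y), without the prefactor \<alpha>: in this form
  Minkowski's inequality applies to all three variables at once. \<open>duhamel_eq\<close> recovers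
  the nested form of the integral equation.\<close>

definition duhamel :: "(real \<Rightarrow> real ^ 'n \<Rightarrow> ennreal) \<Rightarrow> real \<Rightarrow> real ^ 'n \<Rightarrow> ennreal" where
  "duhamel v t x = (\<integral>\<^sup>+(s, \<theta>, y). ennreal (heat_kernel ((t - s) powr \<alpha> * \<theta>) (x - y)) *
     (ennreal (\<theta> * subordination_density \<alpha> \<theta>) * indicator {0<..} \<theta> *
       (ennreal ((t - s) powr (\<alpha> - 1)) * indicator {0<..<t} s * ennreal_pow (v s y) p))
     \<partial>(lborel \<Otimes>\<^sub>M (lborel \<Otimes>\<^sub>M lborel)))"

lemma measurable_comp2:
  assumes v: "(\<lambda>(s, y). v s y) \<in> borel_measurable (borel \<Otimes>\<^sub>M borel)"
    and [measurable]: "f \<in> borel_measurable N" "g \<in> borel_measurable N"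
  shows "(\<lambda>i. v (f i) (g i)) \<in> borel_measurable N"
proof -
  have "(\<lambda>i. (f i, g i)) \<in> N \<rightarrow>\<^sub>M borel \<Otimes>\<^sub>M borel" by measurable
  from measurable_compose[OF this v] show ?thesis by simp
qed

lemma measurable_indicator_Ioo:
  assumes [measurable]: "f \<in> borel_measurable N" "g \<in> borel_measurable N"
  shows "(\<lambda>i. indicator {0<..<f i} (g i :: real) :: ennreal) \<in> borel_measurable N"
proof -
  have "(\<lambda>i. indicator {0<..<f i} (g i) :: ennreal) = (\<lambda>i. if 0 < g i \<and> g i < f i then 1 else 0)"
    by (auto simp: fun_eq_iff indicator_def)
  then show ?thesis by simp
qed

lemma measurable_duhamel_integrand:
  assumes v: "(\<lambda>(s, y). v s y) \<in> borel_measurable (borel \<Otimes>\<^sub>M (borel :: (real ^ 'n) measure))"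
    and [measurable]: "f1 \<in> borel_measurable N" "f2 \<in> borel_measurable N" "f3 \<in> borel_measurable N"
      "f4 \<in> borel_measurable N" "f5 \<in> borel_measurable N"
  shows "(\<lambda>i. ennreal (heat_kernel ((f1 i - f2 i) powr \<alpha> * f3 i) (f4 i - f5 i :: real ^ 'n)) *
     (ennreal (f3 i * subordination_density \<alpha> (f3 i)) * indicator {0<..} (f3 i) *
       (ennreal ((f1 i - f2 i) powr (\<alpha> - 1)) * indicator {0<..<f1 i} (f2 i) * ennreal_pow (v (f2 i) (f5 i)) p))) \<in> borel_measurable N"
proof -
  have [measurable]: "(\<lambda>i. v (f2 i) (f5 i)) \<in> borel_measurable N"
    using v by (rule measurable_comp2) measurable
  have [measurable]: "(\<lambda>i. heat_kernel ((f1 i - f2 i) powr \<alpha> * f3 i) (f4 i - f5 i)) \<in> borel_measurable N"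
    by (rule measurable_heat_kernel_comp) measurable
  have [measurable]: "(\<lambda>i. indicator {0<..<f1 i} (f2 i) :: ennreal) \<in> borel_measurable N"
    by (rule measurable_indicator_Ioo) measurable
  show ?thesis by measurable
qed

lemma measurable_duhamel:
  assumes v: "(\<lambda>(s, y). v s y) \<in> borel_measurable (borel \<Otimes>\<^sub>M borel)"
  shows "(\<lambda>(t, x). duhamel v t x) \<in> borel_measurable (borel \<Otimes>\<^sub>M borel)"
proof -
  interpret l: pair_sigma_finite "lborel :: real measure" "lborel :: (real ^ 'n) measure" by unfold_locales
  interpret ll: pair_sigma_finite "lborel :: real measure" "(lborel :: real measure) \<Otimes>\<^sub>M (lborel :: (real ^ 'n) measure)" by unfold_locales
  have sf: "sigma_finite_measure ((lborel :: real measure) \<Otimes>\<^sub>M ((lborel :: real measure) \<Otimes>\<^sub>M (lborel :: (real ^ 'n) measure)))"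
    by unfold_locales
  show ?thesis unfolding duhamel_def split_beta
    by (rule sigma_finite_measure.borel_measurable_nn_integral[OF sf])
       (unfold split_beta, intro measurable_duhamel_integrand v, measurable)
qed

lemma duhamel_eq:
  assumes v: "(\<lambda>(s, y). v s y) \<in> borel_measurable (borel \<Otimes>\<^sub>M borel)"
  shows "(\<integral>\<^sup>+ s\<in>{0<..<t}. ennreal ((t - s) powr (\<alpha> - 1)) *
      S_op \<alpha> (t - s) (density lborel (\<lambda>y. ennreal_pow (v s y) p)) x \<partial>lborel) = duhamel v t x"
proof -
  have vs [measurable]: "v s \<in> borel_measurable borel" for s
    using measurable_compose[OF measurable_Pair1' v, of s] by simp
  have hk [measurable]: "(\<lambda>y. heat_kernel c (x - y)) \<in> borel_measurable borel" for c
    by (rule measurable_heat_kernel_comp) measurable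
  have "duhamel v t x = (\<integral>\<^sup>+s. (\<integral>\<^sup>+\<theta>. (\<integral>\<^sup>+y. ennreal (heat_kernel ((t - s) powr \<alpha> * \<theta>) (x - y)) *
     (ennreal (\<theta> * subordination_density \<alpha> \<theta>) * indicator {0<..} \<theta> *
       (ennreal ((t - s) powr (\<alpha> - 1)) * indicator {0<..<t} s * ennreal_pow (v s y) p))
     \<partial>lborel) \<partial>lborel) \<partial>lborel)"
    unfolding duhamel_def
    by (subst nn_integral_triple[OF lborel.sigma_finite_measure_axioms lborel.sigma_finite_measure_axioms])
       (unfold split_beta, intro measurable_duhamel_integrand v, auto)
  also have "\<dots> = (\<integral>\<^sup>+ s\<in>{0<..<t}. ennreal ((t - s) powr (\<alpha> - 1)) *
      S_op \<alpha> (t - s) (density lborel (\<lambda>y. ennreal_pow (v s y) p)) x \<partial>lborel)"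
  proof (intro nn_integral_cong)
    fix s :: real
    let ?W = "ennreal ((t - s) powr (\<alpha> - 1)) * indicator {0<..<t} s"
    have "heat_op c (density lborel (\<lambda>y. ennreal_pow (v s y) p)) x = (\<integral>\<^sup>+y. ennreal (heat_kernel c (x - y)) * ennreal_pow (v s y) p \<partial>lborel)" for c
      unfolding heat_op_def by (subst nn_integral_density) (auto simp: mult_ac)
    then have S: "S_op \<alpha> (t - s) (density lborel (\<lambda>y. ennreal_pow (v s y) p)) x = (\<integral>\<^sup>+\<theta>. ennreal (\<theta> * subordination_density \<alpha> \<theta>) * indicator {0<..} \<theta> *
        (\<integral>\<^sup>+y. ennreal (heat_kernel ((t - s) powr \<alpha> * \<theta>) (x - y)) * ennreal_pow (v s y) p \<partial>lborel) \<partial>lborel)"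
      unfolding S_op_def by (simp add: mult_ac)
    have hm: "(\<lambda>\<theta>. \<integral>\<^sup>+y. ennreal (heat_kernel ((t - s) powr \<alpha> * \<theta>) (x - y)) * ennreal_pow (v s y) p \<partial>lborel) \<in> borel_measurable borel"
    proof -
      have [measurable]: "(\<lambda>i. heat_kernel ((t - s) powr \<alpha> * fst i) (x - snd i)) \<in> borel_measurable (borel \<Otimes>\<^sub>M (lborel :: (real ^ 'n) measure))"
        by (rule measurable_heat_kernel_comp) measurable
      show ?thesis by (rule lborel.borel_measurable_nn_integral) (unfold split_beta, measurable)
    qed
    have "(\<integral>\<^sup>+\<theta>. (\<integral>\<^sup>+y. ennreal (heat_kernel ((t - s) powr \<alpha> * \<theta>) (x - y)) *
     (ennreal (\<theta> * subordination_density \<alpha> \<theta>) * indicator {0<..} \<theta> * (?W * ennreal_pow (v s y) p)) \<partial>lborel) \<partial>lborel) =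
     (\<integral>\<^sup>+\<theta>. ?W * (ennreal (\<theta> * subordination_density \<alpha> \<theta>) * indicator {0<..} \<theta> *
        (\<integral>\<^sup>+y. ennreal (heat_kernel ((t - s) powr \<alpha> * \<theta>) (x - y)) * ennreal_pow (v s y) p \<partial>lborel)) \<partial>lborel)"
    proof (intro nn_integral_cong)
      fix \<theta> :: real
      show "(\<integral>\<^sup>+y. ennreal (heat_kernel ((t - s) powr \<alpha> * \<theta>) (x - y)) *
     (ennreal (\<theta> * subordination_density \<alpha> \<theta>) * indicator {0<..} \<theta> * (?W * ennreal_pow (v s y) p)) \<partial>lborel) =
     ?W * (ennreal (\<theta> * subordination_density \<alpha> \<theta>) * indicator {0<..} \<theta> *
        (\<integral>\<^sup>+y. ennreal (heat_kernel ((t - s) powr \<alpha> * \<theta>) (x - y)) * ennreal_pow (v s y) p \<partial>lborel))"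
        unfolding mult.assoc[symmetric, of ?W]
        by (subst nn_integral_cmult[symmetric], measurable) (intro nn_integral_cong, simp add: mult_ac)
    qed
    also have "\<dots> = ?W * S_op \<alpha> (t - s) (density lborel (\<lambda>y. ennreal_pow (v s y) p)) x"
      unfolding S using hm by (intro nn_integral_cmult) measurable
    also have "\<dots> = ennreal ((t - s) powr (\<alpha> - 1)) *
      S_op \<alpha> (t - s) (density lborel (\<lambda>y. ennreal_pow (v s y) p)) x * indicator {0<..<t} s"
      by (simp add: mult_ac)
    finally show "(\<integral>\<^sup>+\<theta>. (\<integral>\<^sup>+y. ennreal (heat_kernel ((t - s) powr \<alpha> * \<theta>) (x - y)) *
     (ennreal (\<theta> * subordination_density \<alpha> \<theta>) * indicator {0<..} \<theta> * (?W * ennreal_pow (v s y) p)) \<partial>lborel) \<partial>lborel) =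
     ennreal ((t - s) powr (\<alpha> - 1)) *
      S_op \<alpha> (t - s) (density lborel (\<lambda>y. ennreal_pow (v s y) p)) x * indicator {0<..<t} s" .
  qed
  finally show ?thesis ..
qed

end

section \<open>Local bounds for the two terms of the integral equation\<close>

context fractional_heat begin

lemma P_op_eq:
  "P_op \<alpha> t \<mu> x = (\<integral>\<^sup>+(\<theta>, y). ennreal (heat_kernel (t powr \<alpha> * \<theta>) (x - y)) *
    (ennreal (subordination_density \<alpha> \<theta>) * indicator {0<..} \<theta>) \<partial>(lborel \<Otimes>\<^sub>M \<mu>))"
proof -
  interpret m: sigma_finite_measure \<mu> by (rule \<mu>)
  have hk1 [measurable]: "(\<lambda>y. heat_kernel c (x - y)) \<in> borel_measurable \<mu>" for c
    by (rule measurable_heat_kernel_comp) measurable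
  have hk [measurable]: "(\<lambda>i. heat_kernel (t powr \<alpha> * fst i) (x - snd i)) \<in> borel_measurable (lborel \<Otimes>\<^sub>M \<mu>)"
    by (rule measurable_heat_kernel_comp) measurable
  define f where "f = (\<lambda>i. ennreal (heat_kernel (t powr \<alpha> * fst i) (x - snd i)) *
    (ennreal (subordination_density \<alpha> (fst i)) * indicator {0<..} (fst i)))"
  have fm: "f \<in> borel_measurable (lborel \<Otimes>\<^sub>M \<mu>)" unfolding f_def by measurable
  have "P_op \<alpha> t \<mu> x = (\<integral>\<^sup>+\<theta>. (\<integral>\<^sup>+y. f (\<theta>, y) \<partial>\<mu>) \<partial>lborel)"
    unfolding P_op_def heat_op_def
  proof (intro nn_integral_cong)
    fix \<theta> :: real
    have "(\<integral>\<^sup>+y. f (\<theta>, y) \<partial>\<mu>) = (\<integral>\<^sup>+y. ennreal (heat_kernel (t powr \<alpha> * \<theta>) (x - y)) \<partial>\<mu>) *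
      (ennreal (subordination_density \<alpha> \<theta>) * indicator {0<..} \<theta>)"
      unfolding f_def fst_conv snd_conv by (rule nn_integral_multc) measurable
    then show "ennreal (subordination_density \<alpha> \<theta>) * (\<integral>\<^sup>+y. ennreal (heat_kernel (t powr \<alpha> * \<theta>) (x - y)) \<partial>\<mu>) * indicator {0<..} \<theta> =
      (\<integral>\<^sup>+y. f (\<theta>, y) \<partial>\<mu>)" by (simp add: mult_ac)
  qed
  also have "\<dots> = integral\<^sup>N (lborel \<Otimes>\<^sub>M \<mu>) f" by (rule m.nn_integral_fst[OF fm])
  finally show ?thesis unfolding f_def split_beta' .
qed

lemma measurable_P_op: "(\<lambda>(t, x). P_op \<alpha> t \<mu> x) \<in> borel_measurable (borel \<Otimes>\<^sub>M borel)"
proof -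
  interpret m: sigma_finite_measure \<mu> by (rule \<mu>)
  interpret lm: pair_sigma_finite "lborel :: real measure" \<mu> by unfold_locales
  have sf: "sigma_finite_measure ((lborel :: real measure) \<Otimes>\<^sub>M \<mu>)" by unfold_locales
  have hk [measurable]: "(\<lambda>i. heat_kernel (fst (fst i) powr \<alpha> * fst (snd i)) (snd (fst i) - snd (snd i)))
     \<in> borel_measurable ((borel \<Otimes>\<^sub>M borel) \<Otimes>\<^sub>M (lborel \<Otimes>\<^sub>M \<mu>))"
    by (rule measurable_heat_kernel_comp) measurable
  show ?thesis unfolding P_op_eq split_beta'
    by (rule sigma_finite_measure.borel_measurable_nn_integral[OF sf]) (unfold split_beta', measurable)
qed

text \<open>\<open>subordinated_local_bound\<close> with a single time t: counting measure on
  \<open>unit\<close> stands in for the time integral and has total mass 1.\<close>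

lemma P_op_local_bound:
  assumes t: "0 < t" "t \<le> T" and M: "0 < M" "\<And>w. emeasure \<mu> (ball w (T powr (\<alpha> / 2))) \<le> ennreal M"
  shows "(\<integral>\<^sup>+x\<in>ball z (T powr (\<alpha> / 2)). ennreal_pow (P_op \<alpha> t \<mu> x) p \<partial>lborel) \<le>
    ennreal ((C0 * C1 * D * (t powr (- (\<alpha> * a)) * M)) powr p)"
proof -
  interpret m: sigma_finite_measure \<mu> by (rule \<mu>)
  interpret lm: pair_sigma_finite "lborel :: real measure" \<mu> by unfold_locales
  have sf: "sigma_finite_measure ((lborel :: real measure) \<Otimes>\<^sub>M \<mu>)" by unfold_locales
  let ?U = "count_space (UNIV :: unit set)"
  have sU: "sigma_finite_measure ?U" by (rule sigma_finite_measure_count_space)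
  have hb: "(\<integral>\<^sup>+\<theta>\<in>{0<..}. ennreal (subordination_density \<alpha> \<theta>) * ennreal (\<theta> powr - a * exp (2 * \<theta>)) \<partial>lborel) \<le> ennreal D"
  proof -
    have "(\<integral>\<^sup>+\<theta>\<in>{0<..}. ennreal (subordination_density \<alpha> \<theta>) * ennreal (\<theta> powr - a * exp (2 * \<theta>)) \<partial>lborel) \<le>
      (\<integral>\<^sup>+\<theta>\<in>{0<..}. ennreal (subordination_density \<alpha> \<theta>) * ennreal (\<theta> powr - a * exp (3 * \<theta>)) \<partial>lborel)"
      by (intro nn_integral_mono) (auto simp: indicator_def intro!: mult_left_mono ennreal_leI)
    then show ?thesis using h_bound by (rule order_trans)
  qed
  have eq: "P_op \<alpha> t \<mu> x = (\<integral>\<^sup>+(s, \<theta>, y). ennreal (heat_kernel (t powr \<alpha> * \<theta>) (x - y)) *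
     (ennreal (subordination_density \<alpha> \<theta>) * indicator {0<..} \<theta> * 1) \<partial>(?U \<Otimes>\<^sub>M (lborel \<Otimes>\<^sub>M \<mu>)))" for x
  proof -
    have [measurable]: "(\<lambda>i. heat_kernel (t powr \<alpha> * fst (snd i)) (x - snd (snd i))) \<in> borel_measurable (?U \<Otimes>\<^sub>M (lborel \<Otimes>\<^sub>M \<mu>))"
      by (rule measurable_heat_kernel_comp) measurable
    define f where "f = (\<lambda>i::unit \<times> real \<times> (real ^ 'n). ennreal (heat_kernel (t powr \<alpha> * fst (snd i)) (x - snd (snd i))) *
      (ennreal (subordination_density \<alpha> (fst (snd i))) * indicator {0<..} (fst (snd i))))"
    have fm: "f \<in> borel_measurable (?U \<Otimes>\<^sub>M (lborel \<Otimes>\<^sub>M \<mu>))" unfolding f_def by measurable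
    have "P_op \<alpha> t \<mu> x = (\<integral>\<^sup>+s. (\<integral>\<^sup>+j. f (s, j) \<partial>(lborel \<Otimes>\<^sub>M \<mu>)) \<partial>?U)"
      unfolding f_def P_op_eq split_beta' by (simp add: nn_integral_count_space_finite)
    also have "\<dots> = integral\<^sup>N (?U \<Otimes>\<^sub>M (lborel \<Otimes>\<^sub>M \<mu>)) f"
      by (rule sigma_finite_measure.nn_integral_fst[OF sf fm])
    finally show ?thesis unfolding f_def split_beta' by simp
  qed
  show ?thesis unfolding eq
  proof (rule subordinated_local_bound[OF sU \<mu> sets_\<mu>, where mass = "\<lambda>_. ennreal M"])
    show "(\<integral>\<^sup>+y\<in>ball w (T powr (\<alpha> / 2)). 1 \<partial>\<mu>) \<le> ennreal M" for w
      using M(2)[of w] by (simp add: sets_\<mu>)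
    show "(\<integral>\<^sup>+s. ennreal (t powr (- (\<alpha> * a))) * ennreal M \<partial>?U) \<le> ennreal (t powr (- (\<alpha> * a)) * M)"
      using M(1) by (simp add: nn_integral_count_space_finite ennreal_mult)
  qed (use hb t M(1) in auto)
qed

text \<open>The mass of v(s)^p on balls is at most (A s^(-\<alpha>a))^p, and the kernel contributes
  (t-s)^(\<alpha>-1) (t-s)^(-\<alpha>a). Scaling s = tu turns the time integral into the Beta
  integral bounded by B, times the stated power of t.\<close>

lemma duhamel_local_bound:
  assumes t: "0 < t" "t \<le> T" and A: "0 < A"
    and v: "(\<lambda>(s, y). v s y) \<in> borel_measurable (borel \<Otimes>\<^sub>M borel)"
    and vA: "\<And>s w. 0 < s \<Longrightarrow> s < t \<Longrightarrow> (\<integral>\<^sup>+y\<in>ball w (T powr (\<alpha> / 2)). ennreal_pow (v s y) p \<partial>lborel) \<le> ennreal ((A * s powr (- (\<alpha> * a))) powr p)"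
    and B: "0 < B" "(\<integral>\<^sup>+u\<in>{0<..<1}. ennreal (u powr (- (p * (\<alpha> * a))) * (1 - u) powr (\<alpha> - \<alpha> * a - 1)) \<partial>lborel) \<le> ennreal B"
  shows "(\<integral>\<^sup>+x\<in>ball z (T powr (\<alpha> / 2)). ennreal_pow (duhamel v t x) p \<partial>lborel) \<le>
    ennreal ((C0 * C1 * D * (A powr p * B * t powr (\<alpha> - \<alpha> * a - p * (\<alpha> * a)))) powr p)"
  unfolding duhamel_def
proof (rule subordinated_local_bound[where r = "\<lambda>s. t - s" and
     mass = "\<lambda>s. ennreal ((t - s) powr (\<alpha> - 1)) * indicator {0<..<t} s * ennreal ((A * s powr (- (\<alpha> * a))) powr p)"])
  have vm: "(\<lambda>i. v (fst i) (snd i)) \<in> borel_measurable (lborel \<Otimes>\<^sub>M borel)"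
    using v by (rule measurable_comp2) measurable
  then show "(\<lambda>(s, y). ennreal ((t - s) powr (\<alpha> - 1)) * indicator {0<..<t} s * ennreal_pow (v s y) p) \<in> borel_measurable (lborel \<Otimes>\<^sub>M borel)"
    unfolding split_beta' by measurable
  show "0 < t - s \<and> t - s \<le> T" if "ennreal ((t - s) powr (\<alpha> - 1)) * indicator {0<..<t} s * ennreal_pow (v s y) p \<noteq> 0" for s y
    using that t by (auto simp: indicator_def split: if_splits)
  show "(\<integral>\<^sup>+\<theta>\<in>{0<..}. ennreal (\<theta> * subordination_density \<alpha> \<theta>) * ennreal (\<theta> powr - a * exp (2 * \<theta>)) \<partial>lborel) \<le> ennreal D"
  proof -
    have "(\<integral>\<^sup>+\<theta>\<in>{0<..}. ennreal (\<theta> * subordination_density \<alpha> \<theta>) * ennreal (\<theta> powr - a * exp (2 * \<theta>)) \<partial>lborel) \<le>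
      (\<integral>\<^sup>+\<theta>\<in>{0<..}. ennreal (subordination_density \<alpha> \<theta>) * ennreal (\<theta> powr - a * exp (3 * \<theta>)) \<partial>lborel)"
    proof (intro nn_integral_mono)
      fix \<theta> :: real
      have "ennreal (\<theta> * subordination_density \<alpha> \<theta>) * ennreal (\<theta> powr - a * exp (2 * \<theta>)) \<le>
        ennreal (subordination_density \<alpha> \<theta>) * ennreal (\<theta> powr - a * exp (3 * \<theta>))" if \<theta>: "0 < \<theta>"
      proof -
        \<comment> \<open>The factor \<theta> of S_\<alpha> is absorbed by passing from
          e^(2\<theta>) to e^(3\<theta>).\<close>
        have "\<theta> \<le> exp \<theta>" using exp_ge_add_one_self[of \<theta>] by linarith
        then have "\<theta> * exp (2 * \<theta>) \<le> exp \<theta> * exp (2 * \<theta>)" by (intro mult_right_mono) auto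
        also have "\<dots> = exp (3 * \<theta>)" unfolding exp_add[symmetric] by simp
        finally have le: "\<theta> powr - a * (\<theta> * exp (2 * \<theta>)) \<le> \<theta> powr - a * exp (3 * \<theta>)" by (intro mult_left_mono) auto
        have "ennreal (\<theta> * subordination_density \<alpha> \<theta>) * ennreal (\<theta> powr - a * exp (2 * \<theta>)) =
          ennreal (subordination_density \<alpha> \<theta>) * ennreal (\<theta> powr - a * (\<theta> * exp (2 * \<theta>)))"
          using \<theta> by (simp add: ennreal_mult' mult_ac)
        also have "\<dots> \<le> ennreal (subordination_density \<alpha> \<theta>) * ennreal (\<theta> powr - a * exp (3 * \<theta>))"
          by (intro mult_left_mono ennreal_leI le) auto
        finally show ?thesis .
      qed
      then show "ennreal (\<theta> * subordination_density \<alpha> \<theta>) * ennreal (\<theta> powr - a * exp (2 * \<theta>)) * indicator {0<..} \<theta> \<le>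
        ennreal (subordination_density \<alpha> \<theta>) * ennreal (\<theta> powr - a * exp (3 * \<theta>)) * indicator {0<..} \<theta>"
        by (auto simp: indicator_def)
    qed
    then show ?thesis using h_bound by (rule order_trans)
  qed
  show "(\<integral>\<^sup>+y\<in>ball w (T powr (\<alpha> / 2)). ennreal ((t - s) powr (\<alpha> - 1)) * indicator {0<..<t} s * ennreal_pow (v s y) p \<partial>lborel) \<le>
    ennreal ((t - s) powr (\<alpha> - 1)) * indicator {0<..<t} s * ennreal ((A * s powr (- (\<alpha> * a))) powr p)" for s w
  proof (cases "0 < s \<and> s < t")
    case True
    have [measurable]: "v s \<in> borel_measurable borel"
      using measurable_compose[OF measurable_Pair1' v, of s] by simp
    have "(\<integral>\<^sup>+y\<in>ball w (T powr (\<alpha> / 2)). ennreal ((t - s) powr (\<alpha> - 1)) * indicator {0<..<t} s * ennreal_pow (v s y) p \<partial>lborel) =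
      ennreal ((t - s) powr (\<alpha> - 1)) * indicator {0<..<t} s * (\<integral>\<^sup>+y\<in>ball w (T powr (\<alpha> / 2)). ennreal_pow (v s y) p \<partial>lborel)"
      by (subst nn_integral_cmult[symmetric]) (auto simp: mult_ac intro!: borel_measurable_times_ennreal borel_measurable_indicator)
    also have "\<dots> \<le> ennreal ((t - s) powr (\<alpha> - 1)) * indicator {0<..<t} s * ennreal ((A * s powr (- (\<alpha> * a))) powr p)"
      using True by (intro mult_left_mono vA) auto
    finally show ?thesis .
  qed auto
  show "(\<integral>\<^sup>+s. ennreal ((t - s) powr (- (\<alpha> * a))) *
    (ennreal ((t - s) powr (\<alpha> - 1)) * indicator {0<..<t} s * ennreal ((A * s powr (- (\<alpha> * a))) powr p)) \<partial>lborel) \<le>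
    ennreal (A powr p * B * t powr (\<alpha> - \<alpha> * a - p * (\<alpha> * a)))"
  proof -
    let ?f = "\<lambda>s. ennreal ((t - s) powr (- (\<alpha> * a))) *
    (ennreal ((t - s) powr (\<alpha> - 1)) * indicator {0<..<t} s * ennreal ((A * s powr (- (\<alpha> * a))) powr p))"
    have "(\<integral>\<^sup>+s. ?f s \<partial>lborel) = ennreal \<bar>t\<bar> * (\<integral>\<^sup>+u. ?f (0 + t * u) \<partial>lborel)"
      using t by (intro nn_integral_real_affine) auto
    also have "(\<integral>\<^sup>+u. ?f (0 + t * u) \<partial>lborel) = (\<integral>\<^sup>+u. ennreal (A powr p * t powr (\<alpha> - \<alpha> * a - p * (\<alpha> * a) - 1)) *
       (ennreal (u powr (- (p * (\<alpha> * a))) * (1 - u) powr (\<alpha> - \<alpha> * a - 1)) * indicator {0<..<1} u) \<partial>lborel)"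
    proof (intro nn_integral_cong)
      fix u :: real
      show "?f (0 + t * u) = ennreal (A powr p * t powr (\<alpha> - \<alpha> * a - p * (\<alpha> * a) - 1)) *
       (ennreal (u powr (- (p * (\<alpha> * a))) * (1 - u) powr (\<alpha> - \<alpha> * a - 1)) * indicator {0<..<1} u)"
      proof (cases "0 < u \<and> u < 1")
        case True
        have e: "t - (0 + t * u) = t * (1 - u)" by (simp add: algebra_simps)
        have i: "0 + t * u \<in> {0<..<t}" using True t by simp
        have "(t * (1 - u)) powr (- (\<alpha> * a)) * ((t * (1 - u)) powr (\<alpha> - 1) * (A * (t * u) powr (- (\<alpha> * a))) powr p) =
          A powr p * (t powr (- (\<alpha> * a)) * t powr (\<alpha> - 1) * t powr (- (p * (\<alpha> * a)))) *
          (u powr (- (p * (\<alpha> * a))) * ((1 - u) powr (- (\<alpha> * a)) * (1 - u) powr (\<alpha> - 1)))"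
          by (simp add: powr_mult powr_powr mult_ac)
        also have "t powr (- (\<alpha> * a)) * t powr (\<alpha> - 1) * t powr (- (p * (\<alpha> * a))) = t powr (\<alpha> - \<alpha> * a - p * (\<alpha> * a) - 1)"
          unfolding powr_add[symmetric] by (simp add: algebra_simps)
        also have "(1 - u) powr (- (\<alpha> * a)) * (1 - u) powr (\<alpha> - 1) = (1 - u) powr (\<alpha> - \<alpha> * a - 1)"
          unfolding powr_add[symmetric] by (simp add: algebra_simps)
        finally show ?thesis using True i unfolding e by (simp flip: ennreal_mult)
      next
        case False
        then have "0 + t * u \<notin> {0<..<t}" using t by (auto simp: zero_less_mult_iff)
        with False show ?thesis by auto
      qed
    qed
    also have "\<dots> = ennreal (A powr p * t powr (\<alpha> - \<alpha> * a - p * (\<alpha> * a) - 1)) *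
      (\<integral>\<^sup>+u\<in>{0<..<1}. ennreal (u powr (- (p * (\<alpha> * a))) * (1 - u) powr (\<alpha> - \<alpha> * a - 1)) \<partial>lborel)"
      by (intro nn_integral_cmult) measurable
    also have "ennreal \<bar>t\<bar> * (ennreal (A powr p * t powr (\<alpha> - \<alpha> * a - p * (\<alpha> * a) - 1)) *
      (\<integral>\<^sup>+u\<in>{0<..<1}. ennreal (u powr (- (p * (\<alpha> * a))) * (1 - u) powr (\<alpha> - \<alpha> * a - 1)) \<partial>lborel)) \<le>
      ennreal \<bar>t\<bar> * (ennreal (A powr p * t powr (\<alpha> - \<alpha> * a - p * (\<alpha> * a) - 1)) * ennreal B)"
      by (intro mult_left_mono B) auto
    also have "\<dots> = ennreal (A powr p * B * (t * t powr (\<alpha> - \<alpha> * a - p * (\<alpha> * a) - 1)))"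
      using t B by (simp add: mult_ac flip: ennreal_mult)
    also have "t * t powr (\<alpha> - \<alpha> * a - p * (\<alpha> * a) - 1) = t powr (\<alpha> - \<alpha> * a - p * (\<alpha> * a))"
      using t by (simp add: powr_diff)
    finally show ?thesis .
  qed
  show "0 < A powr p * B * t powr (\<alpha> - \<alpha> * a - p * (\<alpha> * a))" using A B t by simp
qed (auto intro: lborel.sigma_finite_measure_axioms)

section \<open>Monotone iteration\<close>

text \<open>The start at 0 makes the sequence increasing and the base case of the local bound
  trivial.\<close>

primrec picard :: "nat \<Rightarrow> real \<Rightarrow> real ^ 'n \<Rightarrow> ennreal" where
  "picard 0 = (\<lambda>t x. 0)"
| "picard (Suc n) = (\<lambda>t x. P_op \<alpha> t \<mu> x + ennreal \<alpha> * duhamel (picard n) t x)"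

lemma measurable_picard: "(\<lambda>(t, x). picard n t x) \<in> borel_measurable (borel \<Otimes>\<^sub>M borel)"
proof (induction n)
  case (Suc n)
  note [measurable] = measurable_duhamel[OF Suc] measurable_P_op
  show ?case by simp
qed simp

lemma duhamel_mono:
  assumes "\<And>s y. v s y \<le> w s y" shows "duhamel v t x \<le> duhamel w t x"
  unfolding duhamel_def using p assms
  by (intro nn_integral_mono) (auto intro!: mult_left_mono ennreal_pow_mono)

lemma incseq_picard: "incseq (\<lambda>n. picard n t x)"
proof -
  have "picard n t x \<le> picard (Suc n) t x" for n t x
  proof (induction n arbitrary: t x)
    case (Suc n)
    show ?case unfolding picard.simps(2)
      by (intro add_left_mono mult_left_mono duhamel_mono) (use Suc in auto)
  qed simp
  then show ?thesis by (rule incseq_SucI)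
qed

text \<open>Monotone convergence, after the supremum is moved through the power by
  \<open>ennreal_pow_SUP\<close>.\<close>

lemma duhamel_SUP:
  "duhamel (\<lambda>s y. SUP n. picard n s y) t x = (SUP n. duhamel (picard n) t x)"
proof -
  let ?W = "\<lambda>n i. ennreal (heat_kernel ((t - fst i) powr \<alpha> * fst (snd i)) (x - snd (snd i))) *
     (ennreal (fst (snd i) * subordination_density \<alpha> (fst (snd i))) * indicator {0<..} (fst (snd i)) *
       (ennreal ((t - fst i) powr (\<alpha> - 1)) * indicator {0<..<t} (fst i) * ennreal_pow (picard n (fst i) (snd (snd i))) p))"
  have "duhamel (\<lambda>s y. SUP n. picard n s y) t x = (\<integral>\<^sup>+i. (SUP n. ?W n i) \<partial>(lborel \<Otimes>\<^sub>M (lborel \<Otimes>\<^sub>M lborel)))"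
    unfolding duhamel_def split_beta' using p by (simp add: ennreal_pow_SUP SUP_mult_left_ennreal)
  also have "\<dots> = (SUP n. \<integral>\<^sup>+i. ?W n i \<partial>(lborel \<Otimes>\<^sub>M (lborel \<Otimes>\<^sub>M lborel)))"
  proof (rule nn_integral_monotone_convergence_SUP)
    show "incseq ?W" unfolding incseq_def le_fun_def using p
      by (auto intro!: mult_left_mono ennreal_pow_mono incseqD[OF incseq_picard])
    show "?W n \<in> borel_measurable (lborel \<Otimes>\<^sub>M (lborel \<Otimes>\<^sub>M lborel))" for n
      by (rule measurable_duhamel_integrand[OF measurable_picard]) measurable
  qed
  also have "\<dots> = (SUP n. duhamel (picard n) t x)" unfolding duhamel_def split_beta' ..
  finally show ?thesis .
qed

text \<open>The same A survives every step: each of the two terms has local L^p norm at most (A/4)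
  t^(-\<alpha>a), the inequality for the power of a sum costs 2^p, and adding two equal bounds costs
  2 <= 2^p, in total 4^p. Since p a <= 1, the factor t^(\<alpha>-p\<alpha>a) is at most its value at
  T.\<close>

lemma picard_local_bound:
  assumes A: "0 < A" and M: "0 < M" "\<And>w. emeasure \<mu> (ball w (T powr (\<alpha> / 2))) \<le> ennreal M"
    and B: "0 < B" "(\<integral>\<^sup>+u\<in>{0<..<1}. ennreal (u powr (- (p * (\<alpha> * a))) * (1 - u) powr (\<alpha> - \<alpha> * a - 1)) \<partial>lborel) \<le> ennreal B"
    and pa: "p * a \<le> 1"
    and lin: "C0 * C1 * D * M \<le> A / 4"
    and nonlin: "C0 * C1 * D * (A powr p * B * T powr (\<alpha> - p * (\<alpha> * a))) \<le> A / 4"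
  shows "0 < t \<Longrightarrow> t < T \<Longrightarrow>
    (\<integral>\<^sup>+x\<in>ball z (T powr (\<alpha> / 2)). ennreal_pow (picard n t x) p \<partial>lborel) \<le> ennreal ((A * t powr (- (\<alpha> * a))) powr p)"
proof (induction n arbitrary: t z)
  case 0
  have z: "ennreal_pow 0 p = 0" using ennreal_pow_ennreal[of 0 p] by simp
  show ?case by (simp add: z)
next
  case (Suc n)
  define b where "b = t powr (- (\<alpha> * a))"
  have b: "0 < b" using Suc by (simp add: b_def)
  let ?Q = "ball z (T powr (\<alpha> / 2))"
  have 1: "(\<integral>\<^sup>+x\<in>?Q. ennreal_pow (P_op \<alpha> t \<mu> x) p \<partial>lborel) \<le> ennreal ((A / 4 * b) powr p)"
  proof -
    have "C0 * C1 * D * (t powr (- (\<alpha> * a)) * M) = (C0 * C1 * D * M) * b" by (simp add: b_def)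
    also have "\<dots> \<le> A / 4 * b" using b by (intro mult_right_mono lin) auto
    finally have "(C0 * C1 * D * (t powr (- (\<alpha> * a)) * M)) powr p \<le> (A / 4 * b) powr p"
      using p C D M by (intro powr_mono2) auto
    then show ?thesis using P_op_local_bound[of t M z] Suc M by (auto intro: order_trans ennreal_leI)
  qed
  have 2: "(\<integral>\<^sup>+x\<in>?Q. ennreal_pow (duhamel (picard n) t x) p \<partial>lborel) \<le> ennreal ((A / 4 * b) powr p)"
  proof -
    have pos: "0 \<le> \<alpha> - p * (\<alpha> * a)"
    proof -
      have "\<alpha> * (p * a) \<le> \<alpha> * 1" using pa \<alpha> by (intro mult_left_mono) auto
      then show ?thesis by (simp add: mult_ac)
    qed
    have "t powr (\<alpha> - \<alpha> * a - p * (\<alpha> * a)) = b * t powr (\<alpha> - p * (\<alpha> * a))"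
      unfolding b_def powr_add[symmetric] by (simp add: algebra_simps)
    also have "\<dots> \<le> b * T powr (\<alpha> - p * (\<alpha> * a))"
      using b Suc pos by (intro mult_left_mono powr_mono2) auto
    finally have "C0 * C1 * D * (A powr p * B * t powr (\<alpha> - \<alpha> * a - p * (\<alpha> * a))) \<le>
        C0 * C1 * D * (A powr p * B * (b * T powr (\<alpha> - p * (\<alpha> * a))))"
      using C D B by (intro mult_left_mono) auto
    also have "\<dots> = C0 * C1 * D * (A powr p * B * T powr (\<alpha> - p * (\<alpha> * a))) * b" by simp
    also have "\<dots> \<le> A / 4 * b" using b by (intro mult_right_mono nonlin) auto
    finally have "(C0 * C1 * D * (A powr p * B * t powr (\<alpha> - \<alpha> * a - p * (\<alpha> * a)))) powr p \<le> (A / 4 * b) powr p"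
      using p C D B by (intro powr_mono2) auto
    moreover have "(\<integral>\<^sup>+x\<in>?Q. ennreal_pow (duhamel (picard n) t x) p \<partial>lborel) \<le>
        ennreal ((C0 * C1 * D * (A powr p * B * t powr (\<alpha> - \<alpha> * a - p * (\<alpha> * a)))) powr p)"
      using Suc by (intro duhamel_local_bound A B measurable_picard) auto
    ultimately show ?thesis by (auto intro: order_trans ennreal_leI)
  qed
  have [measurable]: "(\<lambda>x. P_op \<alpha> t \<mu> x) \<in> borel_measurable borel" "(\<lambda>x. duhamel (picard n) t x) \<in> borel_measurable borel"
    using measurable_compose[OF measurable_Pair1' measurable_P_op, of t]
      measurable_compose[OF measurable_Pair1' measurable_duhamel[OF measurable_picard[of n]], of t] by simp_all
  have [measurable]: "?Q \<in> sets borel" by simp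
  have "(\<integral>\<^sup>+x\<in>?Q. ennreal_pow (picard (Suc n) t x) p \<partial>lborel) \<le>
    (\<integral>\<^sup>+x. ennreal (2 powr p) * (ennreal_pow (P_op \<alpha> t \<mu> x) p * indicator ?Q x + ennreal_pow (duhamel (picard n) t x) p * indicator ?Q x) \<partial>lborel)"
  proof (intro nn_integral_mono)
    fix x
    have "ennreal \<alpha> * duhamel (picard n) t x \<le> 1 * duhamel (picard n) t x"
      using \<alpha> by (intro mult_right_mono) (auto simp: ennreal_le_1)
    then have "ennreal_pow (picard (Suc n) t x) p \<le> ennreal_pow (P_op \<alpha> t \<mu> x + duhamel (picard n) t x) p"
      unfolding picard.simps(2) using p by (intro ennreal_pow_mono add_left_mono) auto
    also have "\<dots> \<le> ennreal (2 powr p) * (ennreal_pow (P_op \<alpha> t \<mu> x) p + ennreal_pow (duhamel (picard n) t x) p)"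
      using p by (intro ennreal_pow_add_le) auto
    finally show "ennreal_pow (picard (Suc n) t x) p * indicator ?Q x \<le>
       ennreal (2 powr p) * (ennreal_pow (P_op \<alpha> t \<mu> x) p * indicator ?Q x + ennreal_pow (duhamel (picard n) t x) p * indicator ?Q x)"
      by (auto simp: indicator_def)
  qed
  also have "\<dots> = ennreal (2 powr p) * ((\<integral>\<^sup>+x\<in>?Q. ennreal_pow (P_op \<alpha> t \<mu> x) p \<partial>lborel) + (\<integral>\<^sup>+x\<in>?Q. ennreal_pow (duhamel (picard n) t x) p \<partial>lborel))"
    by (simp add: nn_integral_cmult nn_integral_add)
  also have "\<dots> \<le> ennreal (2 powr p) * (ennreal ((A / 4 * b) powr p) + ennreal ((A / 4 * b) powr p))"
    by (intro mult_left_mono add_mono 1 2) auto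
  also have "\<dots> = ennreal (2 powr p * (2 * (A / 4 * b) powr p))"
    by (simp flip: ennreal_plus ennreal_mult)
  also have "\<dots> \<le> ennreal ((A * b) powr p)"
  proof (rule ennreal_leI)
    have "(2::real) powr 1 \<le> 2 powr p" using p by (intro powr_mono) auto
    then have "2 powr p * (2 * (A / 4 * b) powr p) \<le> 2 powr p * (2 powr p * (A / 4 * b) powr p)"
      by (intro mult_left_mono mult_right_mono) auto
    also have "\<dots> = (2 * (2 * (A / 4 * b))) powr p" by (simp only: powr_mult)
    also have "\<dots> = (A * b) powr p" by simp
    finally show "2 powr p * (2 * (A / 4 * b) powr p) \<le> (A * b) powr p" .
  qed
  finally show ?case unfolding b_def .
qed

text \<open>The supremum satisfies the equation at every point, with values in [0, infinity]. Only
  finiteness is an almost-everywhere statement; it comes from an exponentially weighted L^p bound at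
  each time.\<close>

lemma solution_exists:
  assumes A: "0 < A" and M: "0 < M" "\<And>w. emeasure \<mu> (ball w (T powr (\<alpha> / 2))) \<le> ennreal M"
    and B: "0 < B" "(\<integral>\<^sup>+u\<in>{0<..<1}. ennreal (u powr (- (p * (\<alpha> * a))) * (1 - u) powr (\<alpha> - \<alpha> * a - 1)) \<partial>lborel) \<le> ennreal B"
    and pa: "p * a \<le> 1"
    and lin: "C0 * C1 * D * M \<le> A / 4"
    and nonlin: "C0 * C1 * D * (A powr p * B * T powr (\<alpha> - p * (\<alpha> * a))) \<le> A / 4"
  shows "\<exists>u. is_solution \<alpha> p (ereal T) \<mu> u"
proof -
  define U where "U = (\<lambda>t x. SUP n. picard n t x)"
  define R where "R = T powr (\<alpha> / 2)"
  have R: "0 < R" using T by (simp add: R_def)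
  note pm [measurable] = measurable_picard
  have Um [measurable]: "(\<lambda>(t, x). U t x) \<in> borel_measurable (borel \<Otimes>\<^sub>M borel)"
    unfolding U_def split_beta' using measurable_picard by (intro borel_measurable_SUP) (auto simp: split_beta')
  have Ueq: "U t x = P_op \<alpha> t \<mu> x + ennreal \<alpha> * duhamel U t x" for t x
  proof -
    have "U t x = (SUP n. picard (Suc n) t x)"
    proof (rule antisym)
      show "U t x \<le> (SUP n. picard (Suc n) t x)" unfolding U_def
        by (intro SUP_mono) (use incseq_SucD[OF incseq_picard] in blast)
      show "(SUP n. picard (Suc n) t x) \<le> U t x" unfolding U_def
        by (intro SUP_least SUP_upper) auto
    qed
    also have "\<dots> = P_op \<alpha> t \<mu> x + (SUP n. ennreal \<alpha> * duhamel (picard n) t x)"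
      unfolding picard.simps(2) by (intro ennreal_SUP_add_right[symmetric]) auto
    also have "(SUP n. ennreal \<alpha> * duhamel (picard n) t x) = ennreal \<alpha> * duhamel U t x"
      unfolding U_def duhamel_SUP by (simp add: SUP_mult_left_ennreal)
    finally show ?thesis .
  qed
  have fin: "AE x in lborel. U t x < \<infinity>" if t: "0 < t" "t < T" for t
  proof -
    have [measurable]: "U t \<in> borel_measurable borel" "\<And>n. picard n t \<in> borel_measurable borel"
      using measurable_compose[OF measurable_Pair1' Um, of t] measurable_compose[OF measurable_Pair1' measurable_picard, of t]
      by simp_all
    have bd: "(\<integral>\<^sup>+x\<in>ball w R. ennreal_pow (U t x) p \<partial>lborel) \<le> ennreal ((A * t powr (- (\<alpha> * a))) powr p)" for w
    proof -
      have [measurable]: "ball w R \<in> sets borel" by simp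
      have "(\<integral>\<^sup>+x\<in>ball w R. ennreal_pow (U t x) p \<partial>lborel) = (\<integral>\<^sup>+x. (SUP n. ennreal_pow (picard n t x) p * indicator (ball w R) x) \<partial>lborel)"
        unfolding U_def using p by (intro nn_integral_cong) (simp add: ennreal_pow_SUP SUP_mult_right_ennreal)
      also have "\<dots> = (SUP n. \<integral>\<^sup>+x\<in>ball w R. ennreal_pow (picard n t x) p \<partial>lborel)"
        by (rule nn_integral_monotone_convergence_SUP)
           (use p in \<open>auto simp: incseq_def le_fun_def intro!: mult_right_mono ennreal_pow_mono incseqD[OF incseq_picard]\<close>)
      also have "\<dots> \<le> ennreal ((A * t powr (- (\<alpha> * a))) powr p)"
        unfolding R_def by (intro SUP_least picard_local_bound[OF A M B pa lin nonlin] t)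
      finally show ?thesis .
    qed
    \<comment> \<open>One integral with a strictly positive weight gives finiteness on the whole
      space, without a countable cover by balls.\<close>
    have "(\<integral>\<^sup>+y. ennreal (exp (- norm (y - 0) / R)) * ennreal_pow (U t y) p \<partial>lborel) \<le>
      ennreal C0 * ennreal ((A * t powr (- (\<alpha> * a))) powr p)"
      using bd R by (intro C0 lborel.sigma_finite_measure_axioms) auto
    also have "\<dots> < \<infinity>" by (simp add: ennreal_mult_less_top)
    finally have "AE y in lborel. ennreal (exp (- norm (y - 0) / R)) * ennreal_pow (U t y) p \<noteq> \<infinity>"
      by (intro nn_integral_PInf_AE) auto
    then show ?thesis
    proof eventually_elim
      fix y assume *: "ennreal (exp (- norm (y - 0) / R)) * ennreal_pow (U t y) p \<noteq> \<infinity>"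
      show "U t y < \<infinity>"
      proof (rule ccontr)
        assume "\<not> U t y < \<infinity>"
        then have "U t y = top" by (simp add: less_top[symmetric])
        with * show False by (simp add: ennreal_mult_eq_top_iff)
      qed
    qed
  qed
  \<comment> \<open>From almost every x at each time to almost every (t, x), by joint
    measurability.\<close>
  have "AE q in lborel \<Otimes>\<^sub>M lborel. 0 < fst q \<and> fst q < T \<longrightarrow> U (fst q) (snd q) < \<infinity>"
  proof (rule lborel_pair.AE_pair_measure)
    show "{q \<in> space (lborel \<Otimes>\<^sub>M lborel). 0 < fst q \<and> fst q < T \<longrightarrow> U (fst q) (snd q) < \<infinity>} \<in> sets (lborel \<Otimes>\<^sub>M lborel)"
      using Um unfolding split_beta' by measurable
    show "AE t in lborel. AE x in lborel. 0 < fst (t, x) \<and> fst (t, x) < T \<longrightarrow> U (fst (t, x)) (snd (t, x)) < \<infinity>"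
      using fin by auto
  qed
  then have finAE: "AE q in lborel. 0 < fst q \<and> fst q < T \<longrightarrow> U (fst q) (snd q) < \<infinity>"
    unfolding lborel_prod .
  have "is_solution \<alpha> p (ereal T) \<mu> U"
    unfolding is_solution_def
  proof
    have "(\<lambda>(t, x). U t x) \<in> borel_measurable borel" using Um unfolding borel_prod .
    then show "(\<lambda>(t, x). U t x) \<in> borel_measurable (restrict_space borel ({t. 0 < t \<and> ereal t < ereal T} \<times> UNIV))"
      by (rule measurable_restrict_space1)
    show "AE (t, x) in lborel. 0 < t \<and> ereal t < ereal T \<longrightarrow> U t x < \<infinity> \<and>
      U t x = P_op \<alpha> t \<mu> x + ennreal \<alpha> * (\<integral>\<^sup>+ s\<in>{0<..<t}. ennreal ((t - s) powr (\<alpha> - 1)) *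
             S_op \<alpha> (t - s) (density lborel (\<lambda>y. ennreal_pow (U s y) p)) x \<partial>lborel)"
      unfolding split_beta' duhamel_eq[OF Um] Ueq[symmetric] using finAE by simp
  qed
  then show ?thesis by blast
qed

end

section \<open>Choice of the constants and their behaviour as \<alpha> tends to 1\<close>

lemma radon_measure_sigma_finite:
  fixes \<mu> :: "'a::euclidean_space measure"
  assumes "radon_measure \<mu>" shows "sigma_finite_measure \<mu>"
proof
  have s: "sets \<mu> = sets borel" and K: "\<And>K. compact K \<Longrightarrow> emeasure \<mu> K < \<infinity>"
    using assms by (auto simp: radon_measure_def)
  have "(\<Union>n. cball (0::'a) (real n)) = space \<mu>"
    using sets_eq_imp_space_eq[OF s] real_arch_simple by (auto simp: dist_norm)
  then show "\<exists>A. countable A \<and> A \<subseteq> sets \<mu> \<and> \<Union> A = space \<mu> \<and> (\<forall>a\<in>A. emeasure \<mu> a \<noteq> \<infinity>)"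
    using K by (intro exI[of _ "range (\<lambda>n. cball (0::'a) (real n))"]) (auto simp: s less_top[symmetric])
qed

text \<open>On (0, 1) a larger exponent gives a smaller power, so one Beta value serves all
  exponents above two thresholds. This makes the constants uniform in \<alpha>.\<close>

lemma nn_integral_Beta_bound:
  assumes "0 < x0" "0 < (y0::real)" "y0 - 1 \<le> c" "x0 - 1 \<le> d"
  shows "(\<integral>\<^sup>+u\<in>{0<..<1}. ennreal (u powr c * (1 - u) powr d) \<partial>lborel) \<le> ennreal (Beta y0 x0)"
proof -
  have "(\<integral>\<^sup>+u\<in>{0<..<1}. ennreal (u powr c * (1 - u) powr d) \<partial>lborel) \<le>
    (\<integral>\<^sup>+u\<in>{0..1}. ennreal (u powr (y0 - 1) * (1 - u) powr (x0 - 1)) \<partial>lborel)"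
  proof (intro nn_integral_mono)
    fix u :: real
    have "u powr c * (1 - u) powr d \<le> u powr (y0 - 1) * (1 - u) powr (x0 - 1)" if "0 < u" "u < 1"
      using that assms by (intro mult_mono powr_mono') auto
    then show "ennreal (u powr c * (1 - u) powr d) * indicator {0<..<1} u \<le>
      ennreal (u powr (y0 - 1) * (1 - u) powr (x0 - 1)) * indicator {0..1} u"
      by (auto simp: indicator_def intro!: ennreal_leI)
  qed
  also have "\<dots> = ennreal (Beta y0 x0)"
    by (rule nn_integral_has_integral_lebesgue'[OF _ has_integral_Beta_real]) (use assms in auto)
  finally show ?thesis .
qed

text \<open>The argument of type \<open>'n itself\<close> carries the dimension, which the real
  arguments do not determine.\<close>

definition admissible_constant :: "'n::finite itself \<Rightarrow> real \<Rightarrow> real \<Rightarrow> real \<Rightarrow> bool" where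
  "admissible_constant (n :: 'n itself) p \<alpha> \<gamma> \<longleftrightarrow>
    (\<forall>T>0. \<forall>\<mu> :: (real ^ 'n) measure. radon_measure \<mu> \<longrightarrow>
       (SUP z. emeasure \<mu> (ball z (T powr (\<alpha> / 2))))
         \<le> ennreal (\<gamma> * T powr (\<alpha> * (real CARD('n) / 2 - 1 / (p - 1)))) \<longrightarrow>
       (\<exists>u. is_solution \<alpha> p (ereal T) \<mu> u))"

lemma admissible_constant_antimono:
  assumes "admissible_constant n p \<alpha> \<gamma>" "\<delta> \<le> \<gamma>"
  shows "admissible_constant n p \<alpha> \<delta>"
  unfolding admissible_constant_def
proof (intro allI impI)
  fix T :: real and \<mu> :: "(real ^ 'a) measure"
  assume T: "0 < T" and \<mu>: "radon_measure \<mu>"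
  let ?e = "T powr (\<alpha> * (real CARD('a) / 2 - 1 / (p - 1)))"
  assume le: "(SUP z. emeasure \<mu> (ball z (T powr (\<alpha> / 2)))) \<le> ennreal (\<delta> * ?e)"
  have "ennreal (\<delta> * ?e) \<le> ennreal (\<gamma> * ?e)"
    using assms(2) by (intro ennreal_leI mult_right_mono) auto
  with le have "(SUP z. emeasure \<mu> (ball z (T powr (\<alpha> / 2)))) \<le> ennreal (\<gamma> * ?e)" by (rule order_trans)
  with assms(1) T \<mu> show "\<exists>u. is_solution \<alpha> p (ereal T) \<mu> u"
    unfolding admissible_constant_def by blast
qed

text \<open>Here \<open>b\<close> is p a, and 1 - \<alpha>b is the Beta parameter at u = 0. Its
  lower bound \<open>y0\<close> isolates what may degenerate: for b < 1 it can be 1 - b for all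
  \<alpha>, while for b = 1 only 1 - \<alpha> is left.\<close>

lemma admissible_constant_uniform:
  fixes p :: real and n :: "'n::finite itself"
  defines "b \<equiv> real CARD('n) * (p - 1) / 2"
  assumes p: "1 < p" and b: "b \<le> 1" and \<alpha>0: "0 < \<alpha>0" "\<alpha>0 < 1" and y0: "0 < y0"
  shows "\<exists>\<gamma>>0. \<forall>\<alpha>\<in>{\<alpha>0..<1}. y0 \<le> 1 - \<alpha> * b \<longrightarrow> admissible_constant n p \<alpha> \<gamma>"
proof -
  define a where "a = real CARD('n) * (p - 1) / (2 * p)"
  have pa: "p * a = b" using p by (simp add: a_def b_def)
  have a: "0 \<le> a" "a < 1"
  proof -
    show "0 \<le> a" using p by (simp add: a_def)
    have "p * a < p * 1" using pa b p by linarith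
    then show "a < 1" using p by simp
  qed
  obtain C0 where C0': "C0 > 0 \<and> (\<forall>(\<mu> :: (real ^ 'n) measure) f R z M.
     sigma_finite_measure \<mu> \<longrightarrow> sets \<mu> = sets borel \<longrightarrow> f \<in> borel_measurable borel \<longrightarrow> 0 < R \<longrightarrow>
     (\<forall>w. (\<integral>\<^sup>+y\<in>ball w R. f y \<partial>\<mu>) \<le> M) \<longrightarrow>
     (\<integral>\<^sup>+y. ennreal (exp (- norm (y - z) / R)) * f y \<partial>\<mu>) \<le> ennreal C0 * M)"
    using exp_weight_le_local_mass[where 'a = "real ^ 'n"] by (rule exE)
  note C0 = C0'[THEN conjunct1] C0'[THEN conjunct2, THEN spec, THEN spec, THEN spec, THEN spec, THEN spec,
    THEN mp, THEN mp, THEN mp, THEN mp, THEN mp]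
  obtain C1 where C1': "C1 > 0 \<and> (\<forall>\<tau>>0. \<forall>R>0. \<forall>y z :: real ^ 'n.
    (\<integral>\<^sup>+x. ennreal ((heat_kernel \<tau> (x - y) * indicator (ball z R) x) powr p) \<partial>lborel) \<le>
      ennreal ((C1 * \<tau> powr - a * exp (2 * \<tau> / R\<^sup>2) * exp (- norm (y - z) / R)) powr p))"
    using heat_kernel_power_local[OF p, where 'n = 'n] unfolding a_def by (rule exE)
  note C1 = C1'[THEN conjunct1] C1'[THEN conjunct2, THEN spec, THEN mp, THEN spec, THEN mp, THEN spec, THEN spec]
  obtain D where D: "0 < D" "\<And>\<alpha>. \<alpha> \<in> {\<alpha>0..<1} \<Longrightarrow>
    (\<integral>\<^sup>+\<theta>\<in>{0<..}. ennreal (subordination_density \<alpha> \<theta>) * ennreal (\<theta> powr - a * exp (3 * \<theta>)) \<partial>lborel) \<le> ennreal D"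
    using subordination_density_bound[OF \<alpha>0 a, of 3] by auto
  \<comment> \<open>The Beta parameter at u = 1 is \<alpha>(1-a), which is smallest at \<alpha> =
    \<open>\<alpha>0\<close>.\<close>
  define x0 where "x0 = \<alpha>0 * (1 - a)"
  have x0: "0 < x0" using \<alpha>0 a by (simp add: x0_def)
  define B where "B = Beta y0 x0"
  have B: "0 < B" unfolding B_def Beta_def using x0 y0 by (auto intro!: divide_pos_pos mult_pos_pos Gamma_real_pos)
  define K where "K = C0 * C1 * D"
  have K: "0 < K" using C0 C1 D by (simp add: K_def)
  \<comment> \<open>With A = 4 K \<gamma> T^e the linear condition holds with equality, and the
    nonlinear one becomes (4 K \<gamma>)^(p-1) <= 1/(4 K B); this \<gamma> gives equality there
    too.\<close>
  define \<gamma> where "\<gamma> = (1 / (4 * K * B)) powr (1 / (p - 1)) / (4 * K)"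
  have \<gamma>: "0 < \<gamma>" using K B by (simp add: \<gamma>_def)
  have "admissible_constant n p \<alpha> \<gamma>" if \<alpha>: "\<alpha> \<in> {\<alpha>0..<1}" and y: "y0 \<le> 1 - \<alpha> * b" for \<alpha>
    unfolding admissible_constant_def
  proof (intro allI impI)
    fix T :: real and \<mu> :: "(real ^ 'n) measure"
    assume T: "0 < T" and rm: "radon_measure \<mu>"
    define e where "e = \<alpha> * (real CARD('n) / 2 - 1 / (p - 1))"
    assume "(SUP z. emeasure \<mu> (ball z (T powr (\<alpha> / 2)))) \<le> ennreal (\<gamma> * T powr (\<alpha> * (real CARD('n) / 2 - 1 / (p - 1))))"
    then have mass: "emeasure \<mu> (ball w (T powr (\<alpha> / 2))) \<le> ennreal (\<gamma> * T powr e)" for w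
      unfolding e_def by (meson SUP_upper UNIV_I order_trans)
    have x0_le: "\<alpha>0 * (1 - a) \<le> \<alpha> * (1 - a)" using \<alpha> a by (intro mult_right_mono) auto
    interpret fractional_heat \<alpha> p a T D C0 C1 \<mu>
    proof (rule fractional_heat.intro)
      show "0 < \<alpha>" "\<alpha> < 1" "sets \<mu> = sets borel"
        using \<alpha> \<alpha>0 rm by (auto simp: radon_measure_def)
      show "(\<integral>\<^sup>+x. ennreal ((heat_kernel \<tau> (x - y) * indicator (ball z R) x) powr p) \<partial>lborel) \<le>
        ennreal ((C1 * \<tau> powr - a * exp (2 * \<tau> / R\<^sup>2) * exp (- norm (y - z) / R)) powr p)"
        if "0 < \<tau>" "0 < R" for \<tau> R and y z :: "real ^ 'n"
        using that by (rule C1(2))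
    qed (fact p a_def T D(1) C0(1) C1(1) D(2)[OF \<alpha>] radon_measure_sigma_finite[OF rm] | rule C0(2), assumption+)+
    define A where "A = 4 * K * (\<gamma> * T powr e)"
    have A: "0 < A" using K \<gamma> T by (simp add: A_def)
    \<comment> \<open>Scaling: with the exponent e of the mass condition all powers of T cancel in
      the nonlinear condition.\<close>
    have ee: "e * (p - 1) + (\<alpha> - p * (\<alpha> * a)) = 0"
    proof -
      have "p * (\<alpha> * a) = \<alpha> * b" using pa by (simp add: mult_ac)
      moreover have "1 / (p - 1) * (p - 1) = 1" using p by simp
      then have "e * (p - 1) = \<alpha> * b - \<alpha>" unfolding e_def b_def
        by (simp only: right_diff_distrib left_diff_distrib mult.assoc) (simp add: algebra_simps)
      ultimately show ?thesis by linarith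
    qed
    show "\<exists>u. is_solution \<alpha> p (ereal T) \<mu> u"
    proof (rule solution_exists)
      show "0 < A" by (rule A)
      show "0 < \<gamma> * T powr e" using \<gamma> T by simp
      show "emeasure \<mu> (ball w (T powr (\<alpha> / 2))) \<le> ennreal (\<gamma> * T powr e)" for w by (rule mass)
      show "0 < B" by (rule B)
      show "(\<integral>\<^sup>+u\<in>{0<..<1}. ennreal (u powr (- (p * (\<alpha> * a))) * (1 - u) powr (\<alpha> - \<alpha> * a - 1)) \<partial>lborel) \<le> ennreal B"
        unfolding B_def
      proof (rule nn_integral_Beta_bound[OF x0 y0])
        have "p * (\<alpha> * a) = \<alpha> * b" using pa by (simp add: mult_ac)
        then show "y0 - 1 \<le> - (p * (\<alpha> * a))" using y by linarith
        show "x0 - 1 \<le> \<alpha> - \<alpha> * a - 1" using x0_le by (simp add: x0_def algebra_simps)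
      qed
      show "p * a \<le> 1" using pa b by simp
      show "C0 * C1 * D * (\<gamma> * T powr e) \<le> A / 4" by (simp add: A_def K_def)
      show "C0 * C1 * D * (A powr p * B * T powr (\<alpha> - p * (\<alpha> * a))) \<le> A / 4"
      proof -
        have "A powr (p - 1) = (4 * K * \<gamma>) powr (p - 1) * T powr (e * (p - 1))"
          unfolding A_def by (simp add: powr_mult powr_powr mult.assoc)
        also have "4 * K * \<gamma> = (1 / (4 * K * B)) powr (1 / (p - 1))" using K by (simp add: \<gamma>_def)
        also have "((1 / (4 * K * B)) powr (1 / (p - 1))) powr (p - 1) = 1 / (4 * K * B)"
          unfolding powr_powr using p K B by simp
        finally have "A powr (p - 1) * T powr (\<alpha> - p * (\<alpha> * a)) = 1 / (4 * K * B) * (T powr (e * (p - 1)) * T powr (\<alpha> - p * (\<alpha> * a)))"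
          by simp
        also have "T powr (e * (p - 1)) * T powr (\<alpha> - p * (\<alpha> * a)) = 1"
          unfolding powr_add[symmetric] ee using T by simp
        finally have 1: "A powr (p - 1) * T powr (\<alpha> - p * (\<alpha> * a)) = 1 / (4 * K * B)" by simp
        have "A powr p = A * A powr (p - 1)" using A by (simp add: powr_diff)
        then have "K * (A powr p * B * T powr (\<alpha> - p * (\<alpha> * a))) = K * B * A * (A powr (p - 1) * T powr (\<alpha> - p * (\<alpha> * a)))"
          by simp
        also have "\<dots> = A / 4" unfolding 1 using K B by simp
        finally show ?thesis unfolding K_def by simp
      qed
    qed
  qed
  with \<gamma> show ?thesis by blast
qed

lemma Limsup_at_left_eventually_const:
  assumes "\<And>\<alpha>. \<alpha> \<in> {1/2..<1} \<Longrightarrow> f \<alpha> = (c::real)"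
  shows "Limsup (at_left (1::real)) (\<lambda>\<alpha>. ereal (f \<alpha>)) = ereal c"
proof -
  have "\<forall>\<^sub>F \<alpha> in at_left (1::real). ereal (f \<alpha>) = ereal c"
    unfolding eventually_at_left_field using assms by (intro exI[of _ "1/2"]) auto
  then have "Limsup (at_left (1::real)) (\<lambda>\<alpha>. ereal (f \<alpha>)) = Limsup (at_left (1::real)) (\<lambda>_. ereal c)"
    by (rule Limsup_eq)
  then show ?thesis by (simp add: Limsup_const)
qed

theorem theorem1p2:
  fixes p :: real
  assumes "1 < p" and "p \<le> fujita_exponent CARD('n::finite)"
  shows "\<exists>\<gamma>\<^sub>2 :: real \<Rightarrow> real.
    (\<forall>\<alpha>\<in>{0<..<1}. 0 < \<gamma>\<^sub>2 \<alpha>) \<and>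
    (\<forall>\<alpha>\<in>{0<..<1}. \<forall>T>0. \<forall>\<mu> :: (real ^ 'n) measure.
       radon_measure \<mu> \<longrightarrow>
       (SUP z. emeasure \<mu> (ball z (T powr (\<alpha> / 2))))
         \<le> ennreal (\<gamma>\<^sub>2 \<alpha> * T powr (\<alpha> * (real CARD('n) / 2 - 1 / (p - 1)))) \<longrightarrow>
       (\<exists>u. is_solution \<alpha> p (ereal T) \<mu> u)) \<and>
    (p < fujita_exponent CARD('n) \<longrightarrow>
       0 < Limsup (at_left 1) (\<lambda>\<alpha>. ereal (\<gamma>\<^sub>2 \<alpha>)) \<and>
       Limsup (at_left 1) (\<lambda>\<alpha>. ereal (\<gamma>\<^sub>2 \<alpha>)) < \<infinity>) \<and>
    (p = fujita_exponent CARD('n) \<longrightarrow>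
       (\<exists>\<gamma>\<^sub>2' :: real \<Rightarrow> real.
          (\<forall>\<alpha>\<in>{0<..<1}. \<gamma>\<^sub>2 \<alpha> \<le> \<gamma>\<^sub>2' \<alpha> * (1 - \<alpha>) powr (real CARD('n) / 2)) \<and>
          0 < Limsup (at_left 1) (\<lambda>\<alpha>. ereal (\<gamma>\<^sub>2' \<alpha>)) \<and>
          Limsup (at_left 1) (\<lambda>\<alpha>. ereal (\<gamma>\<^sub>2' \<alpha>)) < \<infinity>))"
proof -
  define n :: "'n itself" where "n = TYPE('n)"
  define N where "N = real CARD('n)"
  have N: "0 < N" by (simp add: N_def)
  define b where "b = N * (p - 1) / 2"
  have b: "b \<le> 1" "0 < b" using assms N unfolding b_def fujita_exponent_def N_def[symmetric]
    by (simp_all add: field_simps)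
  \<comment> \<open>For a single \<alpha> take \<open>\<alpha>0\<close> = \<alpha> and
    \<open>y0\<close> = 1 - \<alpha>, which also covers the critical case b = 1.\<close>
  have adm: "\<exists>\<gamma>>0. admissible_constant n p \<alpha> \<gamma>" if "\<alpha> \<in> {0<..<1}" for \<alpha>
  proof -
    have "\<alpha> * b \<le> \<alpha> * 1" using b that by (intro mult_left_mono) auto
    then show ?thesis
      using admissible_constant_uniform[of p \<alpha> "1 - \<alpha>" n] that assms b unfolding b_def N_def by fastforce
  qed
  then obtain G where G: "\<And>\<alpha>. \<alpha> \<in> {0<..<1} \<Longrightarrow> 0 < G \<alpha>" "\<And>\<alpha>. \<alpha> \<in> {0<..<1} \<Longrightarrow> admissible_constant n p \<alpha> (G \<alpha>)"
    by metis
  show ?thesis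
  proof (cases "p < fujita_exponent CARD('n)")
    case True
    then have b1: "b < 1" using N unfolding b_def fujita_exponent_def N_def[symmetric] by (simp add: field_simps)
    \<comment> \<open>As b < 1, \<open>y0\<close> = 1 - b yields one constant for all \<alpha> >=
      1/2.\<close>
    obtain \<gamma> where \<gamma>: "0 < \<gamma>" "\<And>\<alpha>. \<alpha> \<in> {1/2..<1} \<Longrightarrow> admissible_constant n p \<alpha> \<gamma>"
    proof -
      obtain \<gamma> where "0 < \<gamma>" and *: "\<forall>\<alpha>\<in>{1/2..<1}. 1 - b \<le> 1 - \<alpha> * b \<longrightarrow> admissible_constant n p \<alpha> \<gamma>"
        using admissible_constant_uniform[of p "1/2" "1 - b" n] assms b b1 unfolding b_def N_def by auto
      moreover have "\<alpha> * b \<le> 1 * b" if "\<alpha> \<in> {1/2..<1}" for \<alpha> using that b by (intro mult_right_mono) auto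
      ultimately show ?thesis using that by simp
    qed
    \<comment> \<open>Constant near 1, so that the limit superior is \<open>\<gamma>\<close>; for
      smaller \<alpha> the individual constants are kept.\<close>
    define g where "g = (\<lambda>\<alpha>. if 1 / 2 \<le> \<alpha> then \<gamma> else G \<alpha>)"
    have "Limsup (at_left (1::real)) (\<lambda>\<alpha>. ereal (g \<alpha>)) = ereal \<gamma>"
      by (rule Limsup_at_left_eventually_const) (simp add: g_def)
    moreover have "0 < g \<alpha>" "admissible_constant n p \<alpha> (g \<alpha>)" if "\<alpha> \<in> {0<..<1}" for \<alpha>
      using \<gamma> G[OF that] that unfolding g_def by auto
    ultimately show ?thesis using \<gamma>(1) True unfolding admissible_constant_def
      by (intro exI[of _ g]) auto
  next
    case False
    \<comment> \<open>An admissible constant may be decreased, so capping it at (1-\<alpha>)^(N/2)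
      gives the bound of (ii) with \<open>\<gamma>\<^sub>2'\<close> = 1.\<close>
    define g where "g = (\<lambda>\<alpha>. min (G \<alpha>) ((1 - \<alpha>) powr (N / 2)))"
    have g: "0 < g \<alpha>" "admissible_constant n p \<alpha> (g \<alpha>)" if "\<alpha> \<in> {0<..<1}" for \<alpha>
    proof -
      show "0 < g \<alpha>" using G(1)[OF that] that by (simp add: g_def)
      show "admissible_constant n p \<alpha> (g \<alpha>)"
        by (rule admissible_constant_antimono[OF G(2)[OF that]]) (simp add: g_def)
    qed
    have "Limsup (at_left (1::real)) (\<lambda>\<alpha>. ereal ((\<lambda>_. 1) \<alpha>)) = ereal 1"
      by (rule Limsup_at_left_eventually_const) simp
    then have 3: "\<exists>\<gamma>\<^sub>2' :: real \<Rightarrow> real.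
          (\<forall>\<alpha>\<in>{0<..<1}. g \<alpha> \<le> \<gamma>\<^sub>2' \<alpha> * (1 - \<alpha>) powr (real CARD('n) / 2)) \<and>
          0 < Limsup (at_left 1) (\<lambda>\<alpha>. ereal (\<gamma>\<^sub>2' \<alpha>)) \<and>
          Limsup (at_left 1) (\<lambda>\<alpha>. ereal (\<gamma>\<^sub>2' \<alpha>)) < \<infinity>"
      by (intro exI[of _ "\<lambda>_. 1"]) (auto simp: g_def N_def)
    show ?thesis
      using g(1) g(2)[unfolded admissible_constant_def] 3 False by (intro exI[of _ g]) blast
  qed
qed

end
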